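(* For any $\epsilon>0$, there is a polynomial time two-sided distribution-free adaptive algorithm for $\epsilon$-testing $s$-Term Unate $r$-DNF that makes $\tilde O(rs^2/\epsilon)$ queries.
   Context: Boolean functions $f:\{0,1\}^n\to\{0,1\}$ are accessed through a membership-query oracle that returns $f(x)$ for a queried $x$. For a distribution $\mathcal D$ on $\{0,1\}^n$, $f$ is $\epsilon$-far from a class $C$ with respect to $\mathcal D$ if $\Pr_{x\sim\mathcal D}[f(x)\neq g(x)]\ge\epsilon$ for every $g\in C$. A two-sided distribution-free adaptive algorithm for $\epsilon$-testing $C$ is a randomized algorithm that, given $\epsilon$, membership-query access to an arbitrary $f$, and an oracle returning independent samples from an arbitrary unknown distribution $\mathcal D$ on $\{0,1\}^n$, chooses queries possibly adaptively and, for every $\mathcal D$, accepts with probability at least $2/3$ if $f\in C$ and rejects with probability at least $2/3$ if $f$ is $\epsilon$-far from every function in $C$ with respect to $\mathcal D$. Queries count membership queries and samples. $\tilde O(T)$ means $O(T\cdot\mathrm{poly}(\log T))$. For a variable $x$ and $\xi\in\{0,1\}$, $x^\xi=x$ if $\xi=0$ and $x^\xi=\overline{x}$ if $\xi=1$. A function $f$ is in $s$-Term Unate $r$-DNF if there is $\xi\in\{0,1\}^n$ such that $f(x_1^{\xi_1},\dots,x_n^{\xi_n})$ is a disjunction of at most $s$ terms, each a conjunction of at most $r$ unnegated variables. *)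

theory Defs
  imports "HOL-Probability.Probability"
begin

text \<open>A point of the cube is a list of length \<^term>\<open>n\<close>. Boolean functions are total on
  \<^typ>\<open>bool list\<close>, but only their values on the cube are ever used.\<close>

type_synonym boolfun = "bool list \<Rightarrow> bool"

definition cube :: "nat \<Rightarrow> bool list set" where
  "cube n = {x. length x = n}"

definition term_monotone_dnf :: "nat \<Rightarrow> nat \<Rightarrow> nat \<Rightarrow> boolfun set" where
  "term_monotone_dnf n s r =
     {f. \<exists>T :: nat set set.
           finite T \<and> card T \<le> s \<and> (\<forall>t\<in>T. t \<subseteq> {..<n} \<and> card t \<le> r) \<and>
           (\<forall>x\<in>cube n. f x \<longleftrightarrow> (\<exists>t\<in>T. \<forall>i\<in>t. x ! i))}"

definition literals :: "bool list \<Rightarrow> bool list \<Rightarrow> bool list" where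
  "literals \<xi> x = map2 (\<lambda>b v. if b then \<not> v else v) \<xi> x"

definition term_unate_dnf :: "nat \<Rightarrow> nat \<Rightarrow> nat \<Rightarrow> boolfun set" where
  "term_unate_dnf n s r =
     {f. \<exists>\<xi>\<in>cube n. (\<lambda>x. f (literals \<xi> x)) \<in> term_monotone_dnf n s r}"

definition far_from :: "bool list pmf \<Rightarrow> real \<Rightarrow> boolfun \<Rightarrow> boolfun set \<Rightarrow> bool" where
  "far_from D \<epsilon> f C \<longleftrightarrow> (\<forall>g\<in>C. measure_pmf.prob D {x. f x \<noteq> g x} \<ge> \<epsilon>)"

text \<open>The machine model is a random access machine, written as a while language. A store consists
  of named arrays of natural numbers (a program mentions only finitely many names, and a scalar is
  the entry with index 0). Every command costs one time unit. The only arithmetic is addition and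
  truncated subtraction, so that one step lengthens numbers by at most a constant number of bits
  (depending on the program) and the unit cost measure is polynomially equivalent to Turing machine
  time; a multiplication instruction would destroy this.\<close>

type_synonym store = "string \<Rightarrow> nat \<Rightarrow> nat"

datatype aexp =
    Const nat
  | Elem string aexp
  | Plus aexp aexp
  | Minus aexp aexp

datatype bexp =
    Less aexp aexp
  | Neg bexp
  | Conj bexp bexp

datatype com =
    Skip
  | Assign string aexp aexp
  | Seq com com
  | Cond bexp com com
  | While bexp com
  | Flip string
  | Query string string
  | Sample string

primrec aval :: "aexp \<Rightarrow> store \<Rightarrow> nat" where
  "aval (Const k) \<sigma> = k"
| "aval (Elem x e) \<sigma> = \<sigma> x (aval e \<sigma>)"
| "aval (Plus e1 e2) \<sigma> = aval e1 \<sigma> + aval e2 \<sigma>"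
| "aval (Minus e1 e2) \<sigma> = aval e1 \<sigma> - aval e2 \<sigma>"

primrec bval :: "bexp \<Rightarrow> store \<Rightarrow> bool" where
  "bval (Less e1 e2) \<sigma> \<longleftrightarrow> aval e1 \<sigma> < aval e2 \<sigma>"
| "bval (Neg b) \<sigma> \<longleftrightarrow> \<not> bval b \<sigma>"
| "bval (Conj b1 b2) \<sigma> \<longleftrightarrow> bval b1 \<sigma> \<and> bval b2 \<sigma>"

definition put :: "string \<Rightarrow> nat \<Rightarrow> nat \<Rightarrow> store \<Rightarrow> store" where
  "put x i v \<sigma> = \<sigma>(x := (\<sigma> x)(i := v))"

text \<open>Points of the cube are exchanged with the oracles through the first \<^term>\<open>n\<close> entries
  of an array.\<close>

definition get_point :: "nat \<Rightarrow> string \<Rightarrow> store \<Rightarrow> bool list" where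
  "get_point n x \<sigma> = map (\<lambda>i. \<sigma> x i \<noteq> 0) [0..<n]"

definition put_point :: "nat \<Rightarrow> string \<Rightarrow> bool list \<Rightarrow> store \<Rightarrow> store" where
  "put_point n x v \<sigma> = \<sigma>(x := (\<lambda>i. if i < n then of_bool (v ! i) else \<sigma> x i))"

text \<open>A configuration consists of the commands still to be executed, the store, and the number of
  oracle calls (membership queries and samples) made so far. It has halted when no command is
  left. The program sees \<^term>\<open>f\<close> and \<^term>\<open>D\<close> only through \<^const>\<open>Query\<close> and
  \<^const>\<open>Sample\<close>.\<close>

type_synonym config = "com list \<times> store \<times> nat"

fun step :: "nat \<Rightarrow> boolfun \<Rightarrow> bool list pmf \<Rightarrow> config \<Rightarrow> config pmf" where
  "step n f D ([], \<sigma>, q) = return_pmf ([], \<sigma>, q)"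
| "step n f D (Skip # K, \<sigma>, q) = return_pmf (K, \<sigma>, q)"
| "step n f D (Assign x i e # K, \<sigma>, q) = return_pmf (K, put x (aval i \<sigma>) (aval e \<sigma>) \<sigma>, q)"
| "step n f D (Seq c1 c2 # K, \<sigma>, q) = return_pmf (c1 # c2 # K, \<sigma>, q)"
| "step n f D (Cond b c1 c2 # K, \<sigma>, q) = return_pmf ((if bval b \<sigma> then c1 else c2) # K, \<sigma>, q)"
| "step n f D (While b c # K, \<sigma>, q) =
     return_pmf (if bval b \<sigma> then c # While b c # K else K, \<sigma>, q)"
| "step n f D (Flip x # K, \<sigma>, q) =
     map_pmf (\<lambda>b. (K, put x 0 (of_bool b) \<sigma>, q)) (bernoulli_pmf (1 / 2))"
| "step n f D (Query y x # K, \<sigma>, q) =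
     return_pmf (K, put y 0 (of_bool (f (get_point n x \<sigma>))) \<sigma>, Suc q)"
| "step n f D (Sample x # K, \<sigma>, q) = map_pmf (\<lambda>v. (K, put_point n x v \<sigma>, Suc q)) D"

primrec run :: "nat \<Rightarrow> boolfun \<Rightarrow> bool list pmf \<Rightarrow> nat \<Rightarrow> config \<Rightarrow> config pmf" where
  "run n f D 0 cfg = return_pmf cfg"
| "run n f D (Suc t) cfg = bind_pmf (step n f D cfg) (run n f D t)"

fun halted :: "config \<Rightarrow> bool" where
  "halted (K, \<sigma>, q) \<longleftrightarrow> K = []"

fun oracle_calls :: "config \<Rightarrow> nat" where
  "oracle_calls (K, \<sigma>, q) = q"

fun accepting :: "config \<Rightarrow> bool" where
  "accepting (K, \<sigma>, q) \<longleftrightarrow> K = [] \<and> \<sigma> ''accept'' 0 = 1"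

fun rejecting :: "config \<Rightarrow> bool" where
  "rejecting (K, \<sigma>, q) \<longleftrightarrow> K = [] \<and> \<sigma> ''accept'' 0 \<noteq> 1"

text \<open>A machine cannot read a real number, so \<^term>\<open>\<epsilon>\<close> is handed to it as a fraction
  \<^term>\<open>a / b\<close>. The fraction may be \<^term>\<open>\<epsilon>\<close> itself; to cover irrational
  \<^term>\<open>\<epsilon>\<close> it may be any lower approximation up to a factor 2.\<close>

definition represents :: "nat \<Rightarrow> nat \<Rightarrow> real \<Rightarrow> bool" where
  "represents a b \<epsilon> \<longleftrightarrow>
     0 < a \<and> 0 < b \<and> real a / real b \<le> \<epsilon> \<and> \<epsilon> \<le> 2 * (real a / real b)"

definition input :: "nat \<Rightarrow> nat \<Rightarrow> nat \<Rightarrow> nat \<Rightarrow> nat \<Rightarrow> store" where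
  "input n s r a b =
     put ''n'' 0 n (put ''s'' 0 s (put ''r'' 0 r (put ''eps'' 0 a (put ''eps'' 1 b (\<lambda>_ _. 0)))))"

text \<open>The bounds \<^term>\<open>t\<close> on time and \<^term>\<open>q\<close> on oracle calls are worst case, over
  all outcomes of the coins and of the samples. Every distribution on the finite cube is a
  \<^type>\<open>pmf\<close>.\<close>

definition is_tester ::
    "com \<Rightarrow> store \<Rightarrow> nat \<Rightarrow> boolfun set \<Rightarrow> real \<Rightarrow> nat \<Rightarrow> nat \<Rightarrow> bool" where
  "is_tester P \<sigma> n C \<epsilon> t q \<longleftrightarrow>
     (\<forall>f D. set_pmf D \<subseteq> cube n \<longrightarrow>
        (let R = run n f D t ([P], \<sigma>, 0) in
           (\<forall>cfg\<in>set_pmf R. halted cfg \<and> oracle_calls cfg \<le> q) \<and>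
           (f \<in> C \<longrightarrow> measure_pmf.prob R {cfg. accepting cfg} \<ge> 2 / 3) \<and>
           (far_from D \<epsilon> f C \<longrightarrow> measure_pmf.prob R {cfg. rejecting cfg} \<ge> 2 / 3)))"

text \<open>The bound \<open>c T (log T)^k\<close> behind the soft-O notation; the shift keeps the logarithm at
  least 1.\<close>

definition soft_bound :: "real \<Rightarrow> nat \<Rightarrow> real \<Rightarrow> real" where
  "soft_bound c k T = c * T * (log 2 (T + 2)) ^ k"

end

theory Submission
  imports Defs
begin

text \<open>The tester distributes the variables randomly over \<open>2 ^ l\<close> blocks; with high
  probability the at most \<open>r s\<close> relevant variables of a unate DNF fall into different blocks.
  As long as clearing the blocks outside a collection of known blocks changes the value at a sample,
  a binary search over the hybrids yields a further block and a point \<open>w\<close> with \<open>f w = 0\<close>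
  that becomes a true point by changes inside this block. Toggling a set \<open>d\<close> of variables
  of the block at \<open>w\<close> then defines a function \<open>G d\<close>, which for a unate DNF is a
  projection to a hidden variable. Whether \<open>G\<close> is close to a projection is tested
  through the ring homomorphism laws, and self-correction of \<open>G\<close> evaluates the hidden
  literal at arbitrary points without identifying the variable. On these hidden literals the tester
  learns the terms like a monotone DNF, by minimising misclassified samples. A hypothesis that
  survives \<open>N\<close> fresh samples is accepted; it is a member of the class, so a far function
  is caught, and a member of the class has at most \<open>s\<close> prime implicants to be learnt.

  All randomness of the analysis is fresh at the point of use, so failure probabilities add up along
  the run. The while program is related to the probabilistic algorithm by couplings.\<close>

section \<open>The abstract algorithm\<close>

text \<open>The count r s^2 / \<epsilon> comes from the second phase: at most s + 1 hypotheses,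
  about 1/\<epsilon> samples for each of them, and up to r s slots evaluated per sample. The first
  phase passes through at most r s + 1 states and stays below this even if every sample is charged
  with a binary search.

  The blocks keep the dimension out of the query count: a search over \<open>2 ^ l\<close> blocks
  costs \<open>l\<close> queries, whereas locating a variable would cost log n. For the same reason
  a hidden variable is never identified, only evaluated.

  The obstacle in the unate case is the unknown orientation: no point is known at which all literals
  are false. Each slot therefore carries its own false witness, which supplies the off-value of its
  literal, and the cleared blocks contribute whatever the value 0 makes of their literals.

  A single number \<open>l\<close>, with \<open>2 ^ l\<close> at least 4 (r s + e)^2 and e about
  1/\<epsilon>, controls block collisions, wrong evaluations of slots and, through N = 40 e l, the
  chance that a bad state is overlooked.\<close>

primrec fm :: "nat \<Rightarrow> (nat \<Rightarrow> 'a \<Rightarrow> 'a pmf) \<Rightarrow> 'a \<Rightarrow> 'a pmf" where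
  "fm 0 B a = return_pmf a"
| "fm (Suc m) B a = bind_pmf (fm m B a) (B m)"

datatype 'a outcome = Pass | Change 'a | Rej

text \<open>\<open>j\<close> counts the passes since the last change of state; the run ends after \<open>N\<close>
  consecutive ones. The fuel \<open>m\<close> is always chosen large enough not to run out.\<close>

primrec stream :: "('a \<Rightarrow> 'a outcome pmf) \<Rightarrow> nat \<Rightarrow> nat \<Rightarrow> 'a \<Rightarrow> nat \<Rightarrow> 'a option pmf" where
  "stream S N 0 a j = return_pmf (Some a)"
| "stream S N (Suc m) a j =
     (if j < N then bind_pmf (S a) (\<lambda>out. case out of
         Pass \<Rightarrow> stream S N m a (Suc j)
       | Change a' \<Rightarrow> stream S N m a' 0
       | Rej \<Rightarrow> return_pmf None)
      else return_pmf (Some a))"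

abbreviation coin :: "bool pmf" where "coin \<equiv> bernoulli_pmf (1 / 2)"

text \<open>Vectors are total functions that stay False from position \<open>n\<close> on, so shifts
  of them are uniform again only after truncation by \<open>cut\<close>. The coordinates are drawn
  one by one, as the machine does with single coins.\<close>

definition rvec :: "nat \<Rightarrow> (nat \<Rightarrow> bool) pmf" where
  "rvec n = fm n (\<lambda>j d. map_pmf (\<lambda>b. d(j := b)) coin) (\<lambda>_. False)"

definition rnum :: "nat \<Rightarrow> nat pmf" where
  "rnum l = fm l (\<lambda>i v. map_pmf (\<lambda>b. v + (if b then 2 ^ i else 0)) coin) 0"

definition rpart :: "nat \<Rightarrow> nat \<Rightarrow> (nat \<Rightarrow> nat) pmf" where
  "rpart n l = fm n (\<lambda>j p. map_pmf (\<lambda>v. p(j := v)) (rnum l)) (\<lambda>_. 0)"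

definition pt :: "nat \<Rightarrow> (nat \<Rightarrow> bool) \<Rightarrow> bool list" where
  "pt n g = map g [0..<n]"

text \<open>As \<open>t\<close> grows from 0, the blocks outside \<open>Bs\<close> are given back
  one at a time. Neighbouring hybrids differ in a single block at most, and once \<open>t\<close>
  exceeds all block numbers nothing is cleared.\<close>

definition hyb :: "(nat \<Rightarrow> nat) \<Rightarrow> nat set \<Rightarrow> nat \<Rightarrow> (nat \<Rightarrow> bool) \<Rightarrow> nat \<Rightarrow> bool" where
  "hyb p Bs t x = (\<lambda>j. x j \<and> (p j \<in> Bs \<or> p j < t))"

definition toggle :: "(nat \<Rightarrow> nat) \<Rightarrow> nat \<times> (nat \<Rightarrow> bool) \<Rightarrow> (nat \<Rightarrow> bool) \<Rightarrow> nat \<Rightarrow> bool" where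
  "toggle p c d = (\<lambda>j. snd c j \<noteq> (d j \<and> p j = fst c))"

definition lin_ok :: "((nat \<Rightarrow> bool) \<Rightarrow> bool) \<Rightarrow> (nat \<Rightarrow> bool) \<Rightarrow> (nat \<Rightarrow> bool) \<Rightarrow> bool" where
  "lin_ok G x y \<longleftrightarrow> G (\<lambda>j. x j \<noteq> y j) = (G x \<noteq> G y)"

text \<open>The product of two random vectors is far from uniform, so its value is read in corrected
  form, through the random mask \<open>z\<close>, rather than directly.\<close>

definition mul_ok ::
    "((nat \<Rightarrow> bool) \<Rightarrow> bool) \<Rightarrow> (nat \<Rightarrow> bool) \<Rightarrow> (nat \<Rightarrow> bool) \<Rightarrow> (nat \<Rightarrow> bool) \<Rightarrow> bool" where
  "mul_ok G x y z \<longleftrightarrow> (G (\<lambda>j. (x j \<and> y j) \<noteq> z j) \<noteq> G z) = (G x \<and> G y)"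

text \<open>The zero map is additive and multiplicative as well; complementing the whole vector
  rules it out.\<close>

definition one_ok :: "((nat \<Rightarrow> bool) \<Rightarrow> bool) \<Rightarrow> (nat \<Rightarrow> bool) \<Rightarrow> bool" where
  "one_ok G z \<longleftrightarrow> G (\<lambda>j. \<not> z j) \<noteq> G z"

definition corr :: "((nat \<Rightarrow> bool) \<Rightarrow> bool) \<Rightarrow> (nat \<Rightarrow> bool) \<Rightarrow> (nat \<Rightarrow> bool) \<Rightarrow> bool" where
  "corr G d z \<longleftrightarrow> G (\<lambda>j. d j \<noteq> z j) \<noteq> G z"

definition trial :: "nat \<Rightarrow> ((nat \<Rightarrow> bool) \<Rightarrow> bool) \<Rightarrow> (nat \<Rightarrow> bool) \<Rightarrow> (bool \<times> bool) pmf" where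
  "trial n G d = bind_pmf (rvec n) (\<lambda>x. bind_pmf (rvec n) (\<lambda>y. map_pmf (\<lambda>z.
     (lin_ok G x y \<and> mul_ok G x y z \<and> one_ok G z, corr G d z)) (rvec n)))"

text \<open>The two flags tell whether all trials passed with value 0, respectively with value 1.\<close>

definition trials ::
    "nat \<Rightarrow> nat \<Rightarrow> ((nat \<Rightarrow> bool) \<Rightarrow> bool) \<Rightarrow> (nat \<Rightarrow> bool) \<Rightarrow> (bool \<times> bool) pmf" where
  "trials n L G d = fm L (\<lambda>_ a. map_pmf (\<lambda>u.
     (fst a \<and> fst u \<and> \<not> snd u, snd a \<and> fst u \<and> snd u)) (trial n G d)) (True, True)"

text \<open>A slot is a known block together with a false point that becomes true by changes inside it.\<close>

type_synonym slots = "(nat \<times> (nat \<Rightarrow> bool)) list"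

locale oracles =
  fixes n :: nat and f :: boolfun and D :: "bool list pmf"
begin

definition ask :: "(nat \<Rightarrow> bool) \<Rightarrow> bool" where
  "ask g = f (pt n g)"

primrec bsearch :: "(nat \<Rightarrow> nat) \<Rightarrow> nat set \<Rightarrow> (nat \<Rightarrow> bool) \<Rightarrow> nat \<Rightarrow> nat \<Rightarrow> nat" where
  "bsearch p Bs x 0 lo = lo"
| "bsearch p Bs x (Suc i) lo = bsearch p Bs x i
     (if ask (hyb p Bs (lo + 2 ^ i) x) = ask (hyb p Bs 0 x) then lo + 2 ^ i else lo)"

text \<open>The value changes between the hybrids \<open>B\<close> and \<open>Suc B\<close>; the
  false one of the two is kept as the witness of the slot.\<close>

definition newslot :: "(nat \<Rightarrow> nat) \<Rightarrow> nat set \<Rightarrow> nat \<Rightarrow> (nat \<Rightarrow> bool) \<Rightarrow> nat \<times> (nat \<Rightarrow> bool)" where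
  "newslot p Bs l x = (let B = bsearch p Bs x l 0 in
     (B, hyb p Bs (if ask (hyb p Bs 0 x) then Suc B else B) x))"

definition stepA :: "nat \<Rightarrow> nat \<Rightarrow> (nat \<Rightarrow> nat) \<Rightarrow> slots \<Rightarrow> slots outcome pmf" where
  "stepA k l p cs = map_pmf (\<lambda>v. let x = (!) v; Bs = fst ` set cs in
     if ask x = ask (hyb p Bs 0 x) then Pass
     else if length cs < k then Change (cs @ [newslot p Bs l x]) else Rej) D"

text \<open>Toggling the witness of a slot by its difference from \<open>x\<close> replaces its
  block by that of \<open>x\<close>; the corrected value there tells whether \<open>x\<close> and
  the witness differ in the hidden variable. The first component drops to False as soon as the
  trials of some slot fail or contradict each other.\<close>

definition evals :: "nat \<Rightarrow> (nat \<Rightarrow> nat) \<Rightarrow> slots \<Rightarrow> (nat \<Rightarrow> bool) \<Rightarrow> (bool \<times> (nat \<Rightarrow> bool)) pmf" where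
  "evals l p cs x = fm (length cs) (\<lambda>v e. map_pmf (\<lambda>a.
       (fst e \<and> (fst a \<or> snd a), (snd e)(v := snd a)))
     (trials n l (\<lambda>d. ask (toggle p (cs ! v) d)) (\<lambda>j. x j \<noteq> snd (cs ! v) j)))
   (True, \<lambda>_. False)"

text \<open>Copying the false point of a slot on its block switches the hidden literal of the slot off.
  The slots where this is not possible without leaving the true points form the new term.\<close>

primrec learn ::
    "(nat \<Rightarrow> nat) \<Rightarrow> slots \<Rightarrow> (nat \<Rightarrow> bool) \<Rightarrow> nat \<Rightarrow> (nat \<Rightarrow> bool) \<times> nat set" where
  "learn p cs x 0 = (x, {})"
| "learn p cs x (Suc v) = (let
     y = fst (learn p cs x v); t = snd (learn p cs x v);
     y' = (\<lambda>j. if p j = fst (cs ! v) then snd (cs ! v) j else y j)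
   in if ask (hyb p (fst ` set cs) 0 y') then (y', t) else (y, insert v t))"

definition holds :: "nat set list \<Rightarrow> (nat \<Rightarrow> bool) \<Rightarrow> bool" where
  "holds ts e \<longleftrightarrow> (\<exists>t\<in>set ts. \<forall>v\<in>t. e v)"

text \<open>Terms are only ever added, so a point where the hypothesis is true and the cleared
  function false is beyond repair. For a member of the class with separated variables every learnt
  term is an implicant and this case does not arise.\<close>

definition stepC ::
    "nat \<Rightarrow> nat \<Rightarrow> nat \<Rightarrow> (nat \<Rightarrow> nat) \<Rightarrow> slots \<Rightarrow> nat set list \<Rightarrow> nat set list outcome pmf" where
  "stepC s r l p cs ts = bind_pmf D (\<lambda>v. let x = (!) v in map_pmf (\<lambda>e.
       if \<not> fst e then Rej
       else if ask (hyb p (fst ` set cs) 0 x) = holds ts (snd e) then Pass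
       else if holds ts (snd e) then Rej
       else let t = snd (learn p cs x (length cs)) in
         if card t \<le> r \<and> length ts < s then Change (ts @ [t]) else Rej)
     (evals l p cs x))"

definition algo :: "nat \<Rightarrow> nat \<Rightarrow> nat \<Rightarrow> nat \<Rightarrow> bool pmf" where
  "algo s r l N = bind_pmf (rpart n l) (\<lambda>p.
     bind_pmf (stream (stepA (r * s) l p) N (Suc (r * s) * N) [] 0) (\<lambda>A. case A of
       None \<Rightarrow> return_pmf False
     | Some cs \<Rightarrow> map_pmf (\<lambda>C. C \<noteq> None) (stream (stepC s r l p cs) N (Suc s * N) [] 0)))"

end

section \<open>Estimates for probabilities in composed experiments\<close>

abbreviation pr :: "'a pmf \<Rightarrow> ('a \<Rightarrow> bool) \<Rightarrow> real" where
  "pr A P \<equiv> measure_pmf.prob A {x. P x}"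

lemma pr_mono: "(\<And>x. x \<in> set_pmf A \<Longrightarrow> P x \<Longrightarrow> Q x) \<Longrightarrow> pr A P \<le> pr A Q"
  by (rule measure_pmf.finite_measure_mono_AE) (auto simp: AE_measure_pmf_iff)

lemma pr_disj: "pr A (\<lambda>x. P x \<or> Q x) \<le> pr A P + pr A Q"
  using measure_Un_le[of "{x. P x}" "measure_pmf A" "{x. Q x}"]
  by (simp add: Collect_disj_eq)

lemma pr_not: "pr A (\<lambda>x. \<not> P x) = 1 - pr A P"
  using measure_pmf.prob_compl[of "{x. P x}" A] by (simp add: Collect_neg_eq Compl_eq_Diff_UNIV)

lemma pr_ex: "pr A P < 1 \<Longrightarrow> \<exists>x\<in>set_pmf A. \<not> P x"
  by (metis (mono_tags, lifting) Collect_cong linorder_neq_iff measure_pmf.prob_space_axioms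
      measure_pmf.prob_eq_1 AE_measure_pmf_iff UNIV_I mem_Collect_eq sets_measure_pmf)

lemma pr_map: "pr (map_pmf g A) P = pr A (\<lambda>x. P (g x))"
  by (simp add: vimage_def)

lemma pr_bind: "pr (bind_pmf A B) P = measure_pmf.expectation A (\<lambda>x. pr (B x) P)"
  unfolding measure_pmf_bind
  by (subst measure_pmf.measure_bind[where N="count_space UNIV"])
     (auto intro: measurable_pmf_measure1 simp: measure_pmf_in_subprob_algebra)

lemma integrable_pr: "integrable (measure_pmf A) (\<lambda>x. pr (B x) P)"
  by (rule measure_pmf.integrable_const_bound[where B=1]) auto

lemma pr_bind_le:
  assumes "\<And>x. x \<in> set_pmf A \<Longrightarrow> pr (B x) P \<le> c"
  shows "pr (bind_pmf A B) P \<le> c"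
  unfolding pr_bind
  by (rule measure_pmf.integral_le_const[OF integrable_pr]) (simp add: AE_measure_pmf_iff assms)

text \<open>The surcharge \<open>w\<close> is paid only with the probability of \<open>Q\<close>.
  Iterated over fresh draws this turns one failure chance into a power, without any separate
  independence argument.\<close>

lemma pr_bind_weight:
  assumes "0 \<le> c" "\<And>x. x \<in> set_pmf A \<Longrightarrow> Q x \<Longrightarrow> pr (B x) P \<le> w + c"
    "\<And>x. x \<in> set_pmf A \<Longrightarrow> \<not> Q x \<Longrightarrow> pr (B x) P \<le> c"
  shows "pr (bind_pmf A B) P \<le> pr A Q * w + c"
proof -
  have i: "integrable (measure_pmf A) (indicat_real {x. Q x})"
    by (rule measure_pmf.integrable_const_bound[where B=1]) auto
  have "measure_pmf.expectation A (\<lambda>x. pr (B x) P)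
        \<le> measure_pmf.expectation A (\<lambda>x. indicator {x. Q x} x * w + c)"
  proof (rule integral_mono_AE[OF integrable_pr])
    show "integrable (measure_pmf A) (\<lambda>x. indicat_real {x. Q x} x * w + c)" using i by simp
    show "AE x in measure_pmf A. pr (B x) P \<le> indicator {x. Q x} x * w + c"
      by (rule AE_pmfI) (use assms in \<open>auto simp: indicator_def\<close>)
  qed
  also have "\<dots> = pr A Q * w + c"
    using i by (subst Bochner_Integration.integral_add) auto
  finally show ?thesis by (simp add: pr_bind)
qed

text \<open>The union bound: a surcharge of 1 covers whatever happens under
  \<open>Q\<close>.\<close>

lemma pr_bind_split:
  assumes "0 \<le> c" "\<And>x. x \<in> set_pmf A \<Longrightarrow> \<not> Q x \<Longrightarrow> pr (B x) P \<le> c"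
  shows "pr (bind_pmf A B) P \<le> pr A Q + c"
proof -
  have "pr (B x) P \<le> 1 + c" for x
    using measure_pmf.prob_le_1[of "B x" "{x. P x}"] assms(1) by linarith
  then show ?thesis using pr_bind_weight[of c A Q B P 1] assms by simp
qed

text \<open>Averaging: some outcome is no worse than the mean, which allows one of two random
  vectors to be fixed.\<close>

lemma pr_bind_ex:
  assumes "pr (bind_pmf A B) P \<le> c"
  shows "\<exists>x. pr (B x) P \<le> c"
proof (rule ccontr)
  assume "\<not> ?thesis"
  then have "c < measure_pmf.expectation A (\<lambda>x. pr (B x) P)"
    by (intro measure_pmf.expectation_greater[OF integrable_pr]) (auto simp: not_le)
  with assms show False by (simp add: pr_bind)
qed

lemma pr_bind_cong: "(\<And>x. x \<in> set_pmf A \<Longrightarrow> pr (B x) P = pr (C x) Q)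
    \<Longrightarrow> pr (bind_pmf A B) P = pr (bind_pmf A C) Q"
  unfolding pr_bind by (rule integral_cong_AE) (auto simp: AE_measure_pmf_iff)

section \<open>Translation invariance of uniform random vectors\<close>

lemma coin_xor: "map_pmf (\<lambda>b. c \<noteq> b) coin = coin"
proof (cases c)
  case True
  have "pmf (map_pmf (\<lambda>b. c \<noteq> b) coin) i = pmf coin i" for i
  proof -
    have "{b. b} = {True}" "{b. \<not> b} = {False}" by auto
    then show ?thesis using True
      by (cases i) (auto simp: pmf_map vimage_def measure_pmf_single)
  qed
  then show ?thesis by (intro pmf_eqI)
qed simp

definition cut :: "nat \<Rightarrow> (nat \<Rightarrow> bool) \<Rightarrow> nat \<Rightarrow> bool" where
  "cut n x = (\<lambda>j. j < n \<and> x j)"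

text \<open>At each position a coin stays uniform after the exclusive or with a fixed bit. The shift
  \<open>c\<close> may be true beyond \<open>n\<close>, hence the \<open>cut\<close>.\<close>

lemma rvec_shift: "map_pmf (\<lambda>d. cut n (\<lambda>j. c j \<noteq> d j)) (rvec n) = rvec n"
proof (induction n)
  case 0
  then show ?case by (auto simp: rvec_def cut_def)
next
  case (Suc n)
  let ?T = "\<lambda>n d. cut n (\<lambda>j. c j \<noteq> d j)"
  have eq: "?T (Suc n) (d(n := b)) = (?T n d)(n := (c n \<noteq> b))" for d b
    by (auto simp: cut_def fun_eq_iff)
  have "map_pmf (?T (Suc n)) (rvec (Suc n)) =
      bind_pmf (rvec n) (\<lambda>d. map_pmf (\<lambda>b. (?T n d)(n := b)) (map_pmf (\<lambda>b. c n \<noteq> b) coin))"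
    unfolding rvec_def fm.simps map_bind_pmf pmf.map_comp comp_def eq ..
  also have "\<dots> = bind_pmf (map_pmf (?T n) (rvec n)) (\<lambda>d. map_pmf (\<lambda>b. d(n := b)) coin)"
    by (simp only: coin_xor bind_map_pmf)
  also have "\<dots> = rvec (Suc n)"
    by (simp only: Suc) (simp add: rvec_def)
  finally show ?case .
qed

lemma pr_rvec_shift:
  assumes "\<And>x. P (cut n x) = P x"
  shows "pr (rvec n) (\<lambda>z. P (\<lambda>j. c j \<noteq> z j)) = pr (rvec n) P"
proof -
  have "pr (rvec n) P = pr (map_pmf (\<lambda>d. cut n (\<lambda>j. c j \<noteq> d j)) (rvec n)) P"
    by (simp only: rvec_shift)
  also have "\<dots> = pr (rvec n) (\<lambda>z. P (\<lambda>j. c j \<noteq> z j))"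
    by (simp only: pr_map assms)
  finally show ?thesis by simp
qed

section \<open>Testing for dictators\<close>

definition rvec2 :: "nat \<Rightarrow> ((nat \<Rightarrow> bool) \<times> (nat \<Rightarrow> bool)) pmf" where
  "rvec2 n = bind_pmf (rvec n) (\<lambda>x. map_pmf (Pair x) (rvec n))"

definition rvec3 :: "nat \<Rightarrow> ((nat \<Rightarrow> bool) \<times> (nat \<Rightarrow> bool) \<times> (nat \<Rightarrow> bool)) pmf" where
  "rvec3 n = bind_pmf (rvec n) (\<lambda>x. map_pmf (Pair x) (rvec2 n))"

lemma trial_rvec3: "trial n G d = map_pmf (\<lambda>(x, y, z).
    (lin_ok G x y \<and> mul_ok G x y z \<and> one_ok G z, corr G d z)) (rvec3 n)"
  by (simp add: trial_def rvec3_def rvec2_def map_bind_pmf pmf.map_comp comp_def)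

lemma pr_rvec2_swap: "pr (rvec2 n) (\<lambda>u. P (snd u) (fst u)) = pr (rvec2 n) (\<lambda>u. P (fst u) (snd u))"
proof -
  have "rvec2 n = map_pmf (\<lambda>u. (snd u, fst u)) (rvec2 n)"
    unfolding rvec2_def map_pmf_def
    by (subst bind_commute_pmf) (simp add: bind_assoc_pmf bind_return_pmf)
  then have "pr (rvec2 n) (\<lambda>u. P (fst u) (snd u)) =
      pr (map_pmf (\<lambda>u. (snd u, fst u)) (rvec2 n)) (\<lambda>u. P (fst u) (snd u))" by simp
  then show ?thesis unfolding pr_map by simp
qed

lemma pr_rvec2_shift2:
  assumes "\<And>x y. P x (cut n y) = P x y"
  shows "pr (rvec2 n) (\<lambda>u. P (fst u) (\<lambda>j. c j \<noteq> snd u j)) = pr (rvec2 n) (\<lambda>u. P (fst u) (snd u))"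
  unfolding rvec2_def
proof (rule pr_bind_cong)
  fix x
  show "pr (map_pmf (Pair x) (rvec n)) (\<lambda>u. P (fst u) (\<lambda>j. c j \<noteq> snd u j)) =
      pr (map_pmf (Pair x) (rvec n)) (\<lambda>u. P (fst u) (snd u))"
    unfolding pr_map using pr_rvec_shift[of "P x" n c] assms by simp
qed

lemma pr_rvec2_shift1:
  assumes "\<And>x y. P (cut n x) y = P x y"
  shows "pr (rvec2 n) (\<lambda>u. P (\<lambda>j. c j \<noteq> fst u j) (snd u)) = pr (rvec2 n) (\<lambda>u. P (fst u) (snd u))"
  using pr_rvec2_shift2[of "\<lambda>y x. P x y" n c, OF assms]
  by (subst (1 2) pr_rvec2_swap[symmetric]) simp

lemma pr_rvec2_fst: "pr (rvec2 n) (\<lambda>u. P (fst u)) = pr (rvec n) P"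
  by (simp add: rvec2_def pr_map map_bind_pmf pmf.map_comp comp_def bind_return_pmf'
      flip: pr_map[of fst "rvec2 n" P, unfolded rvec2_def])

lemma pr_rvec2_snd: "pr (rvec2 n) (\<lambda>u. P (snd u)) = pr (rvec n) P"
  by (subst pr_rvec2_swap) (rule pr_rvec2_fst)

lemma pr_rvec3_snd: "pr (rvec3 n) (\<lambda>u. P (snd u)) = pr (rvec2 n) P"
proof -
  have "map_pmf snd (rvec3 n) = rvec2 n"
    by (simp add: rvec3_def map_bind_pmf pmf.map_comp comp_def)
  then show ?thesis by (metis pr_map)
qed

lemma pr_rvec3_fst: "pr (rvec3 n) (\<lambda>u. P (fst u) (fst (snd u))) = pr (rvec2 n) (\<lambda>u. P (fst u) (snd u))"
proof -
  have "map_pmf fst (rvec2 n) = rvec n"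
    by (simp add: rvec2_def map_bind_pmf pmf.map_comp comp_def bind_return_pmf')
  then have "map_pmf (\<lambda>u. (fst u, fst (snd u))) (rvec3 n) = rvec2 n"
    by (simp add: rvec3_def map_bind_pmf pmf.map_comp comp_def)
       (simp add: rvec2_def pmf.map_comp comp_def flip: pmf.map_comp[of _ fst, unfolded comp_def])
  then have "pr (rvec2 n) (\<lambda>u. P (fst u) (snd u)) =
     pr (map_pmf (\<lambda>u. (fst u, fst (snd u))) (rvec3 n)) (\<lambda>u. P (fst u) (snd u))" by simp
  then show ?thesis unfolding pr_map by simp
qed

text \<open>For fixed \<open>x\<close> and \<open>y\<close> only \<open>z\<close> is random; this
  carries bounds for the corrected value at a fixed argument over to random arguments.\<close>

lemma pr_rvec3_le:
  assumes "\<And>x y. pr (rvec n) (P x y) \<le> c"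
  shows "pr (rvec3 n) (\<lambda>(x, y, z). P x y z) \<le> c"
  unfolding rvec3_def
  apply (rule pr_bind_le)
  unfolding pr_map rvec2_def
  apply (rule pr_bind_le)
  unfolding pr_map
  using assms by simp

lemma pr_disj3: "pr A (\<lambda>x. P x \<or> Q x \<or> R x) \<le> pr A P + pr A Q + pr A R"
  using pr_disj[of A P "\<lambda>x. Q x \<or> R x"] pr_disj[of A Q R] by linarith

lemma pr_disj4: "pr A (\<lambda>x. P x \<or> Q x \<or> R x \<or> S x) \<le> pr A P + pr A Q + pr A R + pr A S"
  using pr_disj[of A P "\<lambda>x. Q x \<or> R x \<or> S x"] pr_disj3[of A Q R S] by linarith

text \<open>Linearity testing by self-correction: \<open>corr G c z\<close> is almost independent of \<open>z\<close>, and its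
  typical value is additive in \<open>c\<close>. The remaining two tests make the corrected function a unital
  ring homomorphism of the Boolean ring of all vectors, that is, a projection.\<close>

theorem dictator_test:
  fixes G :: "(nat \<Rightarrow> bool) \<Rightarrow> bool"
  assumes cut: "\<And>x. G (cut n x) = G x"
    and test: "pr (trial n G d0) (\<lambda>u. \<not> fst u) \<le> 1 / 40"
  obtains i where "i < n" "\<And>c. pr (rvec n) (\<lambda>z. corr G c z \<noteq> c i) \<le> 1 / 20"
proof -
  have cong: "G x = G y" if "\<And>j. j < n \<Longrightarrow> x j = y j" for x y
  proof -
    have "cut n x = cut n y" using that by (auto simp: cut_def fun_eq_iff)
    then show ?thesis by (metis cut)
  qed
  have test3: "pr (rvec3 n) (\<lambda>(x, y, z). \<not> (lin_ok G x y \<and> mul_ok G x y z \<and> one_ok G z)) \<le> 1 / 40"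
    using test unfolding trial_rvec3 pr_map by (simp add: case_prod_unfold)
  have lin: "pr (rvec2 n) (\<lambda>u. \<not> lin_ok G (fst u) (snd u)) \<le> 1 / 40"
    using test3 by (subst pr_rvec3_fst[symmetric], elim order_trans[rotated], intro pr_mono) auto
  have one: "pr (rvec n) (\<lambda>z. \<not> one_ok G z) \<le> 1 / 40"
    using test3 
    by (subst pr_rvec2_snd[symmetric], subst pr_rvec3_snd[symmetric], elim order_trans[rotated], intro pr_mono) auto
  have mul: "pr (rvec3 n) (\<lambda>(x, y, z). \<not> mul_ok G x y z) \<le> 1 / 40"
    using test3 by (elim order_trans[rotated], intro pr_mono) auto
  have lin_cut1: "lin_ok G (cut n x) y = lin_ok G x y" for x y
    unfolding lin_ok_def by (intro arg_cong2[where f="(=)"] arg_cong2[where f="(\<noteq>)"] cong) (auto simp: cut_def)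
  have lin_cut2: "lin_ok G x (cut n y) = lin_ok G x y" for x y
    unfolding lin_ok_def by (intro arg_cong2[where f="(=)"] arg_cong2[where f="(\<noteq>)"] cong) (auto simp: cut_def)
  have corr_cut: "corr G c (cut n z) = corr G c z" for c z
    unfolding corr_def by (intro arg_cong2[where f="(\<noteq>)"] cong) (auto simp: cut_def)
  \<comment> \<open>Two masks x and y give the same corrected value at c whenever linearity holds
    for the pairs (c+x, y) and (x, c+y), since both sums are c+x+y. Each pair is uniform, hence
    twice 1/40; one good mask is then fixed by averaging.\<close>
  have "\<exists>b. pr (rvec n) (\<lambda>z. corr G c z \<noteq> b) \<le> 1 / 20" for c
  proof -
    have "pr (rvec2 n) (\<lambda>u. corr G c (snd u) \<noteq> corr G c (fst u)) \<le>
        pr (rvec2 n) (\<lambda>u. \<not> lin_ok G (\<lambda>j. c j \<noteq> fst u j) (snd u) \<or> \<not> lin_ok G (fst u) (\<lambda>j. c j \<noteq> snd u j))"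
    proof (rule pr_mono, rule ccontr)
      fix u :: "(nat \<Rightarrow> bool) \<times> (nat \<Rightarrow> bool)"
      assume a: "corr G c (snd u) \<noteq> corr G c (fst u)"
        and b: "\<not> (\<not> lin_ok G (\<lambda>j. c j \<noteq> fst u j) (snd u) \<or> \<not> lin_ok G (fst u) (\<lambda>j. c j \<noteq> snd u j))"
      have "(\<lambda>j. (c j \<noteq> fst u j) \<noteq> snd u j) = (\<lambda>j. fst u j \<noteq> (c j \<noteq> snd u j))" by auto
      with a b show False unfolding lin_ok_def corr_def by metis
    qed
    also have "\<dots> \<le> pr (rvec2 n) (\<lambda>u. \<not> lin_ok G (\<lambda>j. c j \<noteq> fst u j) (snd u)) +
        pr (rvec2 n) (\<lambda>u. \<not> lin_ok G (fst u) (\<lambda>j. c j \<noteq> snd u j))" by (rule pr_disj)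
    also have "\<dots> \<le> 1 / 20"
      using pr_rvec2_shift1[of "\<lambda>x y. \<not> lin_ok G x y" n c] pr_rvec2_shift2[of "\<lambda>x y. \<not> lin_ok G x y" n c]
        lin lin_cut1 lin_cut2 by simp
    finally obtain x where
      "pr (map_pmf (Pair x) (rvec n)) (\<lambda>u. corr G c (snd u) \<noteq> corr G c (fst u)) \<le> 1 / 20"
      unfolding rvec2_def using pr_bind_ex by blast
    then show ?thesis unfolding pr_map by auto
  qed
  then obtain \<phi> where \<phi>: "\<And>c. pr (rvec n) (\<lambda>z. corr G c z \<noteq> \<phi> c) \<le> 1 / 20" by metis
  \<comment> \<open>The correction at \<open>a\<close>, followed by that at \<open>b\<close> with
    its mask shifted by \<open>a\<close>, telescopes to the correction at the sum. Three failures of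
    at most 1/20 leave a mask for which all three values are typical.\<close>
  have add: "\<phi> (\<lambda>j. a j \<noteq> b j) = (\<phi> a \<noteq> \<phi> b)" for a b
  proof -
    have "pr (rvec n) (\<lambda>z. corr G a z \<noteq> \<phi> a \<or> corr G b (\<lambda>j. a j \<noteq> z j) \<noteq> \<phi> b \<or>
       corr G (\<lambda>j. a j \<noteq> b j) z \<noteq> \<phi> (\<lambda>j. a j \<noteq> b j)) < 1"
      using pr_disj3[of "rvec n" "\<lambda>z. corr G a z \<noteq> \<phi> a" "\<lambda>z. corr G b (\<lambda>j. a j \<noteq> z j) \<noteq> \<phi> b"
          "\<lambda>z. corr G (\<lambda>j. a j \<noteq> b j) z \<noteq> \<phi> (\<lambda>j. a j \<noteq> b j)"]
        pr_rvec_shift[of "\<lambda>z. corr G b z \<noteq> \<phi> b" n a] corr_cut \<phi>[of a] \<phi>[of b] \<phi>[of "\<lambda>j. a j \<noteq> b j"]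
      by simp
    from pr_ex[OF this] obtain z where z: "corr G a z = \<phi> a" "corr G b (\<lambda>j. a j \<noteq> z j) = \<phi> b"
       "corr G (\<lambda>j. a j \<noteq> b j) z = \<phi> (\<lambda>j. a j \<noteq> b j)" by blast
    have "(\<lambda>j. b j \<noteq> (a j \<noteq> z j)) = (\<lambda>j. (a j \<noteq> b j) \<noteq> z j)" by auto
    with z show ?thesis unfolding corr_def by metis
  qed
  \<comment> \<open>Where linearity holds for x and z, the correction at x with mask z equals
    \<open>G x\<close>; hence 1/40 + 1/20.\<close>
  have G\<phi>: "pr (rvec n) (\<lambda>x. G x \<noteq> \<phi> x) \<le> 3 / 40"
  proof -
    have "pr (rvec2 n) (\<lambda>u. G (fst u) \<noteq> \<phi> (fst u)) \<le>
       pr (rvec2 n) (\<lambda>u. \<not> lin_ok G (fst u) (snd u) \<or> corr G (fst u) (snd u) \<noteq> \<phi> (fst u))"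
      by (rule pr_mono) (auto simp: lin_ok_def corr_def)
    also have "\<dots> \<le> pr (rvec2 n) (\<lambda>u. \<not> lin_ok G (fst u) (snd u)) +
        pr (rvec2 n) (\<lambda>u. corr G (fst u) (snd u) \<noteq> \<phi> (fst u))" by (rule pr_disj)
    also have "pr (rvec2 n) (\<lambda>u. corr G (fst u) (snd u) \<noteq> \<phi> (fst u)) \<le> 1 / 20"
      unfolding rvec2_def by (rule pr_bind_le) (unfold pr_map, simp only: fst_conv snd_conv \<phi>)
    finally show ?thesis using lin pr_rvec2_fst[of n "\<lambda>x. G x \<noteq> \<phi> x"] by linarith
  qed
  have cor3: "pr (rvec3 n) (\<lambda>(x, y, z). corr G (\<lambda>j. x j \<and> y j) z \<noteq> \<phi> (\<lambda>j. x j \<and> y j)) \<le> 1 / 20"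
    by (rule pr_rvec3_le) (rule \<phi>)
  \<comment> \<open>The four sources of error are the product test, the correction at the product
    and the two factors: 1/40 + 1/20 + 3/40 + 3/40.\<close>
  have mul2: "pr (rvec2 n) (\<lambda>u. \<phi> (\<lambda>j. fst u j \<and> snd u j) \<noteq> (\<phi> (fst u) \<and> \<phi> (snd u))) \<le> 9 / 40"
  proof -
    have "pr (rvec2 n) (\<lambda>u. \<phi> (\<lambda>j. fst u j \<and> snd u j) \<noteq> (\<phi> (fst u) \<and> \<phi> (snd u))) =
       pr (rvec3 n) (\<lambda>u. \<phi> (\<lambda>j. fst u j \<and> fst (snd u) j) \<noteq> (\<phi> (fst u) \<and> \<phi> (fst (snd u))))"
      by (rule pr_rvec3_fst[symmetric])
    also have "\<dots> \<le> pr (rvec3 n) (\<lambda>u. (case u of (x, y, z) \<Rightarrow> \<not> mul_ok G x y z) \<or>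
       (case u of (x, y, z) \<Rightarrow> corr G (\<lambda>j. x j \<and> y j) z \<noteq> \<phi> (\<lambda>j. x j \<and> y j)) \<or>
       G (fst u) \<noteq> \<phi> (fst u) \<or> G (fst (snd u)) \<noteq> \<phi> (fst (snd u)))"
      by (rule pr_mono) (auto simp: mul_ok_def corr_def)
    also have "\<dots> \<le> 1 / 40 + 1 / 20 + 3 / 40 + 3 / 40"
      using pr_rvec3_fst[of n "\<lambda>x y. G x \<noteq> \<phi> x"] pr_rvec3_fst[of n "\<lambda>x y. G y \<noteq> \<phi> y"]
        pr_rvec2_fst[of n "\<lambda>x. G x \<noteq> \<phi> x"] pr_rvec2_snd[of n "\<lambda>x. G x \<noteq> \<phi> x"]
      by (intro order_trans[OF pr_disj4] add_mono mul cor3) (use G\<phi> in linarith)+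
    finally show ?thesis by simp
  qed
  define \<beta> where "\<beta> = (\<lambda>x y. \<phi> (\<lambda>j. x j \<and> y j) \<noteq> (\<phi> x \<and> \<phi> y))"
  have \<phi>_cut: "\<phi> (cut n x) = \<phi> x" for x
  proof -
    have c: "corr G (cut n x) z = corr G x z" for z
      unfolding corr_def by (intro arg_cong2[where f="(\<noteq>)"] cong) (auto simp: cut_def)
    have "pr (rvec n) (\<lambda>z. corr G x z \<noteq> \<phi> x \<or> corr G x z \<noteq> \<phi> (cut n x)) < 1"
      using pr_disj[of "rvec n" "\<lambda>z. corr G x z \<noteq> \<phi> x" "\<lambda>z. corr G x z \<noteq> \<phi> (cut n x)"]
        \<phi>[of x] \<phi>[of "cut n x"] c by simp
    from pr_ex[OF this] show ?thesis by blast
  qed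
  have \<phi>_cong: "\<phi> x = \<phi> y" if "\<And>j. j < n \<Longrightarrow> x j = y j" for x y
  proof -
    have "cut n x = cut n y" using that by (auto simp: cut_def fun_eq_iff)
    then show ?thesis by (metis \<phi>_cut)
  qed
  have \<beta>_cut1: "\<beta> (cut n x) y = \<beta> x y" and \<beta>_cut2: "\<beta> x (cut n y) = \<beta> x y" for x y
    unfolding \<beta>_def by (intro arg_cong2[where f="(\<noteq>)"] arg_cong2[where f="(\<and>)"] \<phi>_cong; simp add: cut_def)+
  have \<beta>_add1: "\<beta> (\<lambda>j. a j \<noteq> b j) y = (\<beta> a y \<noteq> \<beta> b y)" for a b y
  proof -
    have "(\<lambda>j. (a j \<noteq> b j) \<and> y j) = (\<lambda>j. (a j \<and> y j) \<noteq> (b j \<and> y j))" by auto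
    then have "\<phi> (\<lambda>j. (a j \<noteq> b j) \<and> y j) = (\<phi> (\<lambda>j. a j \<and> y j) \<noteq> \<phi> (\<lambda>j. b j \<and> y j))"
      by (simp only: add)
    then show ?thesis unfolding \<beta>_def add by argo
  qed
  have \<beta>_add2: "\<beta> y (\<lambda>j. a j \<noteq> b j) = (\<beta> y a \<noteq> \<beta> y b)" for a b y
  proof -
    have "(\<lambda>j. y j \<and> (a j \<noteq> b j)) = (\<lambda>j. (y j \<and> a j) \<noteq> (y j \<and> b j))" by auto
    then have "\<phi> (\<lambda>j. y j \<and> (a j \<noteq> b j)) = (\<phi> (\<lambda>j. y j \<and> a j) \<noteq> \<phi> (\<lambda>j. y j \<and> b j))"
      by (simp only: add)
    then show ?thesis unfolding \<beta>_def add by argo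
  qed
  \<comment> \<open>The defect \<beta> is additive in each argument, so \<beta> a b is the sum of
    the defects at the four pairs obtained by shifting the first argument by \<open>a\<close> or not
    and the second by \<open>b\<close> or not. Each pair is uniform and 4 * 9/40 is below 1, so all
    four vanish at some pair. With test error \<tau> the total would be 36 \<tau>, which explains
    the threshold 1/40.\<close>
  have \<beta>: "\<not> \<beta> a b" for a b
  proof
    assume ab: "\<beta> a b"
    have s1: "pr (rvec2 n) (\<lambda>u. \<beta> (\<lambda>j. a j \<noteq> fst u j) (snd u)) \<le> 9 / 40"
      using mul2 pr_rvec2_shift1[of "\<beta>" n a] \<beta>_cut1 by (simp add: \<beta>_def)
    have s2: "pr (rvec2 n) (\<lambda>u. \<beta> (fst u) (\<lambda>j. b j \<noteq> snd u j)) \<le> 9 / 40"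
      using mul2 pr_rvec2_shift2[of "\<beta>" n b] \<beta>_cut2 by (simp add: \<beta>_def)
    have s3: "pr (rvec2 n) (\<lambda>u. \<beta> (\<lambda>j. a j \<noteq> fst u j) (\<lambda>j. b j \<noteq> snd u j)) \<le> 9 / 40"
      using s1 pr_rvec2_shift2[of "\<lambda>x y. \<beta> (\<lambda>j. a j \<noteq> x j) y" n b] \<beta>_cut2 by simp
    have "pr (rvec2 n) (\<lambda>u. \<beta> (fst u) (snd u) \<or> \<beta> (\<lambda>j. a j \<noteq> fst u j) (snd u) \<or>
       \<beta> (fst u) (\<lambda>j. b j \<noteq> snd u j) \<or> \<beta> (\<lambda>j. a j \<noteq> fst u j) (\<lambda>j. b j \<noteq> snd u j)) < 1"
      using mul2 s1 s2 s3 by (intro le_less_trans[OF pr_disj4]) (simp add: \<beta>_def)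
    from pr_ex[OF this] ab show False unfolding \<beta>_add1 \<beta>_add2 by blast
  qed
  then have mult: "\<phi> (\<lambda>j. x j \<and> y j) = (\<phi> x \<and> \<phi> y)" for x y by (auto simp: \<beta>_def)
  have \<phi>1: "\<phi> (\<lambda>_. True)"
  proof -
    have "pr (rvec n) (\<lambda>z. corr G (\<lambda>_. True) z \<noteq> \<phi> (\<lambda>_. True) \<or> \<not> one_ok G z) < 1"
      using pr_disj[of "rvec n" "\<lambda>z. corr G (\<lambda>_. True) z \<noteq> \<phi> (\<lambda>_. True)" "\<lambda>z. \<not> one_ok G z"]
       \<phi>[of "\<lambda>_. True"] one by simp
    from pr_ex[OF this] show ?thesis by (auto simp: corr_def one_ok_def)
  qed
  have \<phi>0: "\<not> \<phi> (\<lambda>_. False)" using add[of "\<lambda>_. False" "\<lambda>_. False"] by simp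
  \<comment> \<open>The all-one vector is the sum of the unit vectors, so an additive map that is
    true there is true at some unit vector.\<close>
  have "\<exists>i<n. \<phi> (\<lambda>j. j = i)"
  proof (rule ccontr)
    assume no: "\<not> ?thesis"
    have "\<not> \<phi> (\<lambda>j. j < m)" if "m \<le> n" for m
      using that
    proof (induction m)
      case (Suc m)
      have "(\<lambda>j. j < Suc m) = (\<lambda>j. (j < m) \<noteq> (j = m))" by auto
      then have "\<phi> (\<lambda>j. j < Suc m) = (\<phi> (\<lambda>j. j < m) \<noteq> \<phi> (\<lambda>j. j = m))"
        by (simp only: add)
      then show ?case using Suc no by auto
    qed (use \<phi>0 in simp)
    then have "\<not> \<phi> (\<lambda>j. j < n)" by simp
    moreover have "\<phi> (\<lambda>j. j < n) = \<phi> (\<lambda>_. True)" by (rule \<phi>_cong) simp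
    ultimately show False using \<phi>1 by simp
  qed
  then obtain i where i: "i < n" "\<phi> (\<lambda>j. j = i)" by blast
  \<comment> \<open>Multiplying \<open>c\<close> by the unit vector at \<open>i\<close> leaves that
    vector or zero, according to \<open>c i\<close>.\<close>
  have "\<phi> c = c i" for c
  proof -
    have "(\<lambda>j. c j \<and> j = i) = (if c i then (\<lambda>j. j = i) else (\<lambda>_. False))" by auto
    then show ?thesis using mult[of c "\<lambda>j. j = i"] i \<phi>0 by (auto split: if_splits)
  qed
  then show ?thesis using that i(1) \<phi> by simp
qed

section \<open>Soundness\<close>

lemma stream_invariant:
  assumes "\<And>a a'. I a \<Longrightarrow> Change a' \<in> set_pmf (S a) \<Longrightarrow> I a'"
  shows "I a \<Longrightarrow> Some a' \<in> set_pmf (stream S N m a j) \<Longrightarrow> I a'"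
proof (induction m arbitrary: a j)
  case (Suc m)
  show ?case
  proof (cases "j < N")
    case True
    then obtain out where out: "out \<in> set_pmf (S a)" "Some a' \<in> set_pmf (case out of
        Pass \<Rightarrow> stream S N m a (Suc j) | Change a' \<Rightarrow> stream S N m a' 0 | Rej \<Rightarrow> return_pmf None)"
      using Suc.prems by auto
    show ?thesis
    proof (cases out)
      case (Change b)
      then have "I b" using assms out(1) Suc.prems(1) by blast
      then show ?thesis using Suc.IH Change out(2) by simp
    qed (use out Suc.IH Suc.prems(1) in auto)
  qed (use Suc.prems in auto)
qed simp

text \<open>Serves the completeness proof: acceptance is certain, whatever the samples, once no
  reachable state can reject.\<close>

lemma stream_no_Rej:
  assumes "\<And>a a'. I a \<Longrightarrow> Change a' \<in> set_pmf (S a) \<Longrightarrow> I a'"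
    and "\<And>a. I a \<Longrightarrow> Rej \<notin> set_pmf (S a)"
  shows "I a \<Longrightarrow> None \<notin> set_pmf (stream S N m a j)"
proof (induction m arbitrary: a j)
  case (Suc m)
  have "None \<notin> set_pmf (case out of Pass \<Rightarrow> stream S N m a (Suc j)
       | Change a' \<Rightarrow> stream S N m a' 0 | Rej \<Rightarrow> return_pmf None)" if "out \<in> set_pmf (S a)" for out
  proof (cases out)
    case (Change b)
    then have "I b" using assms(1) that Suc.prems by blast
    then show ?thesis using Suc.IH Change by simp
  qed (use that Suc.IH Suc.prems assms(2) in auto)
  then show ?case by auto
qed simp

text \<open>Every state met on the way gets \<open>N\<close> fresh chances to be exposed, so the probabilities of
  missing a bad state add up over the at most \<open>K - sz a + 1\<close> states.\<close>

lemma stream_bad: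
  assumes step: "\<And>a a'. I a \<Longrightarrow> Change a' \<in> set_pmf (S a) \<Longrightarrow> I a' \<and> sz a' = Suc (sz a) \<and> sz a' \<le> K"
    and bad: "\<And>a. I a \<Longrightarrow> bad a \<Longrightarrow> pr (S a) (\<lambda>out. out = Pass) \<le> 1 - \<eta>"
    and \<eta>: "0 \<le> \<eta>" "\<eta> \<le> 1"
  shows "I a \<Longrightarrow> sz a \<le> K \<Longrightarrow> j \<le> N \<Longrightarrow> (K - sz a) * N + (N - j) \<le> m \<Longrightarrow>
     pr (stream S N m a j) (\<lambda>res. \<exists>a'. res = Some a' \<and> bad a') \<le>
     (if bad a then (1 - \<eta>) ^ (N - j) else 0) + real (K - sz a) * (1 - \<eta>) ^ N"
proof (induction m arbitrary: a j)
  \<comment> \<open>Without fuel the hypothesis forces \<open>j = N\<close>, and the bound for a bad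
    state is 1.\<close>
  case 0
  then show ?case using \<eta> by (simp add: indicator_def)
next
  case (Suc m)
  let ?P = "\<lambda>res. \<exists>a'. res = Some a' \<and> bad a'"
  define c where "c = real (K - sz a) * (1 - \<eta>) ^ N"
  define w where "w = (if bad a then (1 - \<eta>) ^ (N - Suc j) else 0)"
  have c0: "0 \<le> c" using \<eta> by (simp add: c_def)
  show ?case
  proof (cases "j < N")
    case False
    then have "N = j" using Suc.prems by simp
    then show ?thesis using \<eta> by (simp add: indicator_def)
  next
    case True
    have "pr (stream S N (Suc m) a j) ?P \<le> pr (S a) (\<lambda>out. out = Pass) * w + c"
      unfolding stream.simps if_P[OF True]
    proof (rule pr_bind_weight[OF c0])
      fix out assume "out \<in> set_pmf (S a)" "out = Pass"
      then show "pr (case out of Pass \<Rightarrow> stream S N m a (Suc j) | Change a' \<Rightarrow> stream S N m a' 0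
           | Rej \<Rightarrow> return_pmf None) ?P \<le> w + c"
        using Suc.IH[of a "Suc j"] Suc.prems True by (simp add: w_def c_def)
    next
      fix out assume out: "out \<in> set_pmf (S a)" "out \<noteq> Pass"
      show "pr (case out of Pass \<Rightarrow> stream S N m a (Suc j) | Change a' \<Rightarrow> stream S N m a' 0
           | Rej \<Rightarrow> return_pmf None) ?P \<le> c"
      proof (cases out)
        case (Change a')
        with step[of a a'] out Suc.prems have a': "I a'" "sz a' = Suc (sz a)" "sz a' \<le> K" by auto
        \<comment> \<open>The new state has its own chance of surviving \<open>N\<close> passes; it
          is paid for by the drop of \<open>K - sz\<close> by one.\<close>
        have e: "K - sz a = Suc (K - sz a')" using a' by simp
        then have "(K - sz a') * N + (N - 0) \<le> m" using Suc.prems True by simp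
        then have "pr (stream S N m a' 0) ?P \<le>
            (if bad a' then (1 - \<eta>) ^ (N - 0) else 0) + real (K - sz a') * (1 - \<eta>) ^ N"
          using Suc.IH[of a' 0] a' by blast
        also have "\<dots> \<le> c"
          using \<eta> unfolding c_def e by (auto simp: algebra_simps)
        finally show ?thesis using Change by simp
      qed (use out c0 in \<open>auto simp: indicator_def\<close>)
    qed
    also have "pr (S a) (\<lambda>out. out = Pass) * w \<le> (if bad a then (1 - \<eta>) ^ (N - j) else 0)"
    proof (cases "bad a")
      case b: True
      have "N - j = Suc (N - Suc j)" using True by simp
      then show ?thesis
        using bad[OF Suc.prems(1) b] b \<eta> by (auto simp: w_def intro!: mult_right_mono)
    qed (simp add: w_def)
    finally show ?thesis by (simp add: c_def)
  qed
qed

section \<open>Error probabilities of repeated trials, searches and slot evaluations\<close>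

lemma trials_fst: "pr (trials n L G d) fst \<le> pr (trial n G d) (\<lambda>u. fst u \<and> \<not> snd u) ^ L"
proof (induction L)
  case (Suc L)
  \<comment> \<open>The flag survives the new trial only if it survived the earlier ones, and the
    new trial is fresh, so the factors multiply without remainder.\<close>
  have "pr (trials n (Suc L) G d) fst \<le>
      pr (trials n L G d) fst * pr (trial n G d) (\<lambda>u. fst u \<and> \<not> snd u) + 0"
    unfolding trials_def fm.simps by (rule pr_bind_weight; (unfold pr_map)?; simp)
  also have "\<dots> \<le> pr (trial n G d) (\<lambda>u. fst u \<and> \<not> snd u) ^ Suc L"
    unfolding power_Suc2 add_0_right by (rule mult_right_mono[OF Suc measure_nonneg])
  finally show ?case .
qed simp

lemma trials_snd: "pr (trials n L G d) snd \<le> pr (trial n G d) (\<lambda>u. fst u \<and> snd u) ^ L"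
proof (induction L)
  case (Suc L)
  have "pr (trials n (Suc L) G d) snd \<le>
      pr (trials n L G d) snd * pr (trial n G d) (\<lambda>u. fst u \<and> snd u) + 0"
    unfolding trials_def fm.simps by (rule pr_bind_weight; (unfold pr_map)?; simp)
  also have "\<dots> \<le> pr (trial n G d) (\<lambda>u. fst u \<and> snd u) ^ Suc L"
    unfolding power_Suc2 add_0_right by (rule mult_right_mono[OF Suc measure_nonneg])
  finally show ?case .
qed simp

text \<open>The last trial alone gives all that is needed: a bad slot has to be noticed only with
  constant probability per sample, since the stream does the amplification.\<close>

lemma trials_any:
  assumes "0 < L"
  shows "pr (trials n L G d) (\<lambda>a. fst a \<or> snd a) \<le> pr (trial n G d) fst"
proof -
  obtain m where L: "L = Suc m" using assms by (cases L) auto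
  show ?thesis
    unfolding trials_def L fm.simps by (rule pr_bind_le, unfold pr_map, rule pr_mono) auto
qed

context oracles
begin

lemma ask_cong: "(\<And>j. j < n \<Longrightarrow> x j = y j) \<Longrightarrow> ask x = ask y"
  by (auto simp: ask_def pt_def intro!: arg_cong[where f=f])

lemma ask_nth: "v \<in> cube n \<Longrightarrow> ask ((!) v) = f v"
  by (auto simp: ask_def pt_def cube_def map_nth)

lemma hyb_full: "(\<And>j. j < n \<Longrightarrow> p j < t) \<Longrightarrow> ask (hyb p Bs t x) = ask x"
  by (rule ask_cong) (auto simp: hyb_def)

text \<open>The left end of the interval keeps the value of the cleared point and the right end
  keeps the other value; at width 1 the change is located.\<close>

lemma bsearch:
  assumes "ask (hyb p Bs lo x) = ask (hyb p Bs 0 x)"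
    "ask (hyb p Bs (lo + 2 ^ i) x) \<noteq> ask (hyb p Bs 0 x)"
  shows "ask (hyb p Bs (bsearch p Bs x i lo) x) = ask (hyb p Bs 0 x) \<and>
     ask (hyb p Bs (Suc (bsearch p Bs x i lo)) x) \<noteq> ask (hyb p Bs 0 x)"
  using assms
proof (induction i arbitrary: lo)
  case (Suc i)
  have e: "lo + 2 ^ Suc i = (lo + 2 ^ i) + 2 ^ i" by simp
  show ?case
  proof (cases "ask (hyb p Bs (lo + 2 ^ i) x) = ask (hyb p Bs 0 x)")
    case True
    then show ?thesis using Suc.IH[of "lo + 2 ^ i"] Suc.prems(2) by (simp del: power_Suc add: e)
  next
    case False
    then show ?thesis using Suc.IH[of lo] Suc.prems(1) by simp
  qed
qed simp

text \<open>Known blocks are kept in full by both hybrids, so two neighbouring hybrids with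
  different values differ in an unknown block.\<close>

lemma newslot:
  assumes p: "\<And>j. j < n \<Longrightarrow> p j < 2 ^ l" and ne: "ask x \<noteq> ask (hyb p Bs 0 x)"
  obtains B w w' where "newslot p Bs l x = (B, w)" "B \<notin> Bs" "\<not> ask w" "ask w'"
    "\<And>j. p j \<noteq> B \<Longrightarrow> w' j = w j"
proof -
  define B where "B = bsearch p Bs x l 0"
  have b: "ask (hyb p Bs B x) = ask (hyb p Bs 0 x)" "ask (hyb p Bs (Suc B) x) \<noteq> ask (hyb p Bs 0 x)"
    using bsearch[of p Bs 0 x l] hyb_full[of p "2 ^ l" Bs x] p ne unfolding B_def by auto
  have "\<exists>j. hyb p Bs B x j \<noteq> hyb p Bs (Suc B) x j"
    using b ask_cong[of "hyb p Bs B x" "hyb p Bs (Suc B) x"] by auto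
  then have nB: "B \<notin> Bs" by (auto simp: hyb_def less_Suc_eq)
  have eq: "hyb p Bs B x j = hyb p Bs (Suc B) x j" if "p j \<noteq> B" for j
    using that by (auto simp: hyb_def less_Suc_eq)
  define w where "w = hyb p Bs (if ask (hyb p Bs 0 x) then Suc B else B) x"
  define w' where "w' = hyb p Bs (if ask (hyb p Bs 0 x) then B else Suc B) x"
  have "newslot p Bs l x = (B, w)" by (simp add: newslot_def B_def w_def Let_def)
  moreover have "\<not> ask w" "ask w'" using b by (auto simp: w_def w'_def)
  moreover have "w' j = w j" if "p j \<noteq> B" for j using eq[OF that] by (auto simp: w_def w'_def)
  ultimately show ?thesis using that nB by blast
qed

lemma learn_slots: "snd (learn p cs x v) \<subseteq> {..<v}"
  by (induction v) (auto simp: Let_def)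

lemma stepA_Pass:
  "pr (stepA k l p cs) (\<lambda>out. out = Pass) =
   1 - pr D (\<lambda>v. ask ((!) v) \<noteq> ask (hyb p (fst ` set cs) 0 ((!) v)))"
  unfolding stepA_def pr_map pr_not[symmetric]
  by (rule arg_cong[where f="measure_pmf.prob D"]) (auto simp: Let_def)

definition okA :: "nat \<Rightarrow> slots \<Rightarrow> bool" where
  "okA k cs \<longleftrightarrow> distinct (map fst cs) \<and> length cs \<le> k"

lemma stepA_Change:
  assumes "\<And>j. j < n \<Longrightarrow> p j < 2 ^ l" "okA k cs" "Change cs' \<in> set_pmf (stepA k l p cs)"
  shows "okA k cs' \<and> length cs' = Suc (length cs) \<and> length cs' \<le> k"
proof -
  obtain x where x: "ask x \<noteq> ask (hyb p (fst ` set cs) 0 x)" "length cs < k"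
      "cs' = cs @ [newslot p (fst ` set cs) l x]"
    using assms(3) by (auto simp: stepA_def Let_def split: if_splits)
  obtain B w w' where "newslot p (fst ` set cs) l x = (B, w)" "B \<notin> fst ` set cs"
    using newslot[OF assms(1) x(1)] by metis
  then show ?thesis using assms(2) x by (auto simp: okA_def)
qed

abbreviation slotfun :: "(nat \<Rightarrow> nat) \<Rightarrow> nat \<times> (nat \<Rightarrow> bool) \<Rightarrow> (nat \<Rightarrow> bool) \<Rightarrow> bool" where
  "slotfun p c \<equiv> (\<lambda>d. ask (toggle p c d))"

lemma slotfun_cut: "slotfun p c (cut n d) = slotfun p c d"
  by (rule ask_cong) (auto simp: toggle_def cut_def)

text \<open>The function of a slot is blind to coordinates outside its block, so its corrections at
  unit vectors outside vanish and the projection index must lie inside.\<close>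

lemma slot_variable:
  assumes "pr (trial n (slotfun p c) d) (\<lambda>u. \<not> fst u) \<le> 1 / 40"
  obtains i where "i < n" "p i = fst c" "\<And>d. pr (rvec n) (\<lambda>z. corr (slotfun p c) d z \<noteq> d i) \<le> 1 / 20"
proof -
  from dictator_test[of "slotfun p c" n d, OF slotfun_cut assms]
  obtain i where i: "i < n" "\<And>d. pr (rvec n) (\<lambda>z. corr (slotfun p c) d z \<noteq> d i) \<le> 1 / 20" by blast
  have "p i = fst c"
  proof (rule ccontr)
    assume "p i \<noteq> fst c"
    then have "toggle p c (\<lambda>j. (j = i) \<noteq> z j) = toggle p c z" for z
      by (auto simp: toggle_def fun_eq_iff)
    then have "\<not> corr (slotfun p c) (\<lambda>j. j = i) z" for z by (simp add: corr_def)
    then show False using i(2)[of "\<lambda>j. j = i"] by simp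
  qed
  with i that show ?thesis by blast
qed

text \<open>After slot \<open>v\<close> has been processed, later slots can only clear the validity
  flag; hence the induction over the number of slots behind \<open>v\<close>.\<close>

lemma evals_bad_slot:
  assumes v: "v < length cs" "\<And>d. pr (trial n (slotfun p (cs ! v)) d) fst \<le> c" and "0 < l"
  shows "pr (evals l p cs x) fst \<le> c"
proof -
  define B where "B = (\<lambda>v (e :: bool \<times> (nat \<Rightarrow> bool)). map_pmf (\<lambda>a. (fst e \<and> (fst a \<or> snd a), (snd e)(v := snd a)))
     (trials n l (slotfun p (cs ! v)) (\<lambda>j. x j \<noteq> snd (cs ! v) j)))"
  have "pr (fm (Suc v + m) B (True, \<lambda>_. False)) fst \<le> c" for m
  proof (induction m)
    case 0
    have "pr (B v e) fst \<le> c" for e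
    proof -
      have "pr (B v e) fst \<le> pr (trials n l (slotfun p (cs ! v)) (\<lambda>j. x j \<noteq> snd (cs ! v) j)) (\<lambda>a. fst a \<or> snd a)"
        unfolding B_def pr_map by (rule pr_mono) auto
      also have "\<dots> \<le> c" using trials_any[OF \<open>0 < l\<close>] v(2) order_trans by blast
      finally show ?thesis .
    qed
    then show ?case unfolding add_0_right fm.simps by (rule pr_bind_le)
  next
    case (Suc m)
    have "pr (fm (Suc (Suc v + m)) B (True, \<lambda>_. False)) fst \<le> pr (fm (Suc v + m) B (True, \<lambda>_. False)) fst * 1 + 0"
      unfolding fm.simps by (rule pr_bind_weight) (auto simp: B_def)
    then show ?case using Suc by simp
  qed
  moreover have "Suc v + (length cs - Suc v) = length cs" using v(1) by simp
  ultimately show ?thesis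
    unfolding evals_def B_def[symmetric] by metis
qed

text \<open>A literal is misread only if all \<open>l\<close> trials of its slot show the wrong
  value. Inconclusive results do not count as wrong, since they lead to rejection. The number of
  slots enters through a union bound.\<close>

lemma evals_wrong:
  assumes i: "\<And>v d. v < length cs \<Longrightarrow> pr (rvec n) (\<lambda>z. corr (slotfun p (cs ! v)) d z \<noteq> d (i v)) \<le> 1 / 20"
  shows "pr (evals l p cs x) (\<lambda>e. fst e \<and> (\<exists>v<length cs. snd e v \<noteq> (x (i v) \<noteq> snd (cs ! v) (i v))))
     \<le> real (length cs) / 2 ^ l"
proof -
  define B where "B = (\<lambda>v (e :: bool \<times> (nat \<Rightarrow> bool)). map_pmf (\<lambda>a. (fst e \<and> (fst a \<or> snd a), (snd e)(v := snd a)))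
     (trials n l (slotfun p (cs ! v)) (\<lambda>j. x j \<noteq> snd (cs ! v) j)))"
  define lit where "lit = (\<lambda>v. x (i v) \<noteq> snd (cs ! v) (i v))"
  have "pr (fm m B (True, \<lambda>_. False)) (\<lambda>e. fst e \<and> (\<exists>v<m. snd e v \<noteq> lit v)) \<le> real m / 2 ^ l"
    if "m \<le> length cs" for m using that
  proof (induction m)
    case (Suc m)
    let ?tr = "trials n l (slotfun p (cs ! m)) (\<lambda>j. x j \<noteq> snd (cs ! m) j)"
    let ?t = "trial n (slotfun p (cs ! m)) (\<lambda>j. x j \<noteq> snd (cs ! m) j)"
    have t: "pr ?t (\<lambda>u. snd u \<noteq> lit m) \<le> 1 / 20"
    proof -
      have "pr ?t (\<lambda>u. snd u \<noteq> lit m) = pr (rvec3 n) (\<lambda>(a, b, z). corr (slotfun p (cs ! m)) (\<lambda>j. x j \<noteq> snd (cs ! m) j) z \<noteq> lit m)"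
        unfolding trial_rvec3 pr_map by (simp add: case_prod_unfold)
      also have "\<dots> \<le> 1 / 20" by (rule pr_rvec3_le) (use i[of m "\<lambda>j. x j \<noteq> snd (cs ! m) j"] Suc.prems in \<open>simp add: lit_def\<close>)
      finally show ?thesis .
    qed
    have tr: "pr ?tr (\<lambda>a. (fst a \<or> snd a) \<and> snd a \<noteq> lit m) \<le> 1 / 2 ^ l"
    proof (cases "lit m")
      case True
      have "pr ?tr (\<lambda>a. (fst a \<or> snd a) \<and> snd a \<noteq> lit m) \<le> pr ?tr fst"
        by (rule pr_mono) (use True in auto)
      also have "\<dots> \<le> pr ?t (\<lambda>u. fst u \<and> \<not> snd u) ^ l" by (rule trials_fst)
      also have "\<dots> \<le> pr ?t (\<lambda>u. snd u \<noteq> lit m) ^ l"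
        by (intro power_mono pr_mono) (use True in auto)
      \<comment> \<open>The error 1/20 of a trial is rounded up to 1/2, so that \<open>l\<close>
        trials match the scale \<open>2 ^ l\<close> of the other error terms.\<close>
      also have "\<dots> \<le> (1 / 2) ^ l" by (intro power_mono) (use t in linarith, simp)
      finally show ?thesis by (simp add: power_divide)
    next
      case False
      have "pr ?tr (\<lambda>a. (fst a \<or> snd a) \<and> snd a \<noteq> lit m) \<le> pr ?tr snd"
        by (rule pr_mono) (use False in auto)
      also have "\<dots> \<le> pr ?t (\<lambda>u. fst u \<and> snd u) ^ l" by (rule trials_snd)
      also have "\<dots> \<le> pr ?t (\<lambda>u. snd u \<noteq> lit m) ^ l"
        by (intro power_mono pr_mono) (use False in auto)
      also have "\<dots> \<le> (1 / 2) ^ l" by (intro power_mono) (use t in linarith, simp)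
      finally show ?thesis by (simp add: power_divide)
    qed
    have "pr (fm (Suc m) B (True, \<lambda>_. False)) (\<lambda>e. fst e \<and> (\<exists>v<Suc m. snd e v \<noteq> lit v))
       \<le> pr (fm m B (True, \<lambda>_. False)) (\<lambda>e. fst e \<and> (\<exists>v<m. snd e v \<noteq> lit v)) + 1 / 2 ^ l"
      unfolding fm.simps
    proof (rule pr_bind_split)
      fix e assume e: "\<not> (fst e \<and> (\<exists>v<m. snd e v \<noteq> lit v))"
      have "pr (B m e) (\<lambda>e. fst e \<and> (\<exists>v<Suc m. snd e v \<noteq> lit v)) \<le>
         pr ?tr (\<lambda>a. (fst a \<or> snd a) \<and> snd a \<noteq> lit m)"
        unfolding B_def pr_map by (rule pr_mono) (use e in \<open>auto simp: less_Suc_eq split: if_splits\<close>)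
      with tr show "pr (B m e) (\<lambda>e. fst e \<and> (\<exists>v<Suc m. snd e v \<noteq> lit v)) \<le> 1 / 2 ^ l" by linarith
    qed simp
    also have "\<dots> \<le> real m / 2 ^ l + 1 / 2 ^ l" using Suc by simp
    finally show ?case by (simp add: add_divide_distrib)
  qed simp
  then show ?thesis unfolding evals_def B_def[symmetric] lit_def by blast
qed

end

section \<open>Random partitions into blocks\<close>

lemma fm_invariant:
  assumes "\<And>i a b. i < m \<Longrightarrow> I i a \<Longrightarrow> b \<in> set_pmf (B i a) \<Longrightarrow> I (Suc i) b" "I 0 a"
  shows "b \<in> set_pmf (fm m B a) \<Longrightarrow> I m b"
  using assms(1)
proof (induction m arbitrary: b)
  case (Suc m)
  then obtain c where c: "c \<in> set_pmf (fm m B a)" "b \<in> set_pmf (B m c)" by auto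
  have "I m c" by (rule Suc.IH[OF c(1)], rule Suc.prems(2)) auto
  with c(2) show ?case using Suc.prems(2) by blast
qed (use assms(2) in simp)

lemma rnum_less: "v \<in> set_pmf (rnum l) \<Longrightarrow> v < 2 ^ l"
  unfolding rnum_def by (rule fm_invariant[where I="\<lambda>i v. v < 2 ^ i"]) (auto split: if_splits)

lemma rpart_less:
  assumes "p \<in> set_pmf (rpart n l)"
  shows "p j < 2 ^ l"
proof -
  have "\<forall>j. p j < 2 ^ l"
    using assms unfolding rpart_def
    by (rule fm_invariant[where I="\<lambda>_ p. \<forall>j. p j < 2 ^ l", rotated -1]) (auto dest: rnum_less)
  then show ?thesis by simp
qed

text \<open>The lower bits must form the residue of \<open>c\<close>, and then at most one outcome
  of the last coin is admissible.\<close>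

lemma pr_rnum: "pr (rnum l) (\<lambda>v. v = c) \<le> 1 / 2 ^ l"
proof (induction l arbitrary: c)
  case (Suc l)
  have "pr (rnum (Suc l)) (\<lambda>v. v = c) \<le> pr (rnum l) (\<lambda>v. v = c mod 2 ^ l) * (1 / 2) + 0"
    unfolding rnum_def fm.simps unfolding rnum_def[symmetric]
  proof (rule pr_bind_weight; (unfold pr_map)?)
    fix v
    have "pr coin (\<lambda>b. v + (if b then 2 ^ l else 0) = c) \<le> pr coin (\<lambda>b. b = (c \<noteq> v))"
      by (rule pr_mono) (auto split: if_splits)
    also have "\<dots> = 1 / 2"
      unfolding singleton_conv by (cases "c \<noteq> v") (simp_all add: measure_pmf_single)
    finally show "pr coin (\<lambda>b. v + (if b then 2 ^ l else 0) = c) \<le> 1 / 2 + 0" by simp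
  next
    fix v assume "v \<in> set_pmf (rnum l)" "v \<noteq> c mod 2 ^ l"
    then have "v + (if b then 2 ^ l else 0) \<noteq> c" for b using rnum_less[of v l] by auto
    then show "pr coin (\<lambda>b. v + (if b then 2 ^ l else 0) = c) \<le> 0" by simp
  qed simp
  then show ?case using Suc[of "c mod 2 ^ l"] by simp
qed simp

text \<open>Entry \<open>j\<close> is drawn after entry \<open>i\<close> and has to hit its value;
  later draws change neither.\<close>

lemma rpart_collision:
  assumes "i < j" "j < n"
  shows "pr (rpart n l) (\<lambda>p. p i = p j) \<le> 1 / 2 ^ l"
proof -
  define B where "B = (\<lambda>j p. map_pmf (\<lambda>v. p(j := v)) (rnum l) :: (nat \<Rightarrow> nat) pmf)"
  have "pr (fm (Suc j + m) B (\<lambda>_. 0)) (\<lambda>p. p i = p j) \<le> 1 / 2 ^ l" for m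
  proof (induction m)
    case 0
    have "pr (B j p) (\<lambda>p. p i = p j) \<le> 1 / 2 ^ l" for p
      unfolding B_def pr_map using assms pr_rnum[of l "p i"] by (simp add: eq_commute)
    then show ?case unfolding add_0_right fm.simps by (rule pr_bind_le)
  next
    case (Suc m)
    have "pr (fm (Suc (Suc j + m)) B (\<lambda>_. 0)) (\<lambda>p. p i = p j)
       \<le> pr (fm (Suc j + m) B (\<lambda>_. 0)) (\<lambda>p. p i = p j) * 1 + 0"
      unfolding fm.simps by (rule pr_bind_weight) (use assms in \<open>auto simp: B_def\<close>)
    then show ?case using Suc by simp
  qed
  moreover have "Suc j + (n - Suc j) = n" using assms by simp
  ultimately show ?thesis unfolding rpart_def B_def[symmetric] by metis
qed

text \<open>The birthday bound: a union over the pairs of variables.\<close>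

lemma rpart_inj:
  assumes "V \<subseteq> {..<n}" "card V \<le> k"
  shows "pr (rpart n l) (\<lambda>p. \<not> inj_on p V) \<le> (real k)\<^sup>2 / 2 ^ l"
proof -
  have fin: "finite V" using assms finite_subset by blast
  define J where "J = {(i, j) \<in> V \<times> V. i < j}"
  have J: "J \<subseteq> V \<times> V" "finite J" by (auto simp: J_def intro: finite_subset[of _ "V \<times> V"] fin)
  have "pr (rpart n l) (\<lambda>p. \<not> inj_on p V) \<le> measure_pmf.prob (rpart n l) (\<Union>ij\<in>J. {p. p (fst ij) = p (snd ij)})"
    by (rule measure_pmf.finite_measure_mono) (auto simp: inj_on_def J_def, metis linorder_neqE_nat)
  also have "\<dots> \<le> (\<Sum>ij\<in>J. pr (rpart n l) (\<lambda>p. p (fst ij) = p (snd ij)))"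
    by (rule measure_UNION_le) (use J in auto)
  also have "\<dots> \<le> (\<Sum>ij\<in>J. 1 / 2 ^ l)"
    by (rule sum_mono) (use assms in \<open>auto simp: J_def intro!: rpart_collision\<close>)
  also have "\<dots> = real (card J) / 2 ^ l" by simp
  also have "\<dots> \<le> (real k)\<^sup>2 / 2 ^ l"
  proof -
    have "card J \<le> card (V \<times> V)" by (rule card_mono) (use J fin in auto)
    also have "\<dots> \<le> k * k" using assms by (simp add: card_cartesian_product mult_le_mono)
    finally have "real (card J) \<le> (real k)\<^sup>2" by (metis of_nat_mono of_nat_mult power2_eq_square)
    then show ?thesis by (simp add: divide_right_mono)
  qed
  finally show ?thesis .
qed

text \<open>Adds the share of the initial state to that of its up to \<open>K\<close> successors in
  \<open>stream_bad\<close>.\<close>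

lemma add_count_le: "0 \<le> x \<Longrightarrow> (if b then x else 0) + real K * x \<le> real (Suc K) * (x :: real)"
  by (cases b) (simp_all add: distrib_right)

section \<open>Rejection of far functions\<close>

context oracles
begin

definition okC :: "nat \<Rightarrow> nat \<Rightarrow> nat \<Rightarrow> nat set list \<Rightarrow> bool" where
  "okC s r m ts \<longleftrightarrow> length ts \<le> s \<and> (\<forall>t\<in>set ts. t \<subseteq> {..<m} \<and> card t \<le> r)"

lemma stepC_Change:
  assumes "okC s r (length cs) ts" "Change ts' \<in> set_pmf (stepC s r l p cs ts)"
  shows "okC s r (length cs) ts' \<and> length ts' = Suc (length ts) \<and> length ts' \<le> s"
proof -
  obtain x where "ts' = ts @ [snd (learn p cs x (length cs))]"
      "card (snd (learn p cs x (length cs))) \<le> r" "length ts < s"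
    using assms(2) by (auto simp: stepC_def Let_def split: if_splits)
  then show ?thesis using assms(1) learn_slots[of p cs x "length cs"] by (simp add: okC_def)
qed

text \<open>The literal of slot \<open>v\<close> is satisfied at the points that differ from the witness
  \<open>snd (cs ! v)\<close>, where \<open>f\<close> is false, in the hidden variable \<open>i v\<close>.\<close>

lemma stepC_Pass:
  assumes i: "\<And>v d. v < length cs \<Longrightarrow> pr (rvec n) (\<lambda>z. corr (slotfun p (cs ! v)) d z \<noteq> d (i v)) \<le> 1 / 20"
    and ok: "okC s r (length cs) ts"
  shows "pr (stepC s r l p cs ts) (\<lambda>out. out = Pass) \<le>
    1 - pr D (\<lambda>y. ask (hyb p (fst ` set cs) 0 ((!) y)) \<noteq> holds ts (\<lambda>v. y ! i v \<noteq> snd (cs ! v) (i v)))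
    + real (length cs) / 2 ^ l"
  unfolding pr_not[symmetric] stepC_def Let_def
proof (rule pr_bind_split)
  fix y
  assume "\<not> \<not> ask (hyb p (fst ` set cs) 0 ((!) y)) \<noteq> holds ts (\<lambda>v. y ! i v \<noteq> snd (cs ! v) (i v))"
  \<comment> \<open>At a point of disagreement an exact evaluation never leads to
    \<open>Pass\<close>, so passing requires a misread literal.\<close>
  then have ne: "holds ts e \<noteq> ask (hyb p (fst ` set cs) 0 ((!) y))"
    if "\<forall>v<length cs. e v = (y ! i v \<noteq> snd (cs ! v) (i v))" for e
  proof -
    have "holds ts e = holds ts (\<lambda>v. y ! i v \<noteq> snd (cs ! v) (i v))"
      unfolding holds_def by (intro bex_cong ball_cong refl) (use that ok in \<open>auto simp: okC_def\<close>)
    with \<open>\<not> \<not> _\<close> show ?thesis by blast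
  qed
  show "pr (map_pmf (\<lambda>e. if \<not> fst e then Rej
       else if ask (hyb p (fst ` set cs) 0 ((!) y)) = holds ts (snd e) then Pass
       else if holds ts (snd e) then Rej
       else if card (snd (learn p cs ((!) y) (length cs))) \<le> r \<and> length ts < s
         then Change (ts @ [snd (learn p cs ((!) y) (length cs))]) else Rej)
     (evals l p cs ((!) y))) (\<lambda>out. out = Pass) \<le> real (length cs) / 2 ^ l"
    unfolding pr_map
    by (rule order_trans[OF pr_mono evals_wrong[OF i, where x="(!) y"]])
       (use ne in \<open>auto split: if_splits\<close>)
qed simp

lemma stepC_bad_slot:
  assumes "v < length cs" "\<And>d. pr (trial n (slotfun p (cs ! v)) d) fst \<le> c" "0 < l" "0 \<le> c"
  shows "pr (stepC s r l p cs ts) (\<lambda>out. out = Pass) \<le> c"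
  unfolding stepC_def
proof (rule pr_bind_le)
  fix y
  show "pr (let x = (!) y in map_pmf (\<lambda>e.
       if \<not> fst e then Rej
       else if ask (hyb p (fst ` set cs) 0 x) = holds ts (snd e) then Pass
       else if holds ts (snd e) then Rej
       else let t = snd (learn p cs x (length cs)) in
         if card t \<le> r \<and> length ts < s then Change (ts @ [t]) else Rej)
     (evals l p cs x)) (\<lambda>out. out = Pass) \<le> c"
    unfolding Let_def pr_map
    by (rule order_trans[OF pr_mono evals_bad_slot[OF assms(1-3), where x="(!) y"]])
       (auto split: if_splits)
qed

text \<open>The orientation is read off the witnesses: the literal of slot \<open>v\<close> is
  satisfied where a point differs from the witness in \<open>i v\<close>, so it is negated exactly
  if the witness is true there. Distinct blocks force distinct variables, so these choices never
  conflict.\<close>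

lemma holds_unate:
  assumes ok: "okC s r (length cs) ts" and dist: "distinct (map fst cs)"
    and i: "\<And>v. v < length cs \<Longrightarrow> i v < n" "\<And>v. v < length cs \<Longrightarrow> p (i v) = fst (cs ! v)"
  shows "(\<lambda>y. holds ts (\<lambda>v. y ! i v \<noteq> snd (cs ! v) (i v))) \<in> term_unate_dnf n s r"
proof -
  define m where "m = length cs"
  have inj: "u = v" if "u < m" "v < m" "i u = i v" for u v
    using that i(2)[of u] i(2)[of v] dist by (auto simp: m_def distinct_conv_nth)
  define \<xi> where "\<xi> = pt n (\<lambda>j. \<exists>v<m. j = i v \<and> snd (cs ! v) j)"
  have \<xi>: "\<xi> \<in> cube n" by (simp add: \<xi>_def cube_def pt_def)
  have lit: "literals \<xi> x ! i v \<noteq> snd (cs ! v) (i v) \<longleftrightarrow> x ! i v" if "x \<in> cube n" "v < m" for x v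
  proof -
    have "\<xi> ! i v = snd (cs ! v) (i v)"
      using i(1)[of v] that inj by (auto simp: \<xi>_def pt_def m_def)
    then show ?thesis using i(1)[of v] that \<xi> by (auto simp: literals_def cube_def m_def)
  qed
  define T where "T = (\<lambda>t. i ` t) ` set ts"
  have "card T \<le> s"
    unfolding T_def using ok card_image_le[of "set ts" "\<lambda>t. i ` t"] card_length[of ts]
    by (auto simp: okC_def)
  moreover have "t \<subseteq> {..<n} \<and> card t \<le> r" if tT: "t \<in> T" for t
  proof -
    obtain u where u: "u \<in> set ts" "t = i ` u" using tT by (auto simp: T_def)
    then have "u \<subseteq> {..<m}" "card u \<le> r" using ok by (auto simp: okC_def m_def)
    then show ?thesis using i(1) u card_image_le[of u i] finite_subset[of u "{..<m}"]
      by (auto simp: m_def)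
  qed
  moreover have "holds ts (\<lambda>v. literals \<xi> x ! i v \<noteq> snd (cs ! v) (i v)) \<longleftrightarrow> (\<exists>t\<in>T. \<forall>i\<in>t. x ! i)"
    if "x \<in> cube n" for x
  proof -
    have "holds ts (\<lambda>v. literals \<xi> x ! i v \<noteq> snd (cs ! v) (i v)) \<longleftrightarrow> holds ts (\<lambda>v. x ! i v)"
      unfolding holds_def
      by (intro bex_cong ball_cong refl lit[OF that]) (use ok in \<open>auto simp: okC_def m_def\<close>)
    then show ?thesis by (auto simp: holds_def T_def)
  qed
  ultimately show ?thesis
    unfolding term_unate_dnf_def term_monotone_dnf_def
    by (intro CollectI bexI[OF _ \<xi>] exI[of _ T]) (auto simp: T_def)
qed

text \<open>\<epsilon> is at least 4 \<gamma>. If clearing the unknown blocks changes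
  \<open>f\<close> on weight below 2 \<gamma>, all slots are good, and the hypothesis misses the
  cleared function on weight below 2 \<gamma>, then \<open>f\<close> is closer than \<epsilon> to a
  member of the class. For a far \<open>f\<close>, every accepting run therefore ends one of its two
  streams in a bad state.\<close>

theorem algo_sound:
  assumes D: "set_pmf D \<subseteq> cube n" and far: "far_from D \<epsilon> f (term_unate_dnf n s r)"
    and e: "1 \<le> e" "1 / real e \<le> \<epsilon>" and l: "0 < l" "real (r * s) / 2 ^ l \<le> 1 / (4 * real e)"
    and N: "real (r * s + s + 2) * (1 - 1 / (40 * real e)) ^ N \<le> 1 / 3"
  shows "pr (algo s r l N) (\<lambda>b. b) \<le> 1 / 3"
proof -
  \<comment> \<open>One sample exposes the three kinds of bad states with probability at least 2
    \<gamma>, 1/40 and 2 \<gamma> - \<gamma>, where the subtracted \<gamma> pays for misread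
    literals; \<eta> is a common lower bound.\<close>
  define \<eta> where "\<eta> = 1 / (40 * real e)"
  define \<gamma> where "\<gamma> = 1 / (4 * real e)"
  have \<eta>: "0 \<le> \<eta>" "\<eta> \<le> 1" "\<eta> \<le> 1 / 40" "\<eta> \<le> \<gamma>" "\<eta> \<le> 2 * \<gamma>" using e by (auto simp: \<eta>_def \<gamma>_def field_simps)
  have \<epsilon>: "4 * \<gamma> \<le> \<epsilon>" using e by (simp add: \<gamma>_def)
  have l2: "real (r * s) / 2 ^ l \<le> \<gamma>" using l by (simp add: \<gamma>_def)
  have "pr (algo s r l N) (\<lambda>b. b) \<le> real (Suc (r * s)) * (1 - \<eta>) ^ N + real (Suc s) * (1 - \<eta>) ^ N"
    unfolding algo_def
  proof (rule pr_bind_le)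
    fix p assume "p \<in> set_pmf (rpart n l)"
    then have p: "p j < 2 ^ l" for j by (rule rpart_less)
    define badA where "badA = (\<lambda>cs :: slots. 2 * \<gamma> \<le> pr D (\<lambda>v. ask ((!) v) \<noteq> ask (hyb p (fst ` set cs) 0 ((!) v))))"
    let ?A = "stream (stepA (r * s) l p) N (Suc (r * s) * N) [] 0"
    have "pr ?A (\<lambda>res. \<exists>a'. res = Some a' \<and> badA a') \<le>
        (if badA [] then (1 - \<eta>) ^ (N - 0) else 0) + real (r * s - length ([] :: slots)) * (1 - \<eta>) ^ N"
    proof (rule stream_bad[where I="okA (r * s)"])
      show "okA (r * s) a' \<and> length a' = Suc (length a) \<and> length a' \<le> r * s"
        if "okA (r * s) a" "Change a' \<in> set_pmf (stepA (r * s) l p a)" for a a'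
        using that stepA_Change[of p l] p by blast
      show "pr (stepA (r * s) l p a) (\<lambda>out. out = Pass) \<le> 1 - \<eta>" if "badA a" for a
        using that \<eta> unfolding badA_def stepA_Pass by linarith
    qed (use \<eta>(1,2) in \<open>simp_all add: okA_def\<close>)
    also have "\<dots> \<le> real (Suc (r * s)) * (1 - \<eta>) ^ N"
      using \<eta>(2) unfolding list.size(3) diff_zero by (intro add_count_le) simp
    finally have A: "pr ?A (\<lambda>res. \<exists>a'. res = Some a' \<and> badA a') \<le> real (Suc (r * s)) * (1 - \<eta>) ^ N" .
    have "pr (?A \<bind> (\<lambda>A. case A of None \<Rightarrow> return_pmf False
        | Some cs \<Rightarrow> map_pmf (\<lambda>C. C \<noteq> None) (stream (stepC s r l p cs) N (Suc s * N) [] 0))) (\<lambda>b. b)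
       \<le> pr ?A (\<lambda>res. \<exists>a'. res = Some a' \<and> badA a') + real (Suc s) * (1 - \<eta>) ^ N"
    proof (rule pr_bind_split)
      fix A assume A: "A \<in> set_pmf ?A" "\<not> (\<exists>a'. A = Some a' \<and> badA a')"
      show "pr (case A of None \<Rightarrow> return_pmf False
        | Some cs \<Rightarrow> map_pmf (\<lambda>C. C \<noteq> None) (stream (stepC s r l p cs) N (Suc s * N) [] 0)) (\<lambda>b. b)
        \<le> real (Suc s) * (1 - \<eta>) ^ N"
      proof (cases A)
        case (Some cs)
        have "okA (r * s) cs"
        proof (rule stream_invariant[where I="okA (r * s)", OF _ _ A(1)[unfolded Some]])
          show "okA (r * s) a'" if "okA (r * s) a" "Change a' \<in> set_pmf (stepA (r * s) l p a)" for a a'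
            using that stepA_Change[of p l] p by blast
        qed (simp add: okA_def)
        then have cs: "distinct (map fst cs)" "length cs \<le> r * s" by (auto simp: okA_def)
        define good where "good = (\<lambda>v. pr (trial n (slotfun p (cs ! v)) (\<lambda>_. False)) (\<lambda>u. \<not> fst u) \<le> 1 / 40)"
        \<comment> \<open>The index is meaningful for good slots only; a slot that is not good makes
          the state bad in any case.\<close>
        define i where "i = (\<lambda>v. SOME i. i < n \<and> p i = fst (cs ! v) \<and>
           (\<forall>d. pr (rvec n) (\<lambda>z. corr (slotfun p (cs ! v)) d z \<noteq> d i) \<le> 1 / 20))"
        have i: "i v < n \<and> p (i v) = fst (cs ! v) \<and>
           (\<forall>d. pr (rvec n) (\<lambda>z. corr (slotfun p (cs ! v)) d z \<noteq> d (i v)) \<le> 1 / 20)" if "good v" for v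
          unfolding i_def by (rule someI_ex) (use that slot_variable in \<open>metis good_def\<close>)
        define H where "H = (\<lambda>ts y. holds ts (\<lambda>v. y ! i v \<noteq> snd (cs ! v) (i v)))"
        define F where "F = (\<lambda>y. ask (hyb p (fst ` set cs) 0 ((!) y)))"
        define badC where "badC = (\<lambda>ts. (\<exists>v<length cs. \<not> good v) \<or> 2 * \<gamma> \<le> pr D (\<lambda>y. F y \<noteq> H ts y))"
        \<comment> \<open>Triangle inequality through the cleared function \<open>F\<close>, which
          is close to \<open>f\<close> because the first stream did not end in a bad state.\<close>
        have all_bad: "badC ts" if ok: "okC s r (length cs) ts" for ts
        proof (rule ccontr)
          assume nb: "\<not> badC ts"
          then have good: "good v" if "v < length cs" for v using that unfolding badC_def by blast
          have H: "H ts \<in> term_unate_dnf n s r"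
            unfolding H_def by (rule holds_unate[OF ok cs(1), where p=p]) (use i good in blast)+
          have "pr D (\<lambda>y. f y \<noteq> H ts y) \<le> pr D (\<lambda>y. ask ((!) y) \<noteq> F y \<or> F y \<noteq> H ts y)"
            by (rule pr_mono) (use D ask_nth in auto)
          also have "\<dots> \<le> pr D (\<lambda>y. ask ((!) y) \<noteq> F y) + pr D (\<lambda>y. F y \<noteq> H ts y)" by (rule pr_disj)
          also have "\<dots> < 4 * \<gamma>" using nb A(2) Some unfolding badC_def badA_def F_def by fastforce
          finally show False using far H \<epsilon> unfolding far_from_def by force
        qed
        have "pr (stream (stepC s r l p cs) N (Suc s * N) [] 0) (\<lambda>C. C \<noteq> None)
          \<le> pr (stream (stepC s r l p cs) N (Suc s * N) [] 0) (\<lambda>res. \<exists>a'. res = Some a' \<and> badC a')"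
        proof (rule pr_mono)
          fix C assume C: "C \<in> set_pmf (stream (stepC s r l p cs) N (Suc s * N) [] 0)" "C \<noteq> None"
          then obtain ts where ts: "C = Some ts" by blast
          have "okC s r (length cs) ts"
          proof (rule stream_invariant[where I="okC s r (length cs)", OF _ _ C(1)[unfolded ts]])
            show "okC s r (length cs) a'"
              if "okC s r (length cs) a" "Change a' \<in> set_pmf (stepC s r l p cs a)" for a a'
              using that stepC_Change by blast
          qed (simp add: okC_def)
          then show "\<exists>a'. C = Some a' \<and> badC a'" using ts all_bad by blast
        qed
        also have "\<dots> \<le> (if badC [] then (1 - \<eta>) ^ (N - 0) else 0) + real (s - length ([] :: nat set list)) * (1 - \<eta>) ^ N"
        proof (rule stream_bad[where I="okC s r (length cs)"])
          show "okC s r (length cs) a' \<and> length a' = Suc (length a) \<and> length a' \<le> s"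
            if "okC s r (length cs) a" "Change a' \<in> set_pmf (stepC s r l p cs a)" for a a'
            using that stepC_Change by blast
          show "pr (stepC s r l p cs a) (\<lambda>out. out = Pass) \<le> 1 - \<eta>"
            if ok: "okC s r (length cs) a" and bad: "badC a" for a
          proof (cases "\<exists>v<length cs. \<not> good v")
            case True
            then obtain v where v: "v < length cs" "\<not> good v" by blast
            have "pr (trial n (slotfun p (cs ! v)) d) fst \<le> 39 / 40" for d
            proof -
              \<comment> \<open>The tests do not involve \<open>d\<close>, so a failure rate
                established at one argument holds at all arguments used by
                \<open>evals\<close>.\<close>
              have "pr (trial n (slotfun p (cs ! v)) d) fst = pr (trial n (slotfun p (cs ! v)) (\<lambda>_. False)) fst"
                unfolding trial_rvec3 pr_map by (simp add: case_prod_unfold)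
              then show ?thesis using v(2) by (simp add: good_def pr_not)
            qed
            then have "pr (stepC s r l p cs a) (\<lambda>out. out = Pass) \<le> 39 / 40"
              by (intro stepC_bad_slot[OF v(1)] l) auto
            then show ?thesis using \<eta> by simp
          next
            case False
            then have "2 * \<gamma> \<le> pr D (\<lambda>y. F y \<noteq> H a y)" using bad by (auto simp: badC_def)
            moreover have "real (length cs) / 2 ^ l \<le> \<gamma>"
              by (rule order_trans[OF divide_right_mono l2]) (use cs(2) in \<open>simp_all only: of_nat_le_iff\<close>, simp)
            moreover have "pr (stepC s r l p cs a) (\<lambda>out. out = Pass) \<le>
               1 - pr D (\<lambda>y. F y \<noteq> H a y) + real (length cs) / 2 ^ l"
              unfolding F_def H_def by (rule stepC_Pass[OF _ ok]) (use i False in auto)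
            ultimately show ?thesis using \<eta> by linarith
          qed
        qed (use \<eta>(1,2) in \<open>simp_all add: okC_def\<close>)
        also have "\<dots> \<le> real (Suc s) * (1 - \<eta>) ^ N"
          using \<eta>(2) unfolding list.size(3) diff_zero by (intro add_count_le) simp
        finally show ?thesis using Some by (simp add: pr_map del: measure_map_pmf)
      qed (use \<eta>(2) in simp)
    qed (use \<eta>(2) in simp)
    then show "pr (?A \<bind> (\<lambda>A. case A of None \<Rightarrow> return_pmf False
        | Some cs \<Rightarrow> map_pmf (\<lambda>C. C \<noteq> None) (stream (stepC s r l p cs) N (Suc s * N) [] 0))) (\<lambda>b. b)
       \<le> real (Suc (r * s)) * (1 - \<eta>) ^ N + real (Suc s) * (1 - \<eta>) ^ N"
      using A by linarith
  qed
  also have "\<dots> = real (r * s + s + 2) * (1 - \<eta>) ^ N" by (simp add: algebra_simps)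
  finally show ?thesis using N by (simp add: \<eta>_def)
qed

end

section \<open>Completeness\<close>

lemma trials_dictator:
  assumes G: "\<And>d. G d = d i" and a: "a \<in> set_pmf (trials n l G d)" and "0 < l"
  shows "(fst a \<or> snd a) \<and> snd a = d i"
proof -
  have u: "fst u \<and> snd u = d i" if "u \<in> set_pmf (trial n G d)" for u
    using that by (auto simp: trial_def lin_ok_def mul_ok_def one_ok_def corr_def G)
  \<comment> \<open>Before any trial both flags are up; from the first trial on exactly the correct
    one survives, hence the disjunct for zero.\<close>
  have "fst a = (l = 0 \<or> \<not> d i) \<and> snd a = (l = 0 \<or> d i)"
    using a unfolding trials_def
    by (rule fm_invariant[where I="\<lambda>m a. fst a = (m = 0 \<or> \<not> d i) \<and> snd a = (m = 0 \<or> d i)", rotated -1])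
       (auto dest: u)
  then show ?thesis using \<open>0 < l\<close> by auto
qed

text \<open>Applying \<open>literals \<xi>\<close> twice gives the identity, so the monotone form
  after the substitution becomes a form of \<open>f\<close> itself, in which a literal is satisfied
  where the point differs from \<xi>.\<close>

lemma term_unate_dnfE:
  assumes "f \<in> term_unate_dnf n s r"
  obtains \<xi> T where "finite T" "card T \<le> s" "\<forall>t\<in>T. t \<subseteq> {..<n} \<and> card t \<le> r"
    "\<forall>g. oracles.ask n f g \<longleftrightarrow> (\<exists>t\<in>T. \<forall>i\<in>t. g i \<noteq> \<xi> i)"
proof -
  obtain \<xi> T where \<xi>: "\<xi> \<in> cube n" and T: "finite T" "card T \<le> s" "\<forall>t\<in>T. t \<subseteq> {..<n} \<and> card t \<le> r"
    and f: "\<forall>x\<in>cube n. f (literals \<xi> x) \<longleftrightarrow> (\<exists>t\<in>T. \<forall>i\<in>t. x ! i)"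
    using assms by (auto simp: term_unate_dnf_def term_monotone_dnf_def)
  have "oracles.ask n f g \<longleftrightarrow> (\<exists>t\<in>T. \<forall>i\<in>t. g i \<noteq> \<xi> ! i)" for g
  proof -
    define x where "x = literals \<xi> (pt n g)"
    have x: "x \<in> cube n" "literals \<xi> x = pt n g" "\<And>i. i < n \<Longrightarrow> x ! i = (g i \<noteq> \<xi> ! i)"
      using \<xi> by (auto simp: x_def literals_def cube_def pt_def list_eq_iff_nth_eq)
    have "oracles.ask n f g \<longleftrightarrow> (\<exists>t\<in>T. \<forall>i\<in>t. x ! i)"
      using f x by (metis oracles.ask_def)
    also have "\<dots> \<longleftrightarrow> (\<exists>t\<in>T. \<forall>i\<in>t. g i \<noteq> \<xi> ! i)"
      by (intro bex_cong ball_cong refl x(3)) (use T(3) in auto)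
    finally show ?thesis .
  qed
  then show ?thesis using that[of T "(!) \<xi>"] T by blast
qed

text \<open>The situation for a member of the class once the partition has separated its relevant
  variables.\<close>

locale unate = oracles +
  fixes s r l :: nat and T :: "nat set set" and \<xi> :: "nat \<Rightarrow> bool" and p :: "nat \<Rightarrow> nat"
  assumes T: "finite T" "card T \<le> s" and small: "\<And>t. t \<in> T \<Longrightarrow> t \<subseteq> {..<n} \<and> card t \<le> r"
    and ask: "\<And>g. ask g \<longleftrightarrow> (\<exists>t\<in>T. \<forall>i\<in>t. g i \<noteq> \<xi> i)"
    and p: "\<And>j. p j < 2 ^ l" and inj: "inj_on p (\<Union>T)" and l: "0 < l"
begin

lemma card_vars: "finite (\<Union>T)" "card (\<Union>T) \<le> r * s"
proof -
  show "finite (\<Union>T)" using T small finite_subset by blast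
  have "card (\<Union>T) \<le> (\<Sum>t\<in>T. card t)" by (rule card_Union_le_sum_card)
  also have "\<dots> \<le> (\<Sum>t\<in>T. r)" by (rule sum_mono) (use small in blast)
  also have "\<dots> \<le> r * s" using T by simp
  finally show "card (\<Union>T) \<le> r * s" .
qed

lemma ask_vars: "(\<And>i. i \<in> \<Union>T \<Longrightarrow> x i = y i) \<Longrightarrow> ask x = ask y"
  unfolding ask by (intro bex_cong ball_cong refl) auto

text \<open>The last conjunct makes the witness falsify the literal, so that copying the witness on
  the block switches the literal off.\<close>

definition hidden :: "nat \<times> (nat \<Rightarrow> bool) \<Rightarrow> nat \<Rightarrow> bool" where
  "hidden c i \<longleftrightarrow> i \<in> \<Union>T \<and> p i = fst c \<and> (\<forall>d. ask (toggle p c d) = d i) \<and> snd c i = \<xi> i"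

text \<open>Some term is true at the neighbouring hybrid \<open>w'\<close> and fails at
  \<open>w\<close> in a variable \<open>i\<close>, which must lie in the block where the two differ.
  Injectivity leaves no other relevant variable there, so on the relevant variables toggling yields
  \<open>w'\<close> or \<open>w\<close>, according to \<open>d i\<close>.\<close>

lemma newslot_hidden:
  assumes "ask x \<noteq> ask (hyb p Bs 0 x)"
  shows "fst (newslot p Bs l x) \<notin> Bs \<and> (\<exists>i. hidden (newslot p Bs l x) i)"
proof -
  obtain B w w' where c: "newslot p Bs l x = (B, w)" "B \<notin> Bs" "\<not> ask w" "ask w'"
      "\<And>j. p j \<noteq> B \<Longrightarrow> w' j = w j"
    using newslot[of p l x Bs] p assms by metis
  obtain t where t: "t \<in> T" "\<And>i. i \<in> t \<Longrightarrow> w' i \<noteq> \<xi> i" using c(4) ask by auto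
  obtain i where i: "i \<in> t" "w i = \<xi> i" using c(3) t(1) ask by auto
  have iB: "p i = B" using c(5) i t by metis
  have iV: "i \<in> \<Union>T" using i t by blast
  have u: "j = i" if "j \<in> \<Union>T" "p j = B" for j using inj iB iV that by (auto dest: inj_onD)
  have "ask (toggle p (B, w) d) = d i" for d
  proof (cases "d i")
    case True
    have "ask (toggle p (B, w) d) = ask w'"
    proof (rule ask_vars)
      fix j assume j: "j \<in> \<Union>T"
      show "toggle p (B, w) d j = w' j"
      proof (cases "p j = B")
        case True
        then have "j = i" using u j by blast
        then show ?thesis using \<open>d i\<close> i t(2)[OF i(1)] iB by (auto simp: toggle_def)
      qed (use c(5) in \<open>simp add: toggle_def\<close>)
    qed
    then show ?thesis using c(4) True by simp
  next
    case False
    have "ask (toggle p (B, w) d) = ask w"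
      by (rule ask_vars) (use u False in \<open>auto simp: toggle_def\<close>)
    then show ?thesis using c(3) False by simp
  qed
  then show ?thesis using c i iB iV by (auto simp: hidden_def)
qed

definition goodA :: "slots \<Rightarrow> bool" where
  "goodA cs \<longleftrightarrow> distinct (map fst cs) \<and> (\<forall>c\<in>set cs. \<exists>i. hidden c i)"

text \<open>Distinct slots occupy distinct blocks, each of which contains a relevant
  variable.\<close>

lemma goodA_length: "goodA cs \<Longrightarrow> length cs \<le> r * s"
proof -
  assume g: "goodA cs"
  have "length cs = card (fst ` set cs)"
    using g distinct_card[of "map fst cs"] by (simp add: goodA_def)
  also have "\<dots> \<le> card (p ` \<Union>T)"
  proof (rule card_mono)
    show "fst ` set cs \<subseteq> p ` \<Union>T" using g unfolding goodA_def hidden_def by (metis image_eqI image_subsetI)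
  qed (use card_vars(1) in blast)
  also have "\<dots> \<le> r * s" using card_image_le[OF card_vars(1), of p] card_vars(2) by simp
  finally show ?thesis .
qed

lemma goodA_newslot:
  assumes "goodA cs" "ask x \<noteq> ask (hyb p (fst ` set cs) 0 x)"
  shows "goodA (cs @ [newslot p (fst ` set cs) l x])"
  using assms newslot_hidden[OF assms(2)] by (auto simp: goodA_def)

lemma stepA_good: "goodA cs \<Longrightarrow> Change cs' \<in> set_pmf (stepA (r * s) l p cs) \<Longrightarrow> goodA cs'"
  using goodA_newslot by (auto simp: stepA_def Let_def split: if_splits)

text \<open>A discrepancy always yields one more good slot, so it cannot occur when
  \<open>r * s\<close> of them are already known.\<close>

lemma stepA_no_Rej: "goodA cs \<Longrightarrow> Rej \<notin> set_pmf (stepA (r * s) l p cs)"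
  using goodA_newslot goodA_length by (fastforce simp: stepA_def Let_def split: if_splits)

end

section \<open>Learning terms over the hidden literals\<close>

locale unate_slots = unate +
  fixes cs :: slots and i :: "nat \<Rightarrow> nat"
  assumes dist: "distinct (map fst cs)"
    and hid: "\<And>v. v < length cs \<Longrightarrow> hidden (cs ! v) (i v)"
begin

definition sat :: "(nat \<Rightarrow> bool) \<Rightarrow> nat set" where
  "sat x = {v. v < length cs \<and> x (i v) \<noteq> \<xi> (i v)}"

definition slots_of :: "nat set \<Rightarrow> nat set" where
  "slots_of t = {v. v < length cs \<and> i v \<in> t}"

text \<open>The cleared function as a monotone function of the satisfied slots. A variable without a
  slot is cleared, so its literal holds exactly if it is negated.\<close>

definition val :: "nat set \<Rightarrow> bool" where
  "val S \<longleftrightarrow> (\<exists>t\<in>T. slots_of t \<subseteq> S \<and> (\<forall>j\<in>t. j \<notin> i ` {..<length cs} \<longrightarrow> \<xi> j))"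

abbreviation F :: "(nat \<Rightarrow> bool) \<Rightarrow> bool" where
  "F x \<equiv> ask (hyb p (fst ` set cs) 0 x)"

lemma val_mono: "val S \<Longrightarrow> S \<subseteq> S' \<Longrightarrow> val S'"
  by (auto simp: val_def)

lemma block: "v < length cs \<Longrightarrow> p (i v) = fst (cs ! v)"
  using hid by (auto simp: hidden_def)

lemma i_inj: "u < length cs \<Longrightarrow> v < length cs \<Longrightarrow> i u = i v \<Longrightarrow> u = v"
  using block[of u] block[of v] dist by (auto simp: distinct_conv_nth)

lemma F_val: "F x = val (sat x)"
proof -
  \<comment> \<open>Injectivity makes the slot variable the only relevant one in a known block; all
    other relevant variables lie in cleared blocks.\<close>
  have known: "p j \<in> fst ` set cs \<longleftrightarrow> j \<in> i ` {..<length cs}" if "j \<in> \<Union>T" for j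
  proof
    assume "p j \<in> fst ` set cs"
    then obtain v where v: "v < length cs" "p j = fst (cs ! v)" by (auto simp: in_set_conv_nth)
    then have "j = i v" using hid[of v] inj_onD[OF inj, of j "i v"] that unfolding hidden_def by metis
    then show "j \<in> i ` {..<length cs}" using v by blast
  next
    assume "j \<in> i ` {..<length cs}"
    then show "p j \<in> fst ` set cs" using block by auto
  qed
  have "(\<forall>j\<in>t. hyb p (fst ` set cs) 0 x j \<noteq> \<xi> j) \<longleftrightarrow>
      slots_of t \<subseteq> sat x \<and> (\<forall>j\<in>t. j \<notin> i ` {..<length cs} \<longrightarrow> \<xi> j)" if "t \<in> T" for t
  proof -
    have "hyb p (fst ` set cs) 0 x j \<noteq> \<xi> j \<longleftrightarrow> (if j \<in> i ` {..<length cs} then x j \<noteq> \<xi> j else \<xi> j)"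
      if "j \<in> t" for j
      using known[of j] that \<open>t \<in> T\<close> by (auto simp: hyb_def)
    then have "(\<forall>j\<in>t. hyb p (fst ` set cs) 0 x j \<noteq> \<xi> j) \<longleftrightarrow>
        (\<forall>j\<in>t. if j \<in> i ` {..<length cs} then x j \<noteq> \<xi> j else \<xi> j)" by blast
    also have "\<dots> \<longleftrightarrow> slots_of t \<subseteq> sat x \<and> (\<forall>j\<in>t. j \<notin> i ` {..<length cs} \<longrightarrow> \<xi> j)"
      by (auto simp: slots_of_def sat_def split: if_splits)
    finally show ?thesis .
  qed
  then show ?thesis unfolding ask val_def by blast
qed

text \<open>Every slot already visited is switched off or essential, in the sense that dropping it
  makes the function false. By monotonicity an essential slot stays essential while further ones are
  switched off.\<close>

lemma learn:
  assumes "F x" "v \<le> length cs"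
  shows "(case learn p cs x v of (y, t) \<Rightarrow> F y \<and> sat y \<subseteq> sat x \<and> t \<subseteq> sat y \<and> sat y \<inter> {..<v} \<subseteq> t \<and>
     (\<forall>u\<in>t. \<not> val (sat y - {u})))"
  using assms(2)
proof (induction v)
  case 0
  then show ?case using assms(1) by simp
next
  case (Suc v)
  obtain y t where yt: "learn p cs x v = (y, t)" by fastforce
  define y' where "y' = (\<lambda>j. if p j = fst (cs ! v) then snd (cs ! v) j else y j)"
  have v: "v < length cs" using Suc.prems by simp
  have IH: "F y" "sat y \<subseteq> sat x" "t \<subseteq> sat y" "sat y \<inter> {..<v} \<subseteq> t" "\<forall>u\<in>t. \<not> val (sat y - {u})"
    using Suc yt by auto
  have t: "t \<subseteq> {..<v}" using learn_slots[of p cs x v] yt by simp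
  have "y' (i u) \<noteq> \<xi> (i u) \<longleftrightarrow> u \<noteq> v \<and> y (i u) \<noteq> \<xi> (i u)" if "u < length cs" for u
  proof (cases "u = v")
    case True
    then show ?thesis using hid[OF v] by (auto simp: y'_def hidden_def)
  next
    case False
    then have "fst (cs ! u) \<noteq> fst (cs ! v)" using dist that v by (auto simp: distinct_conv_nth)
    then show ?thesis using False block that by (auto simp: y'_def)
  qed
  then have sat': "sat y' = sat y - {v}" by (auto simp: sat_def)
  show ?case
  proof (cases "F y'")
    case True
    have "sat y' - {u} \<subseteq> sat y - {u}" for u using sat' by auto
    then have "\<forall>u\<in>t. \<not> val (sat y' - {u})" using IH(5) val_mono by blast
    then show ?thesis using IH t True sat'
      by (auto simp: yt y'_def[symmetric] Let_def less_Suc_eq)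
  next
    case False
    then have "\<not> val (sat y - {v})" using F_val sat' by simp
    \<comment> \<open>Switching off a slot that is not satisfied changes nothing, so a failed
      attempt shows that \<open>v\<close> is satisfied.\<close>
    moreover have "v \<in> sat y"
    proof (rule ccontr)
      assume "v \<notin> sat y"
      then have "sat y - {v} = sat y" by auto
      with \<open>\<not> val (sat y - {v})\<close> show False using F_val IH(1) by simp
    qed
    ultimately show ?thesis using IH t False
      by (auto simp: yt y'_def[symmetric] Let_def less_Suc_eq)
  qed
qed

text \<open>The satisfied set that remains is minimal among the true ones. A term that makes it true
  must use all of its slots, so the set is exactly the slot set of that term, and at most
  \<open>card T\<close> different results are possible.\<close>

lemma learn_term:
  assumes "F x"
  shows "snd (learn p cs x (length cs)) \<in> slots_of ` T \<and> val (snd (learn p cs x (length cs))) \<and>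
    snd (learn p cs x (length cs)) \<subseteq> sat x"
proof -
  obtain y t where yt: "learn p cs x (length cs) = (y, t)" by fastforce
  have y: "F y" "sat y \<subseteq> sat x" "t \<subseteq> sat y" "sat y \<inter> {..<length cs} \<subseteq> t" "\<forall>u\<in>t. \<not> val (sat y - {u})"
    using learn[OF assms, of "length cs"] yt by auto
  have ty: "t = sat y" using y(3,4) by (auto simp: sat_def)
  have "val t" using y(1) F_val ty by simp
  then obtain \<tau> where \<tau>: "\<tau> \<in> T" "slots_of \<tau> \<subseteq> t" "\<forall>j\<in>\<tau>. j \<notin> i ` {..<length cs} \<longrightarrow> \<xi> j"
    by (auto simp: val_def)
  have "t \<subseteq> slots_of \<tau>"
  proof
    fix u assume u: "u \<in> t"
    show "u \<in> slots_of \<tau>"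
    proof (rule ccontr)
      assume "u \<notin> slots_of \<tau>"
      then have "val (t - {u})" using \<tau> unfolding val_def by blast
      then show False using y(5) u ty by simp
    qed
  qed
  then have "t = slots_of \<tau>" using \<tau>(2) by blast
  then show ?thesis using yt \<tau>(1) \<open>val t\<close> y(2) ty by auto
qed

lemma evals_exact:
  assumes "e \<in> set_pmf (evals l p cs x)"
  shows "fst e \<and> (\<forall>v<length cs. snd e v \<longleftrightarrow> v \<in> sat x)"
  using assms unfolding evals_def
proof (rule fm_invariant[where I="\<lambda>m e. fst e \<and> (\<forall>v<m. snd e v \<longleftrightarrow> v \<in> sat x)", rotated -1])
  fix v e e' assume v: "v < length cs" and e: "fst e \<and> (\<forall>u<v. snd e u \<longleftrightarrow> u \<in> sat x)"
    and "e' \<in> set_pmf (map_pmf (\<lambda>a. (fst e \<and> (fst a \<or> snd a), (snd e)(v := snd a)))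
      (trials n l (slotfun p (cs ! v)) (\<lambda>j. x j \<noteq> snd (cs ! v) j)))"
  then obtain a where a: "a \<in> set_pmf (trials n l (slotfun p (cs ! v)) (\<lambda>j. x j \<noteq> snd (cs ! v) j))"
      and e': "e' = (fst e \<and> (fst a \<or> snd a), (snd e)(v := snd a))" by auto
  have h: "snd (cs ! v) (i v) = \<xi> (i v)" "\<And>d. slotfun p (cs ! v) d = d (i v)"
    using hid[OF v] by (auto simp: hidden_def)
  have "(fst a \<or> snd a) \<and> snd a = (x (i v) \<noteq> \<xi> (i v))"
    using trials_dictator[OF h(2) a l] unfolding h(1) .
  then show "fst e' \<and> (\<forall>u<Suc v. snd e' u \<longleftrightarrow> u \<in> sat x)"
    using e v by (auto simp: e' sat_def less_Suc_eq)
qed simp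

definition goodC :: "nat set list \<Rightarrow> bool" where
  "goodC ts \<longleftrightarrow> distinct ts \<and> (\<forall>t\<in>set ts. t \<in> slots_of ` T \<and> val t)"

lemma slots_of_card: "t \<in> T \<Longrightarrow> card (slots_of t) \<le> r"
proof -
  assume t: "t \<in> T"
  then have "finite t" using small finite_subset[of t "{..<n}"] by blast
  then have "card (slots_of t) \<le> card t"
    by (intro card_inj_on_le[of i]) (use i_inj in \<open>auto simp: slots_of_def inj_on_def\<close>)
  then show ?thesis using small[OF t] by simp
qed

lemma goodC_length: "goodC ts \<Longrightarrow> length ts \<le> s"
proof -
  assume g: "goodC ts"
  have "length ts = card (set ts)" using g distinct_card[of ts] by (simp add: goodC_def)
  also have "\<dots> \<le> card (slots_of ` T)" by (rule card_mono) (use g T in \<open>auto simp: goodC_def\<close>)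
  also have "\<dots> \<le> s" using card_image_le[OF T(1), of slots_of] T(2) by simp
  finally show ?thesis .
qed

text \<open>Learnt sets are true for the monotone \<open>val\<close>, which excludes a true
  hypothesis at a false point. At a missed point the new set lies inside \<open>sat x\<close> while
  no earlier one does; it is therefore new, and the bound on the length leaves room for it.\<close>

lemma stepC_good:
  assumes g: "goodC ts" and out: "out \<in> set_pmf (stepC s r l p cs ts)"
  shows "out = Pass \<or> (\<exists>ts'. out = Change ts' \<and> goodC ts')"
proof -
  obtain y e where e: "e \<in> set_pmf (evals l p cs ((!) y))" and
    o: "out = (if \<not> fst e then Rej
       else if F ((!) y) = holds ts (snd e) then Pass
       else if holds ts (snd e) then Rej
       else if card (snd (learn p cs ((!) y) (length cs))) \<le> r \<and> length ts < s
         then Change (ts @ [snd (learn p cs ((!) y) (length cs))]) else Rej)"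
    using out unfolding stepC_def Let_def set_bind_pmf set_map_pmf by blast
  define x where "x = (!) y"
  define t where "t = snd (learn p cs x (length cs))"
  have ev: "fst e" "\<And>v. v < length cs \<Longrightarrow> snd e v \<longleftrightarrow> v \<in> sat x"
    using evals_exact[OF e] by (auto simp: x_def)
  have h: "holds ts (snd e) \<longleftrightarrow> (\<exists>t\<in>set ts. t \<subseteq> sat x)"
  proof -
    have "(\<forall>v\<in>t. snd e v) \<longleftrightarrow> t \<subseteq> sat x" if "t \<in> set ts" for t
    proof -
      have "t \<subseteq> {..<length cs}" using g that by (auto simp: goodC_def slots_of_def)
      then show ?thesis using ev(2) by blast
    qed
    then show ?thesis by (auto simp: holds_def)
  qed
  have h1: "F x" if "holds ts (snd e)"
    using that h g val_mono F_val by (auto simp: goodC_def)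
  show ?thesis
  proof (cases "F x = holds ts (snd e)")
    case True
    then show ?thesis using o ev by (simp add: x_def)
  next
    case False
    then have Fx: "F x" "\<not> holds ts (snd e)" using h1 by auto
    have t: "t \<in> slots_of ` T" "val t" "t \<subseteq> sat x" using learn_term[OF Fx(1)] by (auto simp: t_def)
    have "t \<notin> set ts" using t(3) Fx(2) h by blast
    then have g': "goodC (ts @ [t])" using g t by (auto simp: goodC_def)
    then have "length ts < s" using goodC_length[OF g'] by simp
    moreover have "card t \<le> r" using t(1) slots_of_card by auto
    ultimately have "out = Change (ts @ [t])" using o ev(1) Fx by (simp add: x_def t_def)
    then show ?thesis using g' by blast
  qed
qed

end

context oracles
begin

text \<open>Only a collision of relevant variables can do harm; under a separating partition every
  outcome of samples and coins is accepted.\<close>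

theorem algo_complete:
  assumes f: "f \<in> term_unate_dnf n s r" and l: "0 < l" "3 * (real (r * s))\<^sup>2 \<le> 2 ^ l"
  shows "2 / 3 \<le> pr (algo s r l N) (\<lambda>b. b)"
proof -
  obtain \<xi> T where T': "finite T" "card T \<le> s" "\<forall>t\<in>T. t \<subseteq> {..<n} \<and> card t \<le> r"
    "\<forall>g. ask g \<longleftrightarrow> (\<exists>t\<in>T. \<forall>i\<in>t. g i \<noteq> \<xi> i)"
    by (rule term_unate_dnfE[OF f])
  note T = T'(1,2) T'(3)[rule_format] T'(4)[rule_format]
  have acc: "pr (case A of None \<Rightarrow> return_pmf False
      | Some cs \<Rightarrow> map_pmf (\<lambda>C. C \<noteq> None) (stream (stepC s r l p cs) N (Suc s * N) [] 0)) (\<lambda>b. \<not> b) \<le> 0"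
    if p: "p \<in> set_pmf (rpart n l)" "inj_on p (\<Union>T)"
      and A: "A \<in> set_pmf (stream (stepA (r * s) l p) N (Suc (r * s) * N) [] 0)" for p A
  proof -
    interpret unate n f D s r l T \<xi> p
      by unfold_locales (fact T rpart_less[OF p(1)] p(2) l(1))+
    have "None \<notin> set_pmf (stream (stepA (r * s) l p) N (Suc (r * s) * N) [] 0)"
      by (rule stream_no_Rej[where I=goodA, OF stepA_good stepA_no_Rej]) (simp_all add: goodA_def)
    then obtain cs where cs: "A = Some cs" using A by (cases A) auto
    have "goodA cs"
      by (rule stream_invariant[where I=goodA, OF stepA_good _ A[unfolded cs]]) (simp_all add: goodA_def)
    then have "\<forall>v<length cs. \<exists>i. hidden (cs ! v) i" "distinct (map fst cs)" by (auto simp: goodA_def)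
    then obtain i where i: "\<And>v. v < length cs \<Longrightarrow> hidden (cs ! v) (i v)" by metis
    interpret unate_slots n f D s r l T \<xi> p cs i
      by unfold_locales (fact i \<open>distinct (map fst cs)\<close>)+
    have "None \<notin> set_pmf (stream (stepC s r l p cs) N (Suc s * N) [] 0)"
    proof (rule stream_no_Rej[where I=goodC])
      show "goodC b" if "goodC a" "Change b \<in> set_pmf (stepC s r l p cs a)" for a b
        using stepC_good[OF that] by simp
      show "Rej \<notin> set_pmf (stepC s r l p cs a)" if "goodC a" for a
        using stepC_good[OF that] by blast
    qed (simp add: goodC_def)
    then have "pr (stream (stepC s r l p cs) N (Suc s * N) [] 0) (\<lambda>C. \<not> C \<noteq> None) \<le> pr (stream (stepC s r l p cs) N (Suc s * N) [] 0) (\<lambda>C. False)"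
      by (intro pr_mono) auto
    then show ?thesis by (simp add: cs pr_map del: measure_map_pmf)
  qed
  have "pr (algo s r l N) (\<lambda>b. \<not> b) \<le> pr (rpart n l) (\<lambda>p. \<not> inj_on p (\<Union>T)) + 0"
    unfolding algo_def
  proof (rule pr_bind_split)
    fix p assume "p \<in> set_pmf (rpart n l)" "\<not> \<not> inj_on p (\<Union>T)"
    then show "pr (stream (stepA (r * s) l p) N (Suc (r * s) * N) [] 0 \<bind> (\<lambda>A. case A of None \<Rightarrow> return_pmf False
      | Some cs \<Rightarrow> map_pmf (\<lambda>C. C \<noteq> None) (stream (stepC s r l p cs) N (Suc s * N) [] 0))) (\<lambda>b. \<not> b) \<le> 0"
      by (intro pr_bind_le acc) auto
  qed simp
  also have "pr (rpart n l) (\<lambda>p. \<not> inj_on p (\<Union>T)) \<le> (real (r * s))\<^sup>2 / 2 ^ l"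
  proof (rule rpart_inj)
    have "card (\<Union>T) \<le> (\<Sum>t\<in>T. card t)" by (rule card_Union_le_sum_card)
    also have "\<dots> \<le> (\<Sum>t\<in>T. r)" by (rule sum_mono) (use T in blast)
    also have "\<dots> \<le> r * s" using T by simp
    finally show "card (\<Union>T) \<le> r * s" .
  qed (use T in blast)
  also have "\<dots> \<le> 1 / 3" using l by (simp add: field_simps)
  finally show ?thesis by (simp add: pr_not)
qed

end

section \<open>A refinement logic for programs\<close>

definition For :: "string \<Rightarrow> aexp \<Rightarrow> com \<Rightarrow> com" where
  "For x e c = Seq (Assign x (Const 0) (Const 0))
     (While (Less (Elem x (Const 0)) e) (Seq c (Assign x (Const 0) (Plus (Elem x (Const 0)) (Const 1)))))"

text \<open>\<open>fm\<close> appends its last step, whereas a loop unfolds its first one; this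
  bridges the two.\<close>

lemma fm_shift: "fm (Suc m) B a = bind_pmf (B 0 a) (fm m (\<lambda>i. B (Suc i)))"
proof (induction m arbitrary: a)
  case 0
  show ?case by (simp add: bind_return_pmf bind_return_pmf')
next
  case (Suc m)
  have "fm (Suc (Suc m)) B a = bind_pmf (fm (Suc m) B a) (B (Suc m))" by simp
  also have "\<dots> = bind_pmf (B 0 a) (\<lambda>b. bind_pmf (fm m (\<lambda>i. B (Suc i)) b) (B (Suc m)))"
    unfolding Suc bind_assoc_pmf ..
  finally show ?case by simp
qed

context oracles
begin

text \<open>The program is coupled with the distribution \<open>A\<close> through \<open>R\<close>. The components of the
  witness \<open>M\<close> are the final store and the time and the oracle calls actually spent, which may
  differ between outcomes; \<open>t\<close> and \<open>q\<close> are bounds for all of them.\<close>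

definition ht :: "com \<Rightarrow> store \<Rightarrow> nat \<Rightarrow> nat \<Rightarrow> 'a pmf \<Rightarrow> (store \<Rightarrow> 'a \<Rightarrow> bool) \<Rightarrow> bool" where
  "ht c \<sigma> t q A R \<longleftrightarrow> (\<exists>M :: (store \<times> nat \<times> nat) pmf.
     (\<forall>m\<in>set_pmf M. fst (snd m) \<le> t \<and> snd (snd m) \<le> q) \<and>
     (\<forall>K q0 u. t \<le> u \<longrightarrow> run n f D u (c # K, \<sigma>, q0) =
        bind_pmf M (\<lambda>m. run n f D (u - fst (snd m)) (K, fst m, q0 + snd (snd m)))) \<and>
     rel_pmf (\<lambda>m a. R (fst m) a) M A)"

abbreviation dt :: "com \<Rightarrow> store \<Rightarrow> nat \<Rightarrow> nat \<Rightarrow> (store \<Rightarrow> bool) \<Rightarrow> bool" where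
  "dt c \<sigma> t q Q \<equiv> ht c \<sigma> t q (return_pmf ()) (\<lambda>\<sigma>' _. Q \<sigma>')"

lemma ht_mono:
  assumes "ht c \<sigma> t q A R" "t \<le> t'" "q \<le> q'" "\<And>\<sigma>' a. a \<in> set_pmf A \<Longrightarrow> R \<sigma>' a \<Longrightarrow> S \<sigma>' a"
  shows "ht c \<sigma> t' q' A S"
proof -
  obtain M where M: "\<forall>m\<in>set_pmf M. fst (snd m) \<le> t \<and> snd (snd m) \<le> q"
     "\<forall>K q0 u. t \<le> u \<longrightarrow> run n f D u (c # K, \<sigma>, q0) =
        bind_pmf M (\<lambda>m. run n f D (u - fst (snd m)) (K, fst m, q0 + snd (snd m)))"
     "rel_pmf (\<lambda>m a. R (fst m) a) M A" using assms(1) unfolding ht_def by blast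
  have "rel_pmf (\<lambda>m a. S (fst m) a) M A"
    by (rule pmf.rel_mono_strong[OF M(3)]) (use assms(4) in blast)
  with M(1,2) show ?thesis using assms(2,3) unfolding ht_def by (intro exI[of _ M]) force
qed

lemma ht_dt:
  assumes "dt c \<sigma> t q Q" "\<And>\<sigma>'. Q \<sigma>' \<Longrightarrow> R \<sigma>' a"
  shows "ht c \<sigma> t q (return_pmf a) R"
  using assms unfolding ht_def rel_pmf_return_pmf2 by blast

lemma ht_step1:
  assumes "\<And>K q0. step n f D (c # K, \<sigma>, q0) = map_pmf (\<lambda>x. (K, g x, q0 + q)) A"
    and "\<And>x. x \<in> set_pmf A \<Longrightarrow> R (g x) x"
  shows "ht c \<sigma> 1 q A R"
proof -
  define M where "M = map_pmf (\<lambda>x. (g x, 1 :: nat, q)) A"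
  have "run n f D u (c # K, \<sigma>, q0) =
      bind_pmf M (\<lambda>m. run n f D (u - fst (snd m)) (K, fst m, q0 + snd (snd m)))" if "1 \<le> u" for K q0 u
    using that by (cases u) (auto simp: assms(1) M_def bind_map_pmf)
  moreover have "rel_pmf (\<lambda>m a. R (fst m) a) M A"
    unfolding M_def by (auto simp: pmf.rel_map intro!: rel_pmf_reflI assms(2))
  ultimately show ?thesis unfolding ht_def by (intro exI[of _ M]) (auto simp: M_def)
qed

lemma dt_step1:
  assumes "\<And>K q0. step n f D (c # K, \<sigma>, q0) = return_pmf (K, \<sigma>', q0 + q)" "Q \<sigma>'"
  shows "dt c \<sigma> 1 q Q"
  by (rule ht_step1[where g="\<lambda>_. \<sigma>'"]) (use assms in \<open>auto simp: map_return_pmf\<close>)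

lemma dt_Skip: "Q \<sigma> \<Longrightarrow> dt Skip \<sigma> 1 0 Q"
  by (rule dt_step1) auto

lemma dt_Assign: "Q (put x (aval i \<sigma>) (aval e \<sigma>) \<sigma>) \<Longrightarrow> dt (Assign x i e) \<sigma> 1 0 Q"
  by (rule dt_step1) auto

lemma dt_Query: "Q (put y 0 (of_bool (f (get_point n x \<sigma>))) \<sigma>) \<Longrightarrow> dt (Query y x) \<sigma> 1 1 Q"
  by (rule dt_step1) auto

lemma ht_Flip: "(\<And>b. R (put x 0 (of_bool b) \<sigma>) b) \<Longrightarrow> ht (Flip x) \<sigma> 1 0 coin R"
  by (rule ht_step1[where g="\<lambda>b. put x 0 (of_bool b) \<sigma>"]) auto

lemma ht_Sample: "(\<And>v. v \<in> set_pmf D \<Longrightarrow> R (put_point n x v \<sigma>) v) \<Longrightarrow> ht (Sample x) \<sigma> 1 1 D R"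
  by (rule ht_step1[where g="\<lambda>v. put_point n x v \<sigma>"]) auto

lemma ht_jump:
  assumes "\<And>K q0. step n f D (c # K, \<sigma>, q0) = return_pmf (c' # K, \<sigma>, q0)" "ht c' \<sigma> t q A R"
  shows "ht c \<sigma> (Suc t) q A R"
proof -
  obtain M where M: "\<forall>m\<in>set_pmf M. fst (snd m) \<le> t \<and> snd (snd m) \<le> q"
     "\<forall>K q0 u. t \<le> u \<longrightarrow> run n f D u (c' # K, \<sigma>, q0) =
        bind_pmf M (\<lambda>m. run n f D (u - fst (snd m)) (K, fst m, q0 + snd (snd m)))"
     "rel_pmf (\<lambda>m a. R (fst m) a) M A" using assms(2) unfolding ht_def by blast
  define M' where "M' = map_pmf (\<lambda>m. (fst m, Suc (fst (snd m)), snd (snd m))) M"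
  have "run n f D u (c # K, \<sigma>, q0) =
      bind_pmf M' (\<lambda>m. run n f D (u - fst (snd m)) (K, fst m, q0 + snd (snd m)))" if tu: "Suc t \<le> u" for K q0 u
  proof -
    obtain u' where u: "u = Suc u'" "t \<le> u'" using tu by (cases u) auto
    show ?thesis using M(2) u by (simp add: assms(1) bind_return_pmf M'_def bind_map_pmf)
  qed
  moreover have "rel_pmf (\<lambda>m a. R (fst m) a) M' A" using M(3) unfolding M'_def pmf.rel_map by simp
  ultimately show ?thesis unfolding ht_def by (intro exI[of _ M']) (use M(1) in \<open>auto simp: M'_def\<close>)
qed

lemma ht_Cond: "ht (if bval b \<sigma> then c1 else c2) \<sigma> t q A R \<Longrightarrow> ht (Cond b c1 c2) \<sigma> (Suc t) q A R"
  by (rule ht_jump) auto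

text \<open>The common core of sequencing and loop unfolding. The second command starts from the
  concrete store but is compared with a distribution that depends on the abstract value, so its
  witness is chosen for every pair in a coupling of the first stage and then averaged over that
  coupling.\<close>

lemma ht_chain:
  assumes run: "\<And>K q0. step n f D (c # K, \<sigma>, q0) = return_pmf (c1 # c2 # K, \<sigma>, q0)"
    and c1: "ht c1 \<sigma> t1 q1 A R"
    and c2: "\<And>\<sigma>' a. a \<in> set_pmf A \<Longrightarrow> R \<sigma>' a \<Longrightarrow> ht c2 \<sigma>' t2 q2 (B a) S"
  shows "ht c \<sigma> (Suc (t1 + t2)) (q1 + q2) (bind_pmf A B) S"
proof -
  obtain M1 where M1: "\<forall>m\<in>set_pmf M1. fst (snd m) \<le> t1 \<and> snd (snd m) \<le> q1"
     "\<forall>K q0 u. t1 \<le> u \<longrightarrow> run n f D u (c1 # K, \<sigma>, q0) =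
        bind_pmf M1 (\<lambda>m. run n f D (u - fst (snd m)) (K, fst m, q0 + snd (snd m)))"
     "rel_pmf (\<lambda>m a. R (fst m) a) M1 A" using c1 unfolding ht_def by blast
  obtain J where J: "\<And>m a. (m, a) \<in> set_pmf J \<Longrightarrow> R (fst m) a" "map_pmf fst J = M1" "map_pmf snd J = A"
    using M1(3) unfolding rel_pmf.simps by blast
  have "\<forall>x\<in>set_pmf J. \<exists>M. (\<forall>m\<in>set_pmf M. fst (snd m) \<le> t2 \<and> snd (snd m) \<le> q2) \<and>
     (\<forall>K q0 u. t2 \<le> u \<longrightarrow> run n f D u (c2 # K, fst (fst x), q0) =
        bind_pmf M (\<lambda>m. run n f D (u - fst (snd m)) (K, fst m, q0 + snd (snd m)))) \<and>
     rel_pmf (\<lambda>m a. S (fst m) a) M (B (snd x))"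
  proof
    fix x assume x: "x \<in> set_pmf J"
    then have "snd x \<in> set_pmf A" "R (fst (fst x)) (snd x)" using J by auto
    from c2[OF this] show "\<exists>M. (\<forall>m\<in>set_pmf M. fst (snd m) \<le> t2 \<and> snd (snd m) \<le> q2) \<and>
     (\<forall>K q0 u. t2 \<le> u \<longrightarrow> run n f D u (c2 # K, fst (fst x), q0) =
        bind_pmf M (\<lambda>m. run n f D (u - fst (snd m)) (K, fst m, q0 + snd (snd m)))) \<and>
     rel_pmf (\<lambda>m a. S (fst m) a) M (B (snd x))" unfolding ht_def .
  qed
  then obtain M2 where M2: "\<And>x m. x \<in> set_pmf J \<Longrightarrow> m \<in> set_pmf (M2 x) \<Longrightarrow> fst (snd m) \<le> t2 \<and> snd (snd m) \<le> q2"
     "\<And>x K q0 u. x \<in> set_pmf J \<Longrightarrow> t2 \<le> u \<Longrightarrow> run n f D u (c2 # K, fst (fst x), q0) =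
        bind_pmf (M2 x) (\<lambda>m. run n f D (u - fst (snd m)) (K, fst m, q0 + snd (snd m)))"
     "\<And>x. x \<in> set_pmf J \<Longrightarrow> rel_pmf (\<lambda>m a. S (fst m) a) (M2 x) (B (snd x))"
    unfolding bchoice_iff by blast
  \<comment> \<open>The successor accounts for the transition that puts \<open>c1\<close> and
    \<open>c2\<close> on the stack.\<close>
  define M where "M = bind_pmf J (\<lambda>x. map_pmf (\<lambda>m. (fst m, Suc (fst (snd (fst x)) + fst (snd m)),
      snd (snd (fst x)) + snd (snd m))) (M2 x))"
  have J1: "fst (snd (fst x)) \<le> t1 \<and> snd (snd (fst x)) \<le> q1" if "x \<in> set_pmf J" for x
    using M1(1) J(2) that by (metis image_eqI set_map_pmf)
  have "run n f D u (c # K, \<sigma>, q0) =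
      bind_pmf M (\<lambda>m. run n f D (u - fst (snd m)) (K, fst m, q0 + snd (snd m)))" if tu: "Suc (t1 + t2) \<le> u" for K q0 u
  proof -
    obtain u' where u: "u = Suc u'" "t1 + t2 \<le> u'" using tu by (cases u) auto
    have "run n f D u (c # K, \<sigma>, q0) = run n f D u' (c1 # c2 # K, \<sigma>, q0)"
      by (simp add: u run bind_return_pmf)
    also have "\<dots> = bind_pmf J (\<lambda>x. run n f D (u' - fst (snd (fst x))) (c2 # K, fst (fst x), q0 + snd (snd (fst x))))"
      using M1(2) u by (simp add: J(2)[symmetric] bind_map_pmf)
    also have "\<dots> = bind_pmf J (\<lambda>x. bind_pmf (M2 x) (\<lambda>m. run n f D (u' - fst (snd (fst x)) - fst (snd m))
         (K, fst m, q0 + snd (snd (fst x)) + snd (snd m))))"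
    proof (rule bind_pmf_cong[OF refl])
      fix x assume x: "x \<in> set_pmf J"
      have "t2 \<le> u' - fst (snd (fst x))" using J1[OF x] u by linarith
      then show "run n f D (u' - fst (snd (fst x))) (c2 # K, fst (fst x), q0 + snd (snd (fst x))) =
         bind_pmf (M2 x) (\<lambda>m. run n f D (u' - fst (snd (fst x)) - fst (snd m))
           (K, fst m, q0 + snd (snd (fst x)) + snd (snd m)))"
        by (rule M2(2)[OF x])
    qed
    also have "\<dots> = bind_pmf M (\<lambda>m. run n f D (u - fst (snd m)) (K, fst m, q0 + snd (snd m)))"
      by (simp add: M_def bind_assoc_pmf bind_map_pmf u add.assoc)
    finally show ?thesis .
  qed
  moreover have "rel_pmf (\<lambda>m a. S (fst m) a) M (bind_pmf A B)"
    unfolding M_def J(3)[symmetric] bind_map_pmf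
  \<comment> \<open>The diagonal relation restricted to the support makes the pairwise couplings
    available.\<close>
  proof (rule rel_pmf_bindI[where R="\<lambda>x y. x = y \<and> x \<in> set_pmf J"])
    show "rel_pmf (\<lambda>x y. x = y \<and> x \<in> set_pmf J) J J" by (rule rel_pmf_reflI) simp
  qed (use M2(3) in \<open>auto simp: pmf.rel_map\<close>)
  moreover have "\<forall>m\<in>set_pmf M. fst (snd m) \<le> Suc (t1 + t2) \<and> snd (snd m) \<le> q1 + q2"
    using M2(1) J1 by (fastforce simp: M_def intro: add_mono)
  ultimately show ?thesis unfolding ht_def by (intro exI[of _ M]) simp
qed

lemma ht_Seq:
  assumes "ht c1 \<sigma> t1 q1 A R" "\<And>\<sigma>' a. a \<in> set_pmf A \<Longrightarrow> R \<sigma>' a \<Longrightarrow> ht c2 \<sigma>' t2 q2 (B a) S"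
  shows "ht (Seq c1 c2) \<sigma> (Suc (t1 + t2)) (q1 + q2) (bind_pmf A B) S"
  by (rule ht_chain[OF _ assms]) simp_all

lemma dt_ht_Seq:
  assumes "dt c1 \<sigma> t1 q1 Q" "\<And>\<sigma>'. Q \<sigma>' \<Longrightarrow> ht c2 \<sigma>' t2 q2 A R"
  shows "ht (Seq c1 c2) \<sigma> (Suc (t1 + t2)) (q1 + q2) A R"
  using ht_Seq[OF assms(1), where B="\<lambda>_. A"] assms(2) by (simp add: bind_return_pmf)

lemma ht_dt_Seq:
  assumes "ht c1 \<sigma> t1 q1 A R" "\<And>\<sigma>' a. a \<in> set_pmf A \<Longrightarrow> R \<sigma>' a \<Longrightarrow> dt c2 \<sigma>' t2 q2 (\<lambda>\<sigma>''. S \<sigma>'' a)"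
  shows "ht (Seq c1 c2) \<sigma> (Suc (t1 + t2)) (q1 + q2) A S"
proof -
  have "ht (Seq c1 c2) \<sigma> (Suc (t1 + t2)) (q1 + q2) (bind_pmf A return_pmf) S"
    by (rule ht_Seq[OF assms(1)]) (rule ht_dt[OF assms(2)])
  then show ?thesis by (simp add: bind_return_pmf')
qed

lemma ht_map_Seq:
  assumes "ht c1 \<sigma> t1 q1 A R" "\<And>\<sigma>' a. a \<in> set_pmf A \<Longrightarrow> R \<sigma>' a \<Longrightarrow> dt c2 \<sigma>' t2 q2 (\<lambda>\<sigma>''. S \<sigma>'' (h a))"
  shows "ht (Seq c1 c2) \<sigma> (Suc (t1 + t2)) (q1 + q2) (map_pmf h A) S"
  unfolding map_pmf_def by (rule ht_Seq[OF assms(1)]) (rule ht_dt[OF assms(2)])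

lemma ht_While_False: "\<not> bval b \<sigma> \<Longrightarrow> R \<sigma> a \<Longrightarrow> ht (While b c) \<sigma> (Suc 0) 0 (return_pmf a) R"
proof -
  assume a: "\<not> bval b \<sigma>" "R \<sigma> a"
  have "dt (While b c) \<sigma> 1 0 (\<lambda>\<sigma>'. \<sigma>' = \<sigma>)" by (rule dt_step1) (use a in simp_all)
  from ht_dt[OF this, of R a] show ?thesis using a by simp
qed

lemma ht_While_True:
  assumes "bval b \<sigma>" "ht c \<sigma> t1 q1 A R"
    "\<And>\<sigma>' a. a \<in> set_pmf A \<Longrightarrow> R \<sigma>' a \<Longrightarrow> ht (While b c) \<sigma>' t2 q2 (B a) S"
  shows "ht (While b c) \<sigma> (Suc (t1 + t2)) (q1 + q2) (bind_pmf A B) S"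
  by (rule ht_chain[OF _ assms(2,3)]) (use assms(1) in simp_all)

text \<open>In each round the loop test, the unfolding of the sequence and the increment add 3 to
  the body; the constant 3 is made up of the outer sequence, the initialisation and the final test.
  The body establishes the invariant for the store after the increment, since the counter is part of
  the store.\<close>

lemma ht_For:
  assumes init: "I 0 (put x 0 0 \<sigma>) a"
    and bound: "\<And>i \<sigma> a. I i \<sigma> a \<Longrightarrow> aval e \<sigma> = m"
    and idx: "\<And>i \<sigma> a. I i \<sigma> a \<Longrightarrow> \<sigma> x 0 = i"
    and body: "\<And>i \<sigma> a. i < m \<Longrightarrow> I i \<sigma> a \<Longrightarrow>
       ht c \<sigma> t q (B i a) (\<lambda>\<sigma>' a'. \<sigma>' x 0 = i \<and> I (Suc i) (put x 0 (Suc i) \<sigma>') a')"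
  shows "ht (For x e c) \<sigma> (3 + m * (t + 3)) (m * q) (fm m B a) (I m)"
proof -
  let ?w = "While (Less (Elem x (Const 0)) e) (Seq c (Assign x (Const 0) (Plus (Elem x (Const 0)) (Const 1))))"
  \<comment> \<open>Generalised to a start at \<open>i0\<close>, since unfolding leaves a loop over
    the later indices.\<close>
  have loop: "ht ?w \<sigma> (1 + k * (t + 3)) (k * q) (fm k (\<lambda>i. B (i0 + i)) a) (I m)"
    if "I i0 \<sigma> a" "i0 + k = m" for k i0 \<sigma> a
    using that
  proof (induction k arbitrary: i0 \<sigma> a)
    case 0
    then show ?case using bound[OF 0(1)] idx[OF 0(1)] by (auto intro!: ht_While_False)
  next
    case (Suc k)
    have i0: "i0 < m" using Suc.prems by simp
    have "ht (Seq c (Assign x (Const 0) (Plus (Elem x (Const 0)) (Const 1)))) \<sigma> (Suc (t + 1)) (q + 0) (B i0 a) (I (Suc i0))"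
      by (rule ht_dt_Seq[OF body[OF i0 Suc.prems(1)]], rule dt_Assign) simp
    then have "ht ?w \<sigma> (Suc (Suc (t + 1) + (1 + k * (t + 3)))) (q + 0 + k * q)
        (bind_pmf (B i0 a) (fm k (\<lambda>i. B (Suc i0 + i)))) (I m)"
    proof (rule ht_While_True[rotated])
      show "bval (Less (Elem x (Const 0)) e) \<sigma>" using bound[OF Suc.prems(1)] idx[OF Suc.prems(1)] i0 by simp
      show "ht ?w \<sigma>' (1 + k * (t + 3)) (k * q) (fm k (\<lambda>i. B (Suc i0 + i)) a') (I m)"
        if "I (Suc i0) \<sigma>' a'" for \<sigma>' a'
        using Suc.IH[OF that] Suc.prems(2) by simp
    qed
    moreover have "fm (Suc k) (\<lambda>i. B (i0 + i)) a = bind_pmf (B i0 a) (fm k (\<lambda>i. B (Suc i0 + i)))"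
      by (simp add: fm_shift del: fm.simps)
    moreover have "Suc (Suc (t + 1) + (1 + k * (t + 3))) = 1 + Suc k * (t + 3)" "q + 0 + k * q = Suc k * q"
      by simp_all
    ultimately show ?case by metis
  qed
  have "ht (For x e c) \<sigma> (Suc (1 + (1 + m * (t + 3)))) (0 + m * q) (fm m B a) (I m)"
    unfolding For_def
    by (rule dt_ht_Seq[where Q="\<lambda>\<sigma>'. \<sigma>' = put x 0 0 \<sigma>"], rule dt_Assign, simp)
       (use loop[of 0 _ a m] init in simp)
  then show ?thesis by (rule ht_mono) simp_all
qed

lemma ht_For_dt:
  assumes init: "I 0 (put x 0 0 \<sigma>)"
    and bound: "\<And>i \<sigma>. I i \<sigma> \<Longrightarrow> aval e \<sigma> = m"
    and idx: "\<And>i \<sigma>. I i \<sigma> \<Longrightarrow> \<sigma> x 0 = i"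
    and body: "\<And>i \<sigma>. i < m \<Longrightarrow> I i \<sigma> \<Longrightarrow>
       dt c \<sigma> t q (\<lambda>\<sigma>'. \<sigma>' x 0 = i \<and> I (Suc i) (put x 0 (Suc i) \<sigma>'))"
  shows "dt (For x e c) \<sigma> (3 + m * (t + 3)) (m * q) (I m)"
proof -
  have "fm m (\<lambda>_. return_pmf) () = return_pmf ()" by (induction m) (auto simp: bind_return_pmf)
  then show ?thesis
    using ht_For[of "\<lambda>i \<sigma> _. I i \<sigma>" x \<sigma> "()" e m c t q "\<lambda>_. return_pmf"] assms by simp
qed

text \<open>The program carries no fuel. The premise on \<open>m\<close> bounds the remaining
  rounds, \<open>N\<close> for each further state and \<open>N - j\<close> for the present one, so
  the loop ends on its own and the fuel turns into the time bound.\<close>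

lemma ht_stream:
  assumes idx: "\<And>\<sigma> a. Inv \<sigma> a \<Longrightarrow> \<sigma> ''N'' 0 = N"
    and body: "\<And>j \<sigma> a. Inv \<sigma> a \<Longrightarrow> \<sigma> ''cnt'' 0 = j \<Longrightarrow> \<sigma> ''ok'' 0 = 1 \<Longrightarrow> j < N \<Longrightarrow>
      ht c \<sigma> t q (S a) (\<lambda>\<sigma>' out. case out of
         Pass \<Rightarrow> Inv \<sigma>' a \<and> \<sigma>' ''cnt'' 0 = Suc j \<and> \<sigma>' ''ok'' 0 = 1
       | Change a' \<Rightarrow> Inv \<sigma>' a' \<and> \<sigma>' ''cnt'' 0 = 0 \<and> \<sigma>' ''ok'' 0 = 1 \<and> sz a' = Suc (sz a) \<and> sz a' \<le> k
       | Rej \<Rightarrow> \<sigma>' ''ok'' 0 = 0)"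
  shows "Inv \<sigma> a \<Longrightarrow> \<sigma> ''cnt'' 0 = j \<Longrightarrow> \<sigma> ''ok'' 0 = 1 \<Longrightarrow> j \<le> N \<Longrightarrow> sz a \<le> k \<Longrightarrow> (k - sz a) * N + (N - j) \<le> m \<Longrightarrow>
    ht (While (Conj (Less (Elem ''cnt'' (Const 0)) (Elem ''N'' (Const 0))) (Less (Const 0) (Elem ''ok'' (Const 0)))) c)
      \<sigma> (1 + m * (t + 1)) (m * q) (stream S N m a j)
      (\<lambda>\<sigma>' res. case res of None \<Rightarrow> \<sigma>' ''ok'' 0 = 0 | Some a' \<Rightarrow> Inv \<sigma>' a' \<and> \<sigma>' ''ok'' 0 = 1)"
    (is "_ \<Longrightarrow> _ \<Longrightarrow> _ \<Longrightarrow> _ \<Longrightarrow> _ \<Longrightarrow> _ \<Longrightarrow> ht ?w _ _ _ _ ?R")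
proof (induction m arbitrary: \<sigma> a j)
  case 0
  then show ?case using idx by (auto intro!: ht_While_False)
next
  case (Suc m)
  show ?case
  proof (cases "j < N")
    case False
    then have "ht ?w \<sigma> 1 0 (return_pmf (Some a)) ?R"
      using Suc.prems idx by (auto intro!: ht_While_False)
    then show ?thesis using False by (auto elim: ht_mono)
  next
    case True
    have "ht ?w \<sigma> (Suc (t + (1 + m * (t + 1)))) (q + m * q) (stream S N (Suc m) a j) ?R"
      unfolding stream.simps if_P[OF True]
    proof (rule ht_While_True[OF _ body[OF Suc.prems(1-3) True]])
      show "bval (Conj (Less (Elem ''cnt'' (Const 0)) (Elem ''N'' (Const 0))) (Less (Const 0) (Elem ''ok'' (Const 0)))) \<sigma>"
        using Suc.prems True idx by simp
      fix \<sigma>' out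
      assume R: "case out of
         Pass \<Rightarrow> Inv \<sigma>' a \<and> \<sigma>' ''cnt'' 0 = Suc j \<and> \<sigma>' ''ok'' 0 = 1
       | Change a' \<Rightarrow> Inv \<sigma>' a' \<and> \<sigma>' ''cnt'' 0 = 0 \<and> \<sigma>' ''ok'' 0 = 1 \<and> sz a' = Suc (sz a) \<and> sz a' \<le> k
       | Rej \<Rightarrow> \<sigma>' ''ok'' 0 = 0"
      show "ht ?w \<sigma>' (1 + m * (t + 1)) (m * q) (case out of Pass \<Rightarrow> stream S N m a (Suc j)
          | Change a' \<Rightarrow> stream S N m a' 0 | Rej \<Rightarrow> return_pmf None) ?R"
      proof (cases out)
        case Pass
        then show ?thesis using Suc.IH[of \<sigma>' a "Suc j"] R Suc.prems True by simp
      next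
        case (Change a')
        have a': "sz a' = Suc (sz a)" "sz a' \<le> k" using R Change by simp_all
        then have e: "k - sz a = Suc (k - sz a')" by simp
        have "(k - sz a') * N + (N - 0) \<le> m" using Suc.prems True by (simp add: e)
        then show ?thesis unfolding Change outcome.case
          by (intro Suc.IH) (use R Change a' in simp_all)
      next
        case Rej
        then have "ht ?w \<sigma>' 1 0 (return_pmf None) ?R"
          using R by (auto intro!: ht_While_False)
        then show ?thesis using Rej by (auto elim: ht_mono)
      qed
    qed
    then show ?thesis by (simp add: algebra_simps)
  qed
qed

lemma run_halted: "run n f D t ([], \<sigma>, q) = return_pmf ([], \<sigma>, q)"
  by (induction t) (auto simp: bind_return_pmf)

text \<open>The relation determines the abstract bit from the final store, so the coupling becomes
  an equality of distributions and probabilities transfer exactly.\<close>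

lemma ht_run:
  assumes "ht P \<sigma> t q A (\<lambda>\<sigma>' b. (\<sigma>' ''accept'' 0 = 1) = b)"
  shows "\<forall>cfg\<in>set_pmf (run n f D t ([P], \<sigma>, 0)). halted cfg \<and> oracle_calls cfg \<le> q"
    and "pr (run n f D t ([P], \<sigma>, 0)) accepting = pr A (\<lambda>b. b)"
    and "pr (run n f D t ([P], \<sigma>, 0)) rejecting = pr A (\<lambda>b. \<not> b)"
proof -
  obtain M where M: "\<forall>m\<in>set_pmf M. fst (snd m) \<le> t \<and> snd (snd m) \<le> q"
     "\<forall>K q0 u. t \<le> u \<longrightarrow> run n f D u (P # K, \<sigma>, q0) =
        bind_pmf M (\<lambda>m. run n f D (u - fst (snd m)) (K, fst m, q0 + snd (snd m)))"
     "rel_pmf (\<lambda>m b. (fst m ''accept'' 0 = 1) = b) M A" using assms unfolding ht_def by blast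
  have run: "run n f D t ([P], \<sigma>, 0) = map_pmf (\<lambda>m. ([], fst m, snd (snd m))) M"
    using M(2) by (simp add: run_halted map_pmf_def)
  have A: "A = map_pmf (\<lambda>m. fst m ''accept'' 0 = 1) M"
  proof -
    have "rel_pmf (=) (map_pmf (\<lambda>m. fst m ''accept'' 0 = 1) M) A"
      using M(3) by (simp add: pmf.rel_map)
    then show ?thesis by (simp add: pmf.rel_eq)
  qed
  show "\<forall>cfg\<in>set_pmf (run n f D t ([P], \<sigma>, 0)). halted cfg \<and> oracle_calls cfg \<le> q"
    using M(1) by (auto simp: run)
  show "pr (run n f D t ([P], \<sigma>, 0)) accepting = pr A (\<lambda>b. b)"
    "pr (run n f D t ([P], \<sigma>, 0)) rejecting = pr A (\<lambda>b. \<not> b)"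
    unfolding run A pr_map by simp_all
qed

end

section \<open>The program\<close>

abbreviation V :: "string \<Rightarrow> aexp" where "V x \<equiv> Elem x (Const 0)"

abbreviation Set :: "string \<Rightarrow> aexp \<Rightarrow> com" where "Set x e \<equiv> Assign x (Const 0) e"

definition same :: "string set \<Rightarrow> store \<Rightarrow> store \<Rightarrow> bool" where
  "same W \<sigma> \<sigma>' \<longleftrightarrow> (\<forall>x. x \<notin> W \<longrightarrow> \<sigma>' x = \<sigma> x)"

lemma same_refl: "same W \<sigma> \<sigma>"
  by (simp add: same_def)

lemma same_trans: "same W \<sigma> \<sigma>' \<Longrightarrow> same W' \<sigma>' \<sigma>'' \<Longrightarrow> W \<union> W' \<subseteq> W'' \<Longrightarrow> same W'' \<sigma> \<sigma>''"
  unfolding same_def by (metis UnI1 UnI2 subsetD)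

lemma same_put: "same W \<sigma> \<sigma>' \<Longrightarrow> x \<in> W \<Longrightarrow> same W \<sigma> (put x i v \<sigma>')"
  by (auto simp: same_def put_def)

lemma same_put_point: "same W \<sigma> \<sigma>' \<Longrightarrow> x \<in> W \<Longrightarrow> same W \<sigma> (put_point n x v \<sigma>')"
  by (auto simp: same_def put_point_def)

lemma same_mono: "same W \<sigma> \<sigma>' \<Longrightarrow> W \<subseteq> W' \<Longrightarrow> same W' \<sigma> \<sigma>'"
  by (auto simp: same_def)

lemma sameD: "same W \<sigma> \<sigma>' \<Longrightarrow> x \<notin> W \<Longrightarrow> \<sigma>' x = \<sigma> x"
  by (auto simp: same_def)

text \<open>Truth values are stored as 0 and 1. With truncated subtraction, \<open>notE\<close>, \<open>andE\<close>, \<open>xorE\<close>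
  and \<open>eqE\<close> compute with them.\<close>

definition "notE a = Minus (Const 1) a"
definition "andE a b = Minus a (notE b)"
definition "xorE a b = Plus (Minus a b) (Minus b a)"
definition "eqE a b = notE (xorE a b)"
text \<open>The truncated difference is nonzero exactly if the block number is below
  \<open>t\<close>. Its sum with the flag of a known block serves as the disjunction, since
  \<open>andE\<close> needs its second operand only up to being nonzero.\<close>

definition "hybE e t = andE e (Plus (Elem ''kn'' (Elem ''pi'' (V ''j''))) (Minus t (Elem ''pi'' (V ''j''))))"
definition "inE = eqE (Elem ''pi'' (V ''j'')) (Elem ''bl'' (V ''v''))"
text \<open>The witnesses form one flat array with rows of length \<open>n\<close>; the offset
  \<open>wq\<close> is advanced by addition, as the machine cannot multiply.\<close>

definition "witE = Elem ''w'' (Plus (V ''wq'') (V ''j''))"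
definition "togE d = xorE witE (andE d inE)"

lemma aval_notE: "aval a \<sigma> = of_bool A \<Longrightarrow> aval (notE a) \<sigma> = of_bool (\<not> A)"
  by (simp add: notE_def)

lemma aval_andE: "aval a \<sigma> = of_bool A \<Longrightarrow> (aval b \<sigma> \<noteq> 0) = B \<Longrightarrow> aval (andE a b) \<sigma> = of_bool (A \<and> B)"
  by (auto simp: andE_def notE_def)

lemma aval_xorE: "aval a \<sigma> = of_bool A \<Longrightarrow> aval b \<sigma> = of_bool B \<Longrightarrow> aval (xorE a b) \<sigma> = of_bool (A \<noteq> B)"
  by (auto simp: xorE_def)

lemma aval_eqE: "aval (eqE a b) \<sigma> = of_bool (aval a \<sigma> = aval b \<sigma>)"
  by (auto simp: eqE_def notE_def xorE_def)

lemma aval_hybE: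
  assumes "aval e \<sigma> = of_bool A" "\<sigma> ''pi'' (\<sigma> ''j'' 0) = b" "\<sigma> ''kn'' b = of_bool (b \<in> Bs)"
  shows "aval (hybE e t) \<sigma> = of_bool (A \<and> (b \<in> Bs \<or> b < aval t \<sigma>))"
  unfolding hybE_def by (rule aval_andE[OF assms(1)]) (use assms in auto)

definition Fill :: "string \<Rightarrow> aexp \<Rightarrow> aexp \<Rightarrow> com" where
  "Fill dst off e = For ''j'' (V ''n'') (Assign dst (Plus off (V ''j'')) e)"

definition QF :: "string \<Rightarrow> aexp \<Rightarrow> com" where
  "QF y e = Seq (Fill ''q'' (Const 0) e) (Query y ''q'')"

definition RV :: "string \<Rightarrow> com" where
  "RV dst = For ''j'' (V ''n'') (Seq (Flip ''c'') (Assign dst (V ''j'') (V ''c'')))"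

fun Queries :: "(string \<times> aexp) list \<Rightarrow> com" where
  "Queries [] = Skip"
| "Queries ((y, e) # qs) = Seq (QF y e) (Queries qs)"

context oracles
begin

text \<open>The expression may read the entry about to be overwritten, which still has its old
  value; this permits updating an array in place.\<close>

lemma dt_Fill:
  assumes n: "\<sigma> ''n'' 0 = n" "dst \<notin> {''n'', ''j''}"
    and off: "\<And>\<sigma>'. same {dst, ''j''} \<sigma> \<sigma>' \<Longrightarrow> aval off \<sigma>' = o'"
    and e: "\<And>\<sigma>' i. same {dst, ''j''} \<sigma> \<sigma>' \<Longrightarrow> \<sigma>' ''j'' 0 = i \<Longrightarrow> i < n \<Longrightarrow>
      \<sigma>' dst (o' + i) = \<sigma> dst (o' + i) \<Longrightarrow> aval e \<sigma>' = g i"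
  shows "dt (Fill dst off e) \<sigma> (4 * n + 3) 0 (\<lambda>\<sigma>'. same {dst, ''j''} \<sigma> \<sigma>' \<and>
     (\<forall>m. \<sigma>' dst m = (if o' \<le> m \<and> m < o' + n then g (m - o') else \<sigma> dst m)))"
proof -
  let ?I = "\<lambda>i \<sigma>'. same {dst, ''j''} \<sigma> \<sigma>' \<and> \<sigma>' ''j'' 0 = i \<and>
     (\<forall>m. \<sigma>' dst m = (if o' \<le> m \<and> m < o' + i then g (m - o') else \<sigma> dst m))"
  have "dt (Fill dst off e) \<sigma> (3 + n * (1 + 3)) (n * 0) (?I n)"
    unfolding Fill_def
  proof (rule ht_For_dt)
    show "?I 0 (put ''j'' 0 0 \<sigma>)" using n(2) by (auto simp: put_def same_def)
    show "aval (V ''n'') \<sigma>' = n" if "?I i \<sigma>'" for i \<sigma>'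
      using sameD[of "{dst, ''j''}" \<sigma> \<sigma>' "''n''"] that n by auto
    show "\<sigma>' ''j'' 0 = i" if "?I i \<sigma>'" for i \<sigma>' using that by simp
    fix i \<sigma>' assume i: "i < n" and I: "?I i \<sigma>'"
    have "aval e \<sigma>' = g i" by (rule e) (use I i in auto)
    moreover have "aval off \<sigma>' = o'" by (rule off) (use I in auto)
    ultimately show "dt (Assign dst (Plus off (V ''j'')) e) \<sigma>' 1 0
        (\<lambda>\<sigma>''. \<sigma>'' ''j'' 0 = i \<and> ?I (Suc i) (put ''j'' 0 (Suc i) \<sigma>''))"
      using I n(2) by (intro dt_Assign) (auto simp: put_def same_def less_Suc_eq)
  qed
  then show ?thesis by (rule ht_mono) auto
qed

lemma dt_QF:
  assumes n: "\<sigma> ''n'' 0 = n"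
    and e: "\<And>\<sigma>' i. same {''q'', ''j''} \<sigma> \<sigma>' \<Longrightarrow> \<sigma>' ''j'' 0 = i \<Longrightarrow> i < n \<Longrightarrow> aval e \<sigma>' = of_bool (g i)"
  shows "dt (QF y e) \<sigma> (4 * n + 5) 1 (\<lambda>\<sigma>'. same {''q'', ''j'', y} \<sigma> \<sigma>' \<and> \<sigma>' y 0 = of_bool (ask g))"
proof -
  have "dt (QF y e) \<sigma> (Suc ((4 * n + 3) + 1)) (0 + 1)
      (\<lambda>\<sigma>'. same {''q'', ''j'', y} \<sigma> \<sigma>' \<and> \<sigma>' y 0 = of_bool (ask g))"
    unfolding QF_def
  proof (rule dt_ht_Seq[OF dt_Fill[where \<sigma>=\<sigma> and o'=0 and g="\<lambda>i. of_bool (g i)", OF n]])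
    fix \<sigma>'
    assume s: "same {''q'', ''j''} \<sigma> \<sigma>' \<and>
       (\<forall>m. \<sigma>' ''q'' m = (if 0 \<le> m \<and> m < 0 + n then of_bool (g (m - 0)) else \<sigma> ''q'' m))"
    then have "f (get_point n ''q'' \<sigma>') = ask g"
      by (auto simp: get_point_def ask_def pt_def intro!: arg_cong[where f=f])
    then show "dt (Query y ''q'') \<sigma>' 1 1
      (\<lambda>\<sigma>'. same {''q'', ''j'', y} \<sigma> \<sigma>' \<and> \<sigma>' y 0 = of_bool (ask g))"
      using s by (intro dt_Query) (auto simp: put_def same_def)
  qed (use e in auto)
  then show ?thesis by (rule ht_mono) auto
qed

text \<open>One frame \<open>Y\<close> is used for the whole list, and the distinct targets keep
  earlier answers intact.\<close>

lemma dt_Queries: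
  assumes n: "\<sigma> ''n'' 0 = n"
    and dist: "distinct (map fst qs)" "\<And>y e g. ((y, e), g) \<in> set (zip qs gs) \<Longrightarrow> y \<in> Y" "Y \<inter> {''n'', ''q'', ''j''} = {}"
    and len: "length gs = length qs"
    and e: "\<And>\<sigma>' i y e g. ((y, e), g) \<in> set (zip qs gs) \<Longrightarrow> same (Y \<union> {''q'', ''j''}) \<sigma> \<sigma>' \<Longrightarrow>
       \<sigma>' ''j'' 0 = i \<Longrightarrow> i < n \<Longrightarrow> aval e \<sigma>' = of_bool (g i)"
  shows "dt (Queries qs) \<sigma> (length qs * (4 * n + 6) + 1) (length qs)
     (\<lambda>\<sigma>'. same (Y \<union> {''q'', ''j''}) \<sigma> \<sigma>' \<and> (\<forall>y. y \<notin> fst ` set qs \<longrightarrow> y \<notin> {''q'', ''j''} \<longrightarrow> \<sigma>' y = \<sigma> y) \<and>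
        (\<forall>((y, e), g) \<in> set (zip qs gs). \<sigma>' y 0 = of_bool (ask g)))"
  using len dist e n
proof (induction qs gs arbitrary: \<sigma> rule: list_induct2')
  case 1
  show ?case unfolding Queries.simps by (rule ht_mono[OF dt_Skip[where Q="\<lambda>\<sigma>'. \<sigma>' = \<sigma>"]]) (simp_all add: same_refl)
next
  case (4 ye qs g gs)
  obtain y e where ye: "ye = (y, e)" by fastforce
  have yY: "y \<in> Y" using 4(4)[of y e g] by (simp add: ye)
  define Q where "Q = (\<lambda>\<sigma>'. same (Y \<union> {''q'', ''j''}) \<sigma> \<sigma>' \<and>
        (\<forall>z. z \<notin> fst ` set (ye # qs) \<longrightarrow> z \<notin> {''q'', ''j''} \<longrightarrow> \<sigma>' z = \<sigma> z) \<and>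
        (\<forall>((y, e), g) \<in> set (zip (ye # qs) (g # gs)). \<sigma>' y 0 = of_bool (ask g)))"
  have "dt (Seq (QF y e) (Queries qs)) \<sigma> (Suc ((4 * n + 5) + (length qs * (4 * n + 6) + 1))) (1 + length qs) Q"
  proof (rule dt_ht_Seq[OF dt_QF[where g=g]])
    show "\<sigma> ''n'' 0 = n" by fact
    show "aval e \<sigma>' = of_bool (g i)" if "same {''q'', ''j''} \<sigma> \<sigma>'" "\<sigma>' ''j'' 0 = i" "i < n" for \<sigma>' i
      by (rule 4(6)[of y e]) (use that in \<open>auto simp: ye intro: same_mono\<close>)
    fix \<sigma>1 assume s1: "same {''q'', ''j'', y} \<sigma> \<sigma>1 \<and> \<sigma>1 y 0 = of_bool (ask g)"
    have s1Y: "same (Y \<union> {''q'', ''j''}) \<sigma> \<sigma>1" by (rule same_mono[of "{''q'', ''j'', y}"]) (use s1 yY in auto)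
    have "dt (Queries qs) \<sigma>1 (length qs * (4 * n + 6) + 1) (length qs)
     (\<lambda>\<sigma>'. same (Y \<union> {''q'', ''j''}) \<sigma>1 \<sigma>' \<and> (\<forall>y. y \<notin> fst ` set qs \<longrightarrow> y \<notin> {''q'', ''j''} \<longrightarrow> \<sigma>' y = \<sigma>1 y) \<and>
        (\<forall>((y, e), g) \<in> set (zip qs gs). \<sigma>' y 0 = of_bool (ask g)))"
    proof (rule 4(1))
      show "length gs = length qs" "distinct (map fst qs)" using 4 by auto
      show "y' \<in> Y" if "((y', e'), g') \<in> set (zip qs gs)" for y' e' g' using 4(4)[of y' e' g'] that by simp
      show "Y \<inter> {''n'', ''q'', ''j''} = {}" by fact
      show "aval e' \<sigma>' = of_bool (g' i)" if "((y', e'), g') \<in> set (zip qs gs)" "same (Y \<union> {''q'', ''j''}) \<sigma>1 \<sigma>'"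
        "\<sigma>' ''j'' 0 = i" "i < n" for \<sigma>' i y' e' g'
        by (rule 4(6)[of y' e' g' \<sigma>' i]) (use that(1,3,4) same_trans[OF s1Y that(2) order.refl] in simp_all)
      show "\<sigma>1 ''n'' 0 = n" using sameD[OF s1Y, of "''n''"] 4(5,7) by auto
    qed
    then show "dt (Queries qs) \<sigma>1 (length qs * (4 * n + 6) + 1) (length qs) Q"
    proof (rule ht_mono)
      fix \<sigma>' assume s': "same (Y \<union> {''q'', ''j''}) \<sigma>1 \<sigma>' \<and> (\<forall>y. y \<notin> fst ` set qs \<longrightarrow> y \<notin> {''q'', ''j''} \<longrightarrow> \<sigma>' y = \<sigma>1 y) \<and>
        (\<forall>((y, e), g) \<in> set (zip qs gs). \<sigma>' y 0 = of_bool (ask g))"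
      have "y \<notin> fst ` set qs" "y \<notin> {''q'', ''j''}" using 4(3) 4(5) yY by (auto simp: ye)
      then have "\<sigma>' y 0 = of_bool (ask g)" using s' s1 by simp
      moreover have "same (Y \<union> {''q'', ''j''}) \<sigma> \<sigma>'" by (rule same_trans[OF s1Y conjunct1[OF s']]) simp
      moreover have "\<sigma>' z = \<sigma> z" if "z \<notin> fst ` set (ye # qs)" "z \<notin> {''q'', ''j''}" for z
        using that s' s1 by (simp add: ye same_def)
      ultimately show "Q \<sigma>'" using s' unfolding Q_def by (simp add: ye)
    qed simp_all
  qed
  then show ?case unfolding ye Queries.simps by (rule ht_mono) (simp_all add: Q_def ye)
qed auto

lemma ht_RV:
  assumes n: "\<sigma> ''n'' 0 = n" "dst \<notin> {''n'', ''j'', ''c''}"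
  shows "ht (RV dst) \<sigma> (6 * n + 3) 0 (rvec n) (\<lambda>\<sigma>' d. same {''j'', ''c'', dst} \<sigma> \<sigma>' \<and> (\<forall>j<n. \<sigma>' dst j = of_bool (d j)))"
proof -
  let ?I = "\<lambda>i \<sigma>' d. same {''j'', ''c'', dst} \<sigma> \<sigma>' \<and> \<sigma>' ''j'' 0 = i \<and> (\<forall>j<i. \<sigma>' dst j = of_bool (d j))"
  have "ht (RV dst) \<sigma> (3 + n * (Suc (1 + 1) + 3)) (n * (0 + 0)) (rvec n) (?I n)"
    unfolding RV_def rvec_def
  proof (rule ht_For)
    show "?I 0 (put ''j'' 0 0 \<sigma>) (\<lambda>_. False)" by (auto simp: put_def same_def)
    show "aval (V ''n'') \<sigma>' = n" if "?I i \<sigma>' d" for i \<sigma>' d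
      using sameD[of "{''j'', ''c'', dst}" \<sigma> \<sigma>' "''n''"] that n by auto
    show "\<sigma>' ''j'' 0 = i" if "?I i \<sigma>' d" for i \<sigma>' d using that by simp
    fix i \<sigma>' d assume i: "i < n" and I: "?I i \<sigma>' d"
    show "ht (Seq (Flip ''c'') (Assign dst (V ''j'') (V ''c''))) \<sigma>' (Suc (1 + 1)) (0 + 0)
        (map_pmf (\<lambda>b. d(i := b)) coin)
        (\<lambda>\<sigma>'' d'. \<sigma>'' ''j'' 0 = i \<and> ?I (Suc i) (put ''j'' 0 (Suc i) \<sigma>'') d')"
    proof (rule ht_map_Seq[OF ht_Flip[where R="\<lambda>\<sigma>'' b. \<sigma>'' = put ''c'' 0 (of_bool b) \<sigma>'"]])
      fix \<sigma>'' b assume "\<sigma>'' = put ''c'' 0 (of_bool b) \<sigma>'"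
      then show "dt (Assign dst (V ''j'') (V ''c'')) \<sigma>'' 1 0 
        (\<lambda>\<sigma>''. \<sigma>'' ''j'' 0 = i \<and> ?I (Suc i) (put ''j'' 0 (Suc i) \<sigma>'') (d(i := b)))"
        using I n(2) by (intro dt_Assign) (auto simp: put_def same_def less_Suc_eq)
    qed simp
  qed
  then show ?thesis by (rule ht_mono) auto
qed

end

section \<open>Implementation of the dictator trials\<close>

abbreviation "varsB \<equiv> {''n'', ''k'', ''s'', ''r'', ''l'', ''N'', ''pow'', ''pi''}"
abbreviation "varsS \<equiv> {''nb'', ''wp'', ''bl'', ''w'', ''kn''}"
abbreviation "varsT \<equiv> {''nt'', ''tm''}"

definition "oktE = andE (andE (eqE (V ''gs'') (xorE (V ''gx'') (V ''gy'')))
   (eqE (xorE (V ''gp'') (V ''gz'')) (andE (V ''gx'') (V ''gy'')))) (xorE (V ''go'') (V ''gz''))"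

text \<open>The seven points occurring in the tests and in the correction; the value at the mask
  \<open>m3\<close> is shared by the product test, the complement test and the correction.\<close>

definition trial_queries :: "(string \<times> aexp) list" where
  "trial_queries = [(''gx'', togE (Elem ''m1'' (V ''j''))), (''gy'', togE (Elem ''m2'' (V ''j''))),
      (''gs'', togE (xorE (Elem ''m1'' (V ''j'')) (Elem ''m2'' (V ''j'')))),
      (''gp'', togE (xorE (andE (Elem ''m1'' (V ''j'')) (Elem ''m2'' (V ''j''))) (Elem ''m3'' (V ''j'')))),
      (''gz'', togE (Elem ''m3'' (V ''j''))), (''go'', togE (notE (Elem ''m3'' (V ''j'')))),
      (''ge'', togE (xorE (xorE (Elem ''x'' (V ''j'')) witE) (Elem ''m3'' (V ''j''))))]"

definition Judge :: com where
  "Judge = Seq (Queries trial_queries) (Seq (Set ''okt'' oktE) (Seq (Set ''et'' (xorE (V ''ge'') (V ''gz'')))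
    (Seq (Set ''a0'' (andE (V ''a0'') (andE (V ''okt'') (notE (V ''et'')))))
      (Set ''a1'' (andE (V ''a1'') (andE (V ''okt'') (V ''et'')))))))"

definition Trial :: com where
  "Trial = Seq (RV ''m1'') (Seq (RV ''m2'') (Seq (RV ''m3'') Judge))"

abbreviation "varsG \<equiv> {''gx'', ''gy'', ''gs'', ''gp'', ''gz'', ''go'', ''ge''}"

abbreviation "varsTrial \<equiv> {''m1'', ''m2'', ''m3'', ''j'', ''c'', ''q'', ''okt'', ''et'', ''a0'', ''a1''} \<union> varsG"

definition Trials :: com where
  "Trials = Seq (Set ''a0'' (Const 1)) (Seq (Set ''a1'' (Const 1)) (For ''i'' (V ''l'') Trial))"

lemma put_apply: "put x i v \<sigma> y = (if y = x then (\<sigma> x)(i := v) else \<sigma> y)"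
  by (simp add: put_def)

lemma aval_oktE:
  assumes "\<sigma> ''gx'' 0 = of_bool X" "\<sigma> ''gy'' 0 = of_bool Y" "\<sigma> ''gs'' 0 = of_bool S"
    "\<sigma> ''gp'' 0 = of_bool P" "\<sigma> ''gz'' 0 = of_bool Z" "\<sigma> ''go'' 0 = of_bool O'"
  shows "aval oktE \<sigma> = of_bool (S = (X \<noteq> Y) \<and> (P \<noteq> Z) = (X \<and> Y) \<and> O' \<noteq> Z)"
  unfolding oktE_def andE_def notE_def eqE_def xorE_def
  by (cases X; cases Y; cases S; cases P; cases Z; cases O'; simp add: assms)

lemma (in oracles) dt_Assign_Seq:
  assumes "ht c (put x (aval i \<sigma>) (aval e \<sigma>) \<sigma>) t q A R"
  shows "ht (Seq (Assign x i e) c) \<sigma> (t + 2) q A R"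
proof -
  have "ht (Seq (Assign x i e) c) \<sigma> (Suc (1 + t)) (0 + q) A R"
    by (rule dt_ht_Seq[OF dt_Assign[where Q="\<lambda>\<sigma>'. \<sigma>' = put x (aval i \<sigma>) (aval e \<sigma>) \<sigma>"]]) (use assms in simp_all)
  then show ?thesis by simp
qed

locale machine = oracles +
  fixes s r l N :: nat
begin

definition base :: "(nat \<Rightarrow> nat) \<Rightarrow> store \<Rightarrow> bool" where
  "base p \<sigma> \<longleftrightarrow> \<sigma> ''n'' 0 = n \<and> \<sigma> ''k'' 0 = r * s \<and> \<sigma> ''s'' 0 = s \<and> \<sigma> ''r'' 0 = r \<and>
     \<sigma> ''l'' 0 = l \<and> \<sigma> ''N'' 0 = N \<and> (\<forall>i\<le>l. \<sigma> ''pow'' i = 2 ^ i) \<and> (\<forall>j<n. \<sigma> ''pi'' j = p j)"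

text \<open>The array \<open>kn\<close> is the characteristic function of the known blocks, so
  membership costs one access. It is specified at every index, which the all-zero initial store
  provides for.\<close>

definition slotsP :: "slots \<Rightarrow> store \<Rightarrow> bool" where
  "slotsP cs \<sigma> \<longleftrightarrow> \<sigma> ''nb'' 0 = length cs \<and> \<sigma> ''wp'' 0 = length cs * n \<and>
     (\<forall>v<length cs. \<sigma> ''bl'' v = fst (cs ! v)) \<and>
     (\<forall>v<length cs. \<forall>j<n. \<sigma> ''w'' (v * n + j) = of_bool (snd (cs ! v) j)) \<and>
     (\<forall>B. \<sigma> ''kn'' B = of_bool (B \<in> fst ` set cs))"

text \<open>Rows have the fixed width \<open>r * s\<close>, while only the columns of existing slots
  carry meaning; the slots no longer change while terms are learnt.\<close>

definition termsP :: "slots \<Rightarrow> nat set list \<Rightarrow> store \<Rightarrow> bool" where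
  "termsP cs ts \<sigma> \<longleftrightarrow> \<sigma> ''nt'' 0 = length ts \<and>
     (\<forall>u<length ts. \<forall>v<length cs. \<sigma> ''tm'' (u * (r * s) + v) = of_bool (v \<in> ts ! u))"

definition pointP :: "string \<Rightarrow> (nat \<Rightarrow> bool) \<Rightarrow> store \<Rightarrow> bool" where
  "pointP y x \<sigma> \<longleftrightarrow> (\<forall>j<n. \<sigma> y j = of_bool (x j))"

definition slotP :: "nat \<times> (nat \<Rightarrow> bool) \<Rightarrow> store \<Rightarrow> bool" where
  "slotP c \<sigma> \<longleftrightarrow> \<sigma> ''bl'' (\<sigma> ''v'' 0) = fst c \<and> (\<forall>j<n. \<sigma> ''w'' (\<sigma> ''wq'' 0 + j) = of_bool (snd c j))"

text \<open>A frame rule: the invariant survives every command whose changed arrays avoid those it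
  mentions. The analogous rules for the other invariants follow.\<close>

lemma base_same: "base p \<sigma> \<Longrightarrow> same W \<sigma> \<sigma>' \<Longrightarrow> W \<inter> varsB = {} \<Longrightarrow> base p \<sigma>'"
  unfolding base_def using sameD[of W \<sigma> \<sigma>'] by auto

lemma slotsP_same: "slotsP cs \<sigma> \<Longrightarrow> same W \<sigma> \<sigma>' \<Longrightarrow> W \<inter> varsS = {} \<Longrightarrow> slotsP cs \<sigma>'"
  unfolding slotsP_def using sameD[of W \<sigma> \<sigma>'] by auto

lemma termsP_same: "termsP cs ts \<sigma> \<Longrightarrow> same W \<sigma> \<sigma>' \<Longrightarrow> W \<inter> varsT = {} \<Longrightarrow> termsP cs ts \<sigma>'"
  unfolding termsP_def using sameD[of W \<sigma> \<sigma>'] by auto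

lemma pointP_same: "pointP y x \<sigma> \<Longrightarrow> same W \<sigma> \<sigma>' \<Longrightarrow> y \<notin> W \<Longrightarrow> pointP y x \<sigma>'"
  unfolding pointP_def using sameD[of W \<sigma> \<sigma>'] by auto

lemma slotP_same: "slotP c \<sigma> \<Longrightarrow> same W \<sigma> \<sigma>' \<Longrightarrow> W \<inter> {''bl'', ''v'', ''w'', ''wq''} = {} \<Longrightarrow> slotP c \<sigma>'"
  unfolding slotP_def using sameD[of W \<sigma> \<sigma>'] by auto

lemma base_n: "base p \<sigma> \<Longrightarrow> \<sigma> ''n'' 0 = n"
  by (simp add: base_def)

lemma ht_RV_base:
  assumes "base p \<sigma>" "dst \<notin> {''n'', ''j'', ''c''}"
  shows "ht (RV dst) \<sigma> (6 * n + 3) 0 (rvec n) (\<lambda>\<sigma>' d. same {''j'', ''c'', dst} \<sigma> \<sigma>' \<and> (\<forall>j<n. \<sigma>' dst j = of_bool (d j)))"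
  using ht_RV[of \<sigma> dst] base_n[OF assms(1)] assms(2) by blast

lemma aval_point: "pointP y x \<sigma> \<Longrightarrow> \<sigma> ''j'' 0 = i \<Longrightarrow> i < n \<Longrightarrow> aval (Elem y (V ''j'')) \<sigma> = of_bool (x i)"
  by (simp add: pointP_def)

lemma aval_wit: "slotP c \<sigma> \<Longrightarrow> \<sigma> ''j'' 0 = i \<Longrightarrow> i < n \<Longrightarrow> aval witE \<sigma> = of_bool (snd c i)"
  by (simp add: slotP_def witE_def)

lemma aval_in: "base p \<sigma> \<Longrightarrow> slotP c \<sigma> \<Longrightarrow> \<sigma> ''j'' 0 = i \<Longrightarrow> i < n \<Longrightarrow> aval inE \<sigma> = of_bool (p i = fst c)"
  by (simp add: slotP_def base_def inE_def aval_eqE)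

lemma aval_togE:
  assumes "base p \<sigma>" "slotP c \<sigma>" "\<sigma> ''j'' 0 = i" "i < n" "aval d \<sigma> = of_bool (h i)"
  shows "aval (togE d) \<sigma> = of_bool (toggle p c h i)"
  unfolding togE_def toggle_def
  by (rule aval_xorE[OF aval_wit[OF assms(2-4)] aval_andE[OF assms(5)]])
     (simp add: aval_in[OF assms(1-4)])

lemma dt_Judge:
  assumes b: "base p \<sigma>" and c: "slotP c \<sigma>" and x: "pointP ''x'' x \<sigma>"
    and m: "pointP ''m1'' m1 \<sigma>" "pointP ''m2'' m2 \<sigma>" "pointP ''m3'' m3 \<sigma>"
    and a: "\<sigma> ''a0'' 0 = of_bool a0" "\<sigma> ''a1'' 0 = of_bool a1"
    and G: "G = slotfun p c"
    and ok: "ok = (lin_ok G m1 m2 \<and> mul_ok G m1 m2 m3 \<and> one_ok G m3)"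
    and e: "e = corr G (\<lambda>j. x j \<noteq> snd c j) m3"
  shows "dt Judge \<sigma> (28 * n + 60) 7 (\<lambda>\<sigma>'. same ({''j'', ''q'', ''okt'', ''et'', ''a0'', ''a1''} \<union> varsG) \<sigma> \<sigma>' \<and>
     \<sigma>' ''a0'' 0 = of_bool (a0 \<and> ok \<and> \<not> e) \<and> \<sigma>' ''a1'' 0 = of_bool (a1 \<and> ok \<and> e))" (is "dt _ _ _ _ ?R")
proof -
  define ds where "ds = [m1, m2, \<lambda>j. m1 j \<noteq> m2 j, \<lambda>j. (m1 j \<and> m2 j) \<noteq> m3 j, m3, \<lambda>j. \<not> m3 j,
     \<lambda>j. (x j \<noteq> snd c j) \<noteq> m3 j]"
  define gs where "gs = map (toggle p c) ds"
  have q: "dt (Queries trial_queries) \<sigma> (length trial_queries * (4 * n + 6) + 1) (length trial_queries)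
     (\<lambda>\<sigma>'. same (varsG \<union> {''q'', ''j''}) \<sigma> \<sigma>' \<and> (\<forall>y. y \<notin> fst ` set trial_queries \<longrightarrow> y \<notin> {''q'', ''j''} \<longrightarrow> \<sigma>' y = \<sigma> y) \<and>
        (\<forall>((y, e), g) \<in> set (zip trial_queries gs). \<sigma>' y 0 = of_bool (ask g)))"
  proof (rule dt_Queries)
    show "\<sigma> ''n'' 0 = n" using b by (rule base_n)
    show "distinct (map fst trial_queries)" by (simp add: trial_queries_def)
    show "y \<in> varsG" if "((y, e), g) \<in> set (zip trial_queries gs)" for y e g
      using that by (auto simp: trial_queries_def gs_def ds_def)
    show "varsG \<inter> {''n'', ''q'', ''j''} = {}" by simp
    show "length gs = length trial_queries" by (simp add: gs_def ds_def trial_queries_def)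
    fix \<sigma>' i y e g
    assume "((y, e), g) \<in> set (zip trial_queries gs)" and s': "same (varsG \<union> {''q'', ''j''}) \<sigma> \<sigma>'"
      and i: "\<sigma>' ''j'' 0 = i" "i < n"
    have b': "base p \<sigma>'" by (rule base_same[OF b s']) simp
    have c': "slotP c \<sigma>'" by (rule slotP_same[OF c s']) simp
    have x': "aval (Elem ''x'' (V ''j'')) \<sigma>' = of_bool (x i)"
      by (rule aval_point[OF pointP_same[OF x s']]) (simp_all add: i)
    have m1': "aval (Elem ''m1'' (V ''j'')) \<sigma>' = of_bool (m1 i)"
      by (rule aval_point[OF pointP_same[OF m(1) s']]) (simp_all add: i)
    have m2': "aval (Elem ''m2'' (V ''j'')) \<sigma>' = of_bool (m2 i)"
      by (rule aval_point[OF pointP_same[OF m(2) s']]) (simp_all add: i)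
    have m3': "aval (Elem ''m3'' (V ''j'')) \<sigma>' = of_bool (m3 i)"
      by (rule aval_point[OF pointP_same[OF m(3) s']]) (simp_all add: i)
    have nz: "(aval (Elem ''m2'' (V ''j'')) \<sigma>' \<noteq> 0) = m2 i" unfolding m2' by simp
    note w' = aval_wit[OF c' i] and t = aval_togE[OF b' c' i]
    have all: "\<forall>((y, e), g) \<in> set (zip trial_queries gs). aval e \<sigma>' = of_bool (g i)"
      unfolding trial_queries_def gs_def ds_def list.map zip_Cons_Cons zip_Nil list.set
      by (intro ballI, elim insertE emptyE; simp only: case_prod_conv)
         (intro t m1' m2' m3' aval_xorE aval_andE nz aval_notE x' w')+
    then show "aval e \<sigma>' = of_bool (g i)" using \<open>((y, e), g) \<in> _\<close> by blast
  qed
  show ?thesis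
    unfolding Judge_def
  proof (rule ht_mono[OF dt_ht_Seq[OF q]])
    fix \<sigma>1
    assume s1: "same (varsG \<union> {''q'', ''j''}) \<sigma> \<sigma>1 \<and> (\<forall>y. y \<notin> fst ` set trial_queries \<longrightarrow> y \<notin> {''q'', ''j''} \<longrightarrow> \<sigma>1 y = \<sigma> y) \<and>
        (\<forall>((y, e), g) \<in> set (zip trial_queries gs). \<sigma>1 y 0 = of_bool (ask g))"
    have v: "\<sigma>1 ''gx'' 0 = of_bool (G m1)" "\<sigma>1 ''gy'' 0 = of_bool (G m2)"
      "\<sigma>1 ''gs'' 0 = of_bool (G (\<lambda>j. m1 j \<noteq> m2 j))" "\<sigma>1 ''gp'' 0 = of_bool (G (\<lambda>j. (m1 j \<and> m2 j) \<noteq> m3 j))"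
      "\<sigma>1 ''gz'' 0 = of_bool (G m3)" "\<sigma>1 ''go'' 0 = of_bool (G (\<lambda>j. \<not> m3 j))"
      "\<sigma>1 ''ge'' 0 = of_bool (G (\<lambda>j. (x j \<noteq> snd c j) \<noteq> m3 j))"
      using conjunct2[OF conjunct2[OF s1]]
      by (simp_all add: G trial_queries_def gs_def ds_def)
    have okt: "aval oktE \<sigma>1 = of_bool ok"
      unfolding ok lin_ok_def mul_ok_def one_ok_def by (rule aval_oktE[where \<sigma>=\<sigma>1, OF v(1-6)])
    have a': "\<sigma>1 ''a0'' 0 = of_bool a0" "\<sigma>1 ''a1'' 0 = of_bool a1"
      using a sameD[OF conjunct1[OF s1], of "''a0''"] sameD[OF conjunct1[OF s1], of "''a1''"] by simp_all
    \<comment> \<open>The intermediate stores are named so that the four assignments can be verified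
      backwards, each with its value already computed.\<close>
    define \<sigma>2 where "\<sigma>2 = put ''okt'' 0 (of_bool ok) \<sigma>1"
    define \<sigma>3 where "\<sigma>3 = put ''et'' 0 (of_bool e) \<sigma>2"
    define \<sigma>4 where "\<sigma>4 = put ''a0'' 0 (of_bool (a0 \<and> ok \<and> \<not> e)) \<sigma>3"
    have et: "aval (xorE (V ''ge'') (V ''gz'')) \<sigma>2 = of_bool e"
      unfolding e corr_def by (rule aval_xorE) (simp_all add: v put_apply \<sigma>2_def)
    have v3: "aval (V ''okt'') \<sigma>3 = of_bool ok" "aval (V ''et'') \<sigma>3 = of_bool e" "aval (V ''a0'') \<sigma>3 = of_bool a0"
      using a' by (simp_all add: put_apply \<sigma>2_def \<sigma>3_def)
    have v4: "aval (V ''okt'') \<sigma>4 = of_bool ok" "aval (V ''et'') \<sigma>4 = of_bool e" "aval (V ''a1'') \<sigma>4 = of_bool a1"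
      using a' by (simp_all add: put_apply \<sigma>2_def \<sigma>3_def \<sigma>4_def)
    have x3: "aval (andE (V ''a0'') (andE (V ''okt'') (notE (V ''et'')))) \<sigma>3 = of_bool (a0 \<and> ok \<and> \<not> e)"
      by (rule aval_andE[OF v3(3)]) (simp add: aval_andE[OF v3(1)] aval_notE[OF v3(2)])
    have x4: "aval (andE (V ''a1'') (andE (V ''okt'') (V ''et''))) \<sigma>4 = of_bool (a1 \<and> ok \<and> e)"
      by (rule aval_andE[OF v4(3)]) (simp add: aval_andE[OF v4(1)] v4(2) del: aval.simps)
    have "same ({''j'', ''q'', ''okt'', ''et'', ''a0'', ''a1''} \<union> varsG) \<sigma> \<sigma>1"
      by (rule same_mono[OF conjunct1[OF s1]]) simp
    then have s4: "same ({''j'', ''q'', ''okt'', ''et'', ''a0'', ''a1''} \<union> varsG) \<sigma> (put ''a1'' 0 (of_bool (a1 \<and> ok \<and> e)) \<sigma>4)"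
      unfolding \<sigma>4_def \<sigma>3_def \<sigma>2_def by (intro same_put) simp_all
    have d4: "dt (Set ''a1'' (andE (V ''a1'') (andE (V ''okt'') (V ''et'')))) \<sigma>4 1 0 ?R"
      by (rule dt_Assign) (use s4 in \<open>simp only: x4, simp add: put_apply \<sigma>4_def\<close>)
    have d3: "dt (Seq (Set ''a0'' (andE (V ''a0'') (andE (V ''okt'') (notE (V ''et'')))))
      (Set ''a1'' (andE (V ''a1'') (andE (V ''okt'') (V ''et''))))) \<sigma>3 (1 + 2) 0 ?R"
      by (rule dt_Assign_Seq) (use d4 in \<open>simp only: x3 aval.simps \<sigma>4_def[symmetric]\<close>)
    have d2: "dt (Seq (Set ''et'' (xorE (V ''ge'') (V ''gz''))) (Seq (Set ''a0'' (andE (V ''a0'') (andE (V ''okt'') (notE (V ''et'')))))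
      (Set ''a1'' (andE (V ''a1'') (andE (V ''okt'') (V ''et'')))))) \<sigma>2 (1 + 2 + 2) 0 ?R"
      by (rule dt_Assign_Seq) (use d3 in \<open>simp only: et aval.simps \<sigma>3_def[symmetric]\<close>)
    show "dt (Seq (Set ''okt'' oktE) (Seq (Set ''et'' (xorE (V ''ge'') (V ''gz'')))
      (Seq (Set ''a0'' (andE (V ''a0'') (andE (V ''okt'') (notE (V ''et'')))))
      (Set ''a1'' (andE (V ''a1'') (andE (V ''okt'') (V ''et''))))))) \<sigma>1 (1 + 2 + 2 + 2) 0 ?R"
      by (rule dt_Assign_Seq) (use d2 in \<open>simp only: okt aval.simps \<sigma>2_def[symmetric]\<close>)
  qed (simp_all add: trial_queries_def)
qed

lemma ht_Trial:
  assumes b: "base p \<sigma>" and c: "slotP c \<sigma>" and x: "pointP ''x'' x \<sigma>"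
    and a: "\<sigma> ''a0'' 0 = of_bool (fst a)" "\<sigma> ''a1'' 0 = of_bool (snd a)"
  shows "ht Trial \<sigma> (50 * n + 80) 7
     (map_pmf (\<lambda>u. (fst a \<and> fst u \<and> \<not> snd u, snd a \<and> fst u \<and> snd u)) (trial n (slotfun p c) (\<lambda>j. x j \<noteq> snd c j)))
     (\<lambda>\<sigma>' a'. same varsTrial \<sigma> \<sigma>' \<and> \<sigma>' ''a0'' 0 = of_bool (fst a') \<and> \<sigma>' ''a1'' 0 = of_bool (snd a'))"
    (is "ht _ _ _ _ _ ?R")
proof -
  let ?G = "slotfun p c"
  let ?ok = "\<lambda>m1 m2 m3. lin_ok ?G m1 m2 \<and> mul_ok ?G m1 m2 m3 \<and> one_ok ?G m3"
  let ?e = "\<lambda>m3. corr ?G (\<lambda>j. x j \<noteq> snd c j) m3"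
  let ?h = "\<lambda>m1 m2 m3. (fst a \<and> ?ok m1 m2 m3 \<and> \<not> ?e m3, snd a \<and> ?ok m1 m2 m3 \<and> ?e m3)"
  have "ht Trial \<sigma> (Suc ((6 * n + 3) + Suc ((6 * n + 3) + Suc ((6 * n + 3) + (28 * n + 60))))) (0 + (0 + (0 + 7)))
    (bind_pmf (rvec n) (\<lambda>m1. bind_pmf (rvec n) (\<lambda>m2. map_pmf (?h m1 m2) (rvec n)))) ?R"
    unfolding Trial_def
  proof (rule ht_Seq[OF ht_RV_base[OF b]], simp, rule ht_Seq[OF ht_RV_base[where p=p]], goal_cases)
    case (1 \<sigma>1 m1)
    have s1: "same {''j'', ''c'', ''m1''} \<sigma> \<sigma>1" using 1 by blast
    show ?case by (rule base_same[OF b s1]) simp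
  next
    case 2 show ?case by simp
  next
    case (3 \<sigma>1 m1 \<sigma>2 m2)
    have s1: "same {''j'', ''c'', ''m1''} \<sigma> \<sigma>1" and m1: "pointP ''m1'' m1 \<sigma>1"
      and s2: "same {''j'', ''c'', ''m2''} \<sigma>1 \<sigma>2" and m2: "pointP ''m2'' m2 \<sigma>2"
      using 3 by (auto simp: pointP_def)
    let ?W = "{''j'', ''c'', ''m1'', ''m2'', ''m3''}"
    have s2': "same ?W \<sigma> \<sigma>2" by (rule same_trans[OF s1 s2]) simp
    show ?case
    proof (rule ht_map_Seq[OF ht_RV_base[where p=p]], goal_cases)
      case 1
      show ?case by (rule base_same[OF b s2']) simp
    next
      case (3 \<sigma>3 m3)
      have s3: "same {''j'', ''c'', ''m3''} \<sigma>2 \<sigma>3" and m3: "pointP ''m3'' m3 \<sigma>3"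
        using 3 by (auto simp: pointP_def)
      have s3': "same ?W \<sigma> \<sigma>3" by (rule same_trans[OF s2' s3]) simp
      have b3: "base p \<sigma>3" by (rule base_same[OF b s3']) simp
      have c3: "slotP c \<sigma>3" by (rule slotP_same[OF c s3']) simp
      have x3: "pointP ''x'' x \<sigma>3" by (rule pointP_same[OF x s3']) simp
      have m23: "pointP ''m2'' m2 \<sigma>3" by (rule pointP_same[OF m2 s3]) simp
      have m13: "pointP ''m1'' m1 \<sigma>3"
        by (rule pointP_same[OF pointP_same[OF m1 s2] s3]) simp_all
      have a3: "\<sigma>3 ''a0'' 0 = of_bool (fst a)" "\<sigma>3 ''a1'' 0 = of_bool (snd a)"
        using a sameD[OF s3', of "''a0''"] sameD[OF s3', of "''a1''"] by simp_all
      show ?case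
      proof (rule ht_mono[OF dt_Judge[OF b3 c3 x3 m13 m23 m3 a3 refl refl refl]], simp, simp)
        fix \<sigma>4
        assume s4: "same ({''j'', ''q'', ''okt'', ''et'', ''a0'', ''a1''} \<union> varsG) \<sigma>3 \<sigma>4 \<and>
          \<sigma>4 ''a0'' 0 = of_bool (fst a \<and> ?ok m1 m2 m3 \<and> \<not> ?e m3) \<and>
          \<sigma>4 ''a1'' 0 = of_bool (snd a \<and> ?ok m1 m2 m3 \<and> ?e m3)"
        show "same varsTrial \<sigma> \<sigma>4 \<and> \<sigma>4 ''a0'' 0 = of_bool (fst (?h m1 m2 m3)) \<and>
          \<sigma>4 ''a1'' 0 = of_bool (snd (?h m1 m2 m3))"
          using s4 same_trans[OF s3' conjunct1[OF s4], of varsTrial] by simp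
      qed
    qed simp
  qed
  then show ?thesis
    unfolding trial_def map_bind_pmf pmf.map_comp comp_def fst_conv snd_conv
    by (rule ht_mono) simp_all
qed

lemma ht_Trials:
  assumes b: "base p \<sigma>" and c: "slotP c \<sigma>" and x: "pointP ''x'' x \<sigma>"
  shows "ht Trials \<sigma> (10 + l * (50 * n + 83)) (l * 7) (trials n l (slotfun p c) (\<lambda>j. x j \<noteq> snd c j))
     (\<lambda>\<sigma>' a. same (varsTrial \<union> {''i''}) \<sigma> \<sigma>' \<and> \<sigma>' ''a0'' 0 = of_bool (fst a) \<and> \<sigma>' ''a1'' 0 = of_bool (snd a))"
proof -
  let ?I = "\<lambda>i \<sigma>' a. same (varsTrial \<union> {''i''}) \<sigma> \<sigma>' \<and> \<sigma>' ''i'' 0 = i \<and>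
     \<sigma>' ''a0'' 0 = of_bool (fst a) \<and> \<sigma>' ''a1'' 0 = of_bool (snd a)"
  have "ht Trials \<sigma> (3 + l * ((50 * n + 80) + 3) + 2 + 2) (l * 7) (trials n l (slotfun p c) (\<lambda>j. x j \<noteq> snd c j)) (?I l)"
    unfolding Trials_def trials_def
  proof (rule dt_Assign_Seq, rule dt_Assign_Seq, rule ht_For)
    let ?\<sigma>0 = "put ''i'' 0 0 (put ''a1'' (aval (Const 0) (put ''a0'' (aval (Const 0) \<sigma>) (aval (Const 1) \<sigma>) \<sigma>))
          (aval (Const 1) (put ''a0'' (aval (Const 0) \<sigma>) (aval (Const 1) \<sigma>) \<sigma>))
          (put ''a0'' (aval (Const 0) \<sigma>) (aval (Const 1) \<sigma>) \<sigma>))"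
    have "same (varsTrial \<union> {''i''}) \<sigma> ?\<sigma>0" by (intro same_put same_refl) simp_all
    then show "?I 0 ?\<sigma>0 (True, True)" by (simp add: put_apply)
    fix i \<sigma>1 a assume I: "?I i \<sigma>1 a"
    have b1: "base p \<sigma>1" by (rule base_same[OF b conjunct1[OF I]]) simp
    then show "aval (V ''l'') \<sigma>1 = l" by (simp add: base_def)
    show "\<sigma>1 ''i'' 0 = i" using I by simp
    assume i: "i < l"
    have c1: "slotP c \<sigma>1" by (rule slotP_same[OF c conjunct1[OF I]]) simp
    have x1: "pointP ''x'' x \<sigma>1" by (rule pointP_same[OF x conjunct1[OF I]]) simp
    show "ht Trial \<sigma>1 (50 * n + 80) 7
       (map_pmf (\<lambda>u. (fst a \<and> fst u \<and> \<not> snd u, snd a \<and> fst u \<and> snd u)) (trial n (slotfun p c) (\<lambda>j. x j \<noteq> snd c j)))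
       (\<lambda>\<sigma>' a'. \<sigma>' ''i'' 0 = i \<and> ?I (Suc i) (put ''i'' 0 (Suc i) \<sigma>') a')"
    proof (rule ht_mono[OF ht_Trial[OF b1 c1 x1]])
      show "\<sigma>1 ''a0'' 0 = of_bool (fst a)" "\<sigma>1 ''a1'' 0 = of_bool (snd a)" using I by simp_all
      fix \<sigma>2 a' assume s2: "same varsTrial \<sigma>1 \<sigma>2 \<and> \<sigma>2 ''a0'' 0 = of_bool (fst a') \<and> \<sigma>2 ''a1'' 0 = of_bool (snd a')"
      have "same (varsTrial \<union> {''i''}) \<sigma> \<sigma>2" by (rule same_trans[OF conjunct1[OF I] conjunct1[OF s2]]) simp
      then have "same (varsTrial \<union> {''i''}) \<sigma> (put ''i'' 0 (Suc i) \<sigma>2)" by (rule same_put) simp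
      then show "\<sigma>2 ''i'' 0 = i \<and> ?I (Suc i) (put ''i'' 0 (Suc i) \<sigma>2) a'"
        using s2 I sameD[OF conjunct1[OF s2], of "''i''"] by (simp add: put_apply)
    qed simp_all
  qed
  then show ?thesis by (rule ht_mono) (simp_all add: algebra_simps)
qed

end

section \<open>Implementation of slot evaluation, term learning and block search\<close>

definition Incr :: "string \<Rightarrow> aexp \<Rightarrow> com" where
  "Incr x e = Set x (Plus (V x) e)"

definition Eval_slots :: com where
  "Eval_slots = Seq (Set ''oke'' (Const 1)) (Seq (Set ''wq'' (Const 0)) (For ''v'' (V ''nb'')
     (Seq Trials (Seq (Assign ''val'' (V ''v'') (V ''a1''))
       (Seq (Set ''oke'' (andE (V ''oke'') (Plus (V ''a0'') (V ''a1'')))) (Incr ''wq'' (V ''n'')))))))"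

abbreviation "varsEval \<equiv> varsTrial \<union> {''i'', ''v'', ''oke'', ''wq'', ''val''}"

text \<open>The inner truncated difference is 1 exactly for a slot that belongs to the term and is
  not satisfied; subtracting it clears \<open>to\<close> for good.\<close>

definition Eval_terms :: com where
  "Eval_terms = Seq (Set ''h'' (Const 0)) (Seq (Set ''tp'' (Const 0)) (For ''u'' (V ''nt'')
     (Seq (Set ''to'' (Const 1)) (Seq (For ''v'' (V ''nb'')
       (Set ''to'' (Minus (V ''to'') (Minus (Elem ''tm'' (Plus (V ''tp'') (V ''v''))) (Elem ''val'' (V ''v''))))))
     (Seq (Set ''h'' (notE (notE (Plus (V ''h'') (V ''to''))))) (Incr ''tp'' (V ''k'')))))))"

definition "eraseE = Plus (andE witE inE) (andE (Elem ''x'' (V ''j'')) (notE inE))"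

text \<open>The new row of \<open>tm\<close> is written at \<open>tp\<close>, the first free
  position, before it is decided whether the term is accepted; only the later increment of
  \<open>nt\<close> makes it part of the hypothesis.\<close>

definition Learn :: com where
  "Learn = Seq (Set ''tsz'' (Const 0)) (Seq (Set ''wq'' (Const 0)) (For ''v'' (V ''nb'')
     (Seq (QF ''f1'' (hybE eraseE (Const 0)))
     (Seq (Cond (Less (Const 0) (V ''f1''))
        (Seq (Fill ''x'' (Const 0) eraseE) (Assign ''tm'' (Plus (V ''tp'') (V ''v'')) (Const 0)))
        (Seq (Incr ''tsz'' (Const 1)) (Assign ''tm'' (Plus (V ''tp'') (V ''v'')) (Const 1))))
      (Incr ''wq'' (V ''n''))))))"

text \<open>The loop counts up while \<open>bsearch\<close> counts down, hence the exponent
  \<open>l - (i + 1)\<close>.\<close>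

definition Search :: com where
  "Search = Seq (Set ''lo'' (Const 0)) (For ''i'' (V ''l'')
     (Seq (Set ''po'' (Elem ''pow'' (Minus (V ''l'') (Plus (V ''i'') (Const 1)))))
     (Seq (QF ''fh'' (hybE (Elem ''x'' (V ''j'')) (Plus (V ''lo'') (V ''po''))))
       (Cond (Less (Const 0) (eqE (V ''fh'') (V ''f0''))) (Incr ''lo'' (V ''po'')) Skip))))"

text \<open>As \<open>f0\<close> is 0 or 1, the sum of \<open>lo\<close> and \<open>f0\<close>
  selects the false one of the two hybrids without a branch.\<close>

definition Add_slot :: com where
  "Add_slot = Seq (Assign ''bl'' (V ''nb'') (V ''lo''))
     (Seq (Fill ''w'' (V ''wp'') (hybE (Elem ''x'' (V ''j'')) (Plus (V ''lo'') (V ''f0''))))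
     (Seq (Assign ''kn'' (V ''lo'') (Const 1)) (Seq (Incr ''nb'' (Const 1)) (Incr ''wp'' (V ''n'')))))"

context machine
begin

lemma dt_QF_base:
  assumes b: "base p \<sigma>"
    and e: "\<And>\<sigma>' i. same {''q'', ''j''} \<sigma> \<sigma>' \<Longrightarrow> \<sigma>' ''j'' 0 = i \<Longrightarrow> i < n \<Longrightarrow> aval e \<sigma>' = of_bool (g i)"
  shows "dt (QF y e) \<sigma> (4 * n + 5) 1 (\<lambda>\<sigma>'. same {''q'', ''j'', y} \<sigma> \<sigma>' \<and> \<sigma>' y 0 = of_bool (ask g))"
  using dt_QF[of \<sigma> e g y, OF base_n[OF b] e] by blast

lemma aval_hyb:
  assumes b: "base p \<sigma>" and S: "slotsP cs \<sigma>" and i: "\<sigma> ''j'' 0 = i" "i < n" and e: "aval e \<sigma> = of_bool (x i)"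
    and t: "aval t \<sigma> = t'"
  shows "aval (hybE e t) \<sigma> = of_bool (hyb p (fst ` set cs) t' x i)"
  unfolding hyb_def t[symmetric]
  by (rule aval_hybE[OF e]) (use b S i in \<open>simp_all add: base_def slotsP_def\<close>)

lemma ht_Eval_slots:
  assumes b: "base p \<sigma>" and S: "slotsP cs \<sigma>" and x: "pointP ''x'' x \<sigma>"
  shows "ht Eval_slots \<sigma> (10 + length cs * (l * (50 * n + 83) + 30)) (length cs * (l * 7)) (evals l p cs x)
     (\<lambda>\<sigma>' e. same varsEval \<sigma> \<sigma>' \<and> \<sigma>' ''oke'' 0 = of_bool (fst e) \<and> (\<forall>v<length cs. \<sigma>' ''val'' v = of_bool (snd e v)))"
proof -
  let ?I = "\<lambda>v \<sigma>' e. same varsEval \<sigma> \<sigma>' \<and> \<sigma>' ''v'' 0 = v \<and> \<sigma>' ''wq'' 0 = v * n \<and>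
     \<sigma>' ''oke'' 0 = of_bool (fst e) \<and> (\<forall>u<v. \<sigma>' ''val'' u = of_bool (snd e u))"
  let ?t = "Suc ((10 + l * (50 * n + 83)) + (1 + 2 + 2))"
  have "ht Eval_slots \<sigma> (3 + length cs * (?t + 3) + 2 + 2) (length cs * (l * 7 + 0)) (evals l p cs x) (?I (length cs))"
    unfolding Eval_slots_def evals_def
  proof (rule dt_Assign_Seq, rule dt_Assign_Seq, rule ht_For, goal_cases)
    case 1
    show ?case by (intro conjI same_put same_refl) (simp_all add: put_apply)
  next
    case (2 v \<sigma>1 e)
    then have "slotsP cs \<sigma>1" using slotsP_same[OF S, of varsEval \<sigma>1] by simp
    then show ?case by (simp add: slotsP_def)
  next
    case (3 v \<sigma>1 e)
    then show ?case by simp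
  next
    case (4 v \<sigma>1 e)
    note I = 4(2)
    have b1: "base p \<sigma>1" by (rule base_same[OF b conjunct1[OF I]]) simp
    have S1: "slotsP cs \<sigma>1" by (rule slotsP_same[OF S conjunct1[OF I]]) simp
    have x1: "pointP ''x'' x \<sigma>1" by (rule pointP_same[OF x conjunct1[OF I]]) simp
    have c1: "slotP (cs ! v) \<sigma>1" using S1 I 4(1) by (simp add: slotsP_def slotP_def)
    show ?case
    proof (rule ht_map_Seq[OF ht_Trials[OF b1 c1 x1]])
      fix \<sigma>2 a
      assume s2: "same (varsTrial \<union> {''i''}) \<sigma>1 \<sigma>2 \<and> \<sigma>2 ''a0'' 0 = of_bool (fst a) \<and> \<sigma>2 ''a1'' 0 = of_bool (snd a)"
      have v2: "\<sigma>2 ''v'' 0 = v" "\<sigma>2 ''wq'' 0 = v * n" "\<sigma>2 ''oke'' 0 = of_bool (fst e)"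
         "\<sigma>2 ''n'' 0 = n" "\<forall>u<v. \<sigma>2 ''val'' u = of_bool (snd e u)"
        using sameD[OF conjunct1[OF s2], of "''v''"] sameD[OF conjunct1[OF s2], of "''wq''"]
          sameD[OF conjunct1[OF s2], of "''oke''"] sameD[OF conjunct1[OF s2], of "''n''"]
          sameD[OF conjunct1[OF s2], of "''val''"] I base_n[OF b1] by simp_all
      have ss: "same varsEval \<sigma> \<sigma>2" by (rule same_trans[OF conjunct1[OF I] conjunct1[OF s2]]) simp
      show "dt (Seq (Assign ''val'' (V ''v'') (V ''a1''))
         (Seq (Set ''oke'' (andE (V ''oke'') (Plus (V ''a0'') (V ''a1'')))) (Incr ''wq'' (V ''n'')))) \<sigma>2 (1 + 2 + 2) 0
         (\<lambda>\<sigma>'. \<sigma>' ''v'' 0 = v \<and> ?I (Suc v) (put ''v'' 0 (Suc v) \<sigma>')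
            (fst e \<and> (fst a \<or> snd a), (snd e)(v := snd a)))"
        unfolding Incr_def
      proof (rule dt_Assign_Seq, rule dt_Assign_Seq, rule dt_Assign, intro conjI, goal_cases)
        case 1 show ?case by (simp add: put_apply v2)
      next
        case 2 show ?case by (intro same_put ss) simp_all
      next
        case 5
        show ?case using s2 by (auto simp: put_apply v2 andE_def notE_def)
      next
        case 6
        show ?case using s2 v2 by (auto simp: put_apply less_Suc_eq)
      qed (simp_all add: put_apply v2)
    qed
  qed
  then show ?thesis by (rule ht_mono) (simp_all add: algebra_simps)
qed

lemma dt_Eval_terms:
  assumes b: "base p \<sigma>" and S: "slotsP cs \<sigma>" and T: "termsP cs ts \<sigma>"
    and ts: "\<forall>t\<in>set ts. t \<subseteq> {..<length cs}" and v: "\<forall>v<length cs. \<sigma> ''val'' v = of_bool (e v)"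
  shows "dt Eval_terms \<sigma> (10 + length ts * (length cs * 4 + 20)) 0
     (\<lambda>\<sigma>'. same {''h'', ''tp'', ''u'', ''to'', ''v''} \<sigma> \<sigma>' \<and> \<sigma>' ''h'' 0 = of_bool (holds ts e) \<and>
        \<sigma>' ''tp'' 0 = length ts * (r * s))"
proof -
  let ?W = "{''h'', ''tp'', ''u'', ''to'', ''v''}"
  let ?I = "\<lambda>u \<sigma>'. same ?W \<sigma> \<sigma>' \<and> \<sigma>' ''u'' 0 = u \<and> \<sigma>' ''tp'' 0 = u * (r * s) \<and>
     \<sigma>' ''h'' 0 = of_bool (\<exists>u'<u. \<forall>v\<in>ts ! u'. e v)"
  let ?t = "Suc ((3 + length cs * (1 + 3)) + (1 + 2)) + 2"
  have "dt Eval_terms \<sigma> (3 + length ts * (?t + 3) + 2 + 2) (length ts * (length cs * 0 + 0)) (?I (length ts))"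
    unfolding Eval_terms_def
  proof (rule dt_Assign_Seq, rule dt_Assign_Seq, rule ht_For_dt, goal_cases)
    case 1
    show ?case by (intro conjI same_put same_refl) (simp_all add: put_apply)
  next
    case (2 u \<sigma>1)
    then have "termsP cs ts \<sigma>1" using termsP_same[OF T, of ?W \<sigma>1] by simp
    then show ?case by (simp add: termsP_def)
  next
    case (3 u \<sigma>1)
    then show ?case by simp
  next
    case (4 u \<sigma>1)
    note I = 4(2)
    have b1: "base p \<sigma>1" by (rule base_same[OF b conjunct1[OF I]]) simp
    have S1: "slotsP cs \<sigma>1" by (rule slotsP_same[OF S conjunct1[OF I]]) simp
    have T1: "termsP cs ts \<sigma>1" by (rule termsP_same[OF T conjunct1[OF I]]) simp
    have v1: "\<forall>v<length cs. \<sigma>1 ''val'' v = of_bool (e v)" using v sameD[OF conjunct1[OF I], of "''val''"] by simp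
    let ?J = "\<lambda>v \<sigma>'. same {''to'', ''v''} \<sigma>1 \<sigma>' \<and> \<sigma>' ''v'' 0 = v \<and> \<sigma>' ''to'' 0 = of_bool (\<forall>w\<in>ts ! u. w < v \<longrightarrow> e w)"
    show ?case
    proof (rule dt_Assign_Seq, rule dt_ht_Seq)
      show "dt (For ''v'' (V ''nb'') (Set ''to'' (Minus (V ''to'') (Minus (Elem ''tm'' (Plus (V ''tp'') (V ''v''))) (Elem ''val'' (V ''v''))))))
        (put ''to'' (aval (Const 0) \<sigma>1) (aval (Const 1) \<sigma>1) \<sigma>1) (3 + length cs * (1 + 3)) (length cs * 0) (?J (length cs))"
      proof (rule ht_For_dt, goal_cases)
        case 1
        show ?case by (intro conjI same_put same_refl) (simp_all add: put_apply)
      next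
        case (2 v \<sigma>2)
        then have "slotsP cs \<sigma>2" using slotsP_same[OF S1, of "{''to'', ''v''}" \<sigma>2] by simp
        then show ?case by (simp add: slotsP_def)
      next
        case (3 v \<sigma>2)
        then show ?case by simp
      next
        case (4 v \<sigma>2)
        note J = 4(2)
        have e2: "\<sigma>2 ''tm'' = \<sigma>1 ''tm''" "\<sigma>2 ''val'' = \<sigma>1 ''val''" "\<sigma>2 ''tp'' = \<sigma>1 ''tp''"
          using sameD[OF conjunct1[OF J]] by simp_all
        have tm: "\<sigma>1 ''tm'' (u * (r * s) + v) = of_bool (v \<in> ts ! u)"
          using T1 4(1) \<open>u < length ts\<close> by (simp add: termsP_def)
        have val: "\<sigma>1 ''val'' v = of_bool (e v)" using v1 4(1) by simp
        have ex: "(\<forall>w\<in>ts ! u. w < Suc v \<longrightarrow> e w) \<longleftrightarrow> (\<forall>w\<in>ts ! u. w < v \<longrightarrow> e w) \<and> (v \<in> ts ! u \<longrightarrow> e v)"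
          by (auto simp: less_Suc_eq)
        have I': "\<sigma>1 ''tp'' 0 = u * (r * s)" "\<sigma>2 ''v'' 0 = v"
          "\<sigma>2 ''to'' 0 = of_bool (\<forall>w\<in>ts ! u. w < v \<longrightarrow> e w)" using I J by simp_all
        show ?case
          unfolding ex by (rule dt_Assign, intro conjI same_put conjunct1[OF J]) (simp_all add: put_apply e2 tm val I')
      qed
    next
      fix \<sigma>2 assume J: "?J (length cs) \<sigma>2"
      have s2: "same ?W \<sigma> \<sigma>2" by (rule same_trans[OF conjunct1[OF I] conjunct1[OF J]]) simp
      have e2: "\<sigma>2 ''u'' 0 = u" "\<sigma>2 ''tp'' 0 = u * (r * s)" "\<sigma>2 ''h'' 0 = of_bool (\<exists>u'<u. \<forall>v\<in>ts ! u'. e v)"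
         "\<sigma>2 ''k'' 0 = r * s"
        using sameD[OF conjunct1[OF J]] I b1 by (simp_all add: base_def)
      have "(\<forall>w\<in>ts ! u. w < length cs \<longrightarrow> e w) \<longleftrightarrow> (\<forall>w\<in>ts ! u. e w)"
        using ts \<open>u < length ts\<close> by (meson lessThan_iff nth_mem subsetD)
      then have to2: "\<sigma>2 ''to'' 0 = of_bool (\<forall>w\<in>ts ! u. e w)" using J by simp
      have ex: "(\<exists>u'<Suc u. \<forall>v\<in>ts ! u'. e v) \<longleftrightarrow> (\<exists>u'<u. \<forall>v\<in>ts ! u'. e v) \<or> (\<forall>v\<in>ts ! u. e v)"
        by (auto simp: less_Suc_eq)
      show "dt (Seq (Set ''h'' (notE (notE (Plus (V ''h'') (V ''to''))))) (Incr ''tp'' (V ''k''))) \<sigma>2 (1 + 2) 0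
         (\<lambda>\<sigma>'. \<sigma>' ''u'' 0 = u \<and> ?I (Suc u) (put ''u'' 0 (Suc u) \<sigma>'))"
        unfolding Incr_def
      proof (rule dt_Assign_Seq, rule dt_Assign, intro conjI, goal_cases)
        case 2 show ?case by (intro same_put s2) simp_all
      next
        case 5 show ?case unfolding ex by (simp add: put_apply e2 to2 notE_def)
      qed (simp_all add: put_apply e2)
    qed
  qed
  then show ?thesis
  proof (rule ht_mono)
    fix \<sigma>' assume "?I (length ts) \<sigma>'"
    moreover have "(\<exists>u'<length ts. \<forall>v\<in>ts ! u'. e v) = holds ts e"
      unfolding holds_def by (metis in_set_conv_nth)
    ultimately show "same ?W \<sigma> \<sigma>' \<and> \<sigma>' ''h'' 0 = of_bool (holds ts e) \<and> \<sigma>' ''tp'' 0 = length ts * (r * s)"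
      by simp
  qed (simp_all add: algebra_simps)
qed

lemma aval_eraseE:
  assumes "base p \<sigma>" "slotP c \<sigma>" "\<sigma> ''j'' 0 = i" "i < n" "aval (Elem ''x'' (V ''j'')) \<sigma> = of_bool (x i)"
  shows "aval eraseE \<sigma> = of_bool (if p i = fst c then snd c i else x i)"
proof -
  have "aval (andE witE inE) \<sigma> = of_bool (snd c i \<and> p i = fst c)"
    by (rule aval_andE[OF aval_wit[OF assms(2-4)]]) (simp add: aval_in[OF assms(1-4)])
  moreover have "aval (andE (Elem ''x'' (V ''j'')) (notE inE)) \<sigma> = of_bool (x i \<and> p i \<noteq> fst c)"
    by (rule aval_andE[OF assms(5)]) (simp add: aval_notE[OF aval_in[OF assms(1-4)]])
  ultimately show ?thesis by (simp add: eraseE_def)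
qed

text \<open>The row is complete but not yet counted, so the last clause promises
  \<open>termsP\<close> for the stores that arise when \<open>nt\<close> alone is raised.\<close>

lemma dt_Learn:
  assumes b: "base p \<sigma>" and S: "slotsP cs \<sigma>" and T: "termsP cs ts \<sigma>" and x: "pointP ''x'' x \<sigma>"
    and tp: "\<sigma> ''tp'' 0 = length ts * (r * s)" and len: "length cs \<le> r * s"
    and t: "t = snd (learn p cs x (length cs))"
  shows "dt Learn \<sigma> (10 + length cs * (8 * n + 30)) (length cs)
     (\<lambda>\<sigma>'. same {''tsz'', ''wq'', ''v'', ''q'', ''j'', ''f1'', ''x'', ''tm''} \<sigma> \<sigma>' \<and> \<sigma>' ''tsz'' 0 = card t \<and>
        (\<forall>\<sigma>''. same {''nt''} \<sigma>' \<sigma>'' \<longrightarrow> \<sigma>'' ''nt'' 0 = Suc (length ts) \<longrightarrow> termsP cs (ts @ [t]) \<sigma>''))"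
proof -
  let ?W = "{''tsz'', ''wq'', ''v'', ''q'', ''j'', ''f1'', ''x'', ''tm''}"
  let ?L = "\<lambda>v. learn p cs x v"
  let ?I = "\<lambda>v \<sigma>'. same ?W \<sigma> \<sigma>' \<and> \<sigma>' ''v'' 0 = v \<and> \<sigma>' ''wq'' 0 = v * n \<and>
     \<sigma>' ''tsz'' 0 = card (snd (?L v)) \<and> pointP ''x'' (fst (?L v)) \<sigma>' \<and>
     (\<forall>m. \<sigma>' ''tm'' m = (if length ts * (r * s) \<le> m \<and> m < length ts * (r * s) + v
        then of_bool (m - length ts * (r * s) \<in> snd (?L v)) else \<sigma> ''tm'' m))"
  have "dt Learn \<sigma> (3 + length cs * ((8 * n + 20) + 3) + 2 + 2) (length cs * 1) (?I (length cs))"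
    unfolding Learn_def
  proof (rule dt_Assign_Seq, rule dt_Assign_Seq, rule ht_For_dt, goal_cases)
    case 1
    show ?case using x by (intro conjI same_put same_refl) (simp_all add: put_apply pointP_def)
  next
    case (2 v \<sigma>1)
    then have "slotsP cs \<sigma>1" using slotsP_same[OF S, of ?W \<sigma>1] by simp
    then show ?case by (simp add: slotsP_def)
  next
    case (3 v \<sigma>1)
    then show ?case by simp
  next
    case (4 v \<sigma>1)
    note I = 4(2)
    obtain y u where yu: "?L v = (y, u)" by fastforce
    have uv: "u \<subseteq> {..<v}" using learn_slots[of p cs x v] yu by simp
    then have vu: "v \<notin> u" by auto
    then have u_card: "card (insert v u) = Suc (card u)" using finite_subset[OF uv] by simp
    define y' where "y' = (\<lambda>j. if p j = fst (cs ! v) then snd (cs ! v) j else y j)"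
    define res where "res = ask (hyb p (fst ` set cs) 0 y')"
    have L: "?L (Suc v) = (if res then (y', u) else (y, insert v u))"
      by (simp add: yu y'_def[symmetric] res_def)
    have s1: "same ?W \<sigma> \<sigma>1" and I1: "\<sigma>1 ''v'' 0 = v" "\<sigma>1 ''wq'' 0 = v * n" "\<sigma>1 ''tsz'' 0 = card u" "pointP ''x'' y \<sigma>1"
      "\<And>m. \<sigma>1 ''tm'' m = (if length ts * (r * s) \<le> m \<and> m < length ts * (r * s) + v
        then of_bool (m - length ts * (r * s) \<in> u) else \<sigma> ''tm'' m)"
      using I yu by simp_all
    have b1: "base p \<sigma>1" by (rule base_same[OF b s1]) simp
    have S1: "slotsP cs \<sigma>1" by (rule slotsP_same[OF S s1]) simp
    have c1: "slotP (cs ! v) \<sigma>1" using S1 I1 4(1) by (simp add: slotsP_def slotP_def)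
    \<comment> \<open>Applied twice: to the query, during which \<open>x\<close> is untouched, and
      to the fill, which overwrites \<open>x\<close> in place and reads each entry before changing
      it.\<close>
    have er: "aval eraseE \<sigma>' = of_bool (y' i)"
      if s: "same W \<sigma>1 \<sigma>'" "W \<inter> varsB = {}" "\<sigma>' ''j'' 0 = i" "i < n" "\<sigma>' ''x'' i = \<sigma>1 ''x'' i"
        "W \<inter> {''bl'', ''v'', ''w'', ''wq''} = {}" for W \<sigma>' i
      unfolding y'_def
    proof (rule aval_eraseE[where \<sigma>=\<sigma>', OF _ _ s(3,4)])
      show "base p \<sigma>'" by (rule base_same[OF b1 s(1,2)])
      show "slotP (cs ! v) \<sigma>'" by (rule slotP_same[OF c1 s(1,6)])
      show "aval (Elem ''x'' (V ''j'')) \<sigma>' = of_bool (y i)" using s(3-5) I1(4) by (simp add: pointP_def)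
    qed
    have Q: "dt (QF ''f1'' (hybE eraseE (Const 0))) \<sigma>1 (4 * n + 5) 1
       (\<lambda>\<sigma>'. same {''q'', ''j'', ''f1''} \<sigma>1 \<sigma>' \<and> \<sigma>' ''f1'' 0 = of_bool res)"
      unfolding res_def
    proof (rule dt_QF_base[OF b1])
      fix \<sigma>' i assume s': "same {''q'', ''j''} \<sigma>1 \<sigma>'" "\<sigma>' ''j'' 0 = i" "i < n"
      show "aval (hybE eraseE (Const 0)) \<sigma>' = of_bool (hyb p (fst ` set cs) 0 y' i)"
      proof (rule aval_hyb[where \<sigma>=\<sigma>', OF _ _ s'(2,3)])
        show "base p \<sigma>'" by (rule base_same[OF b1 s'(1)]) simp
        show "slotsP cs \<sigma>'" by (rule slotsP_same[OF S1 s'(1)]) simp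
        show "aval eraseE \<sigma>' = of_bool (y' i)"
          by (rule er[OF s'(1)]) (use s' sameD[OF s'(1), of "''x''"] in simp_all)
      qed simp
    qed
    let ?C = "Cond (Less (Const 0) (V ''f1''))
        (Seq (Fill ''x'' (Const 0) eraseE) (Assign ''tm'' (Plus (V ''tp'') (V ''v'')) (Const 0)))
        (Seq (Incr ''tsz'' (Const 1)) (Assign ''tm'' (Plus (V ''tp'') (V ''v'')) (Const 1)))"
    let ?J = "\<lambda>\<sigma>'. same ?W \<sigma> \<sigma>' \<and> \<sigma>' ''v'' 0 = v \<and> \<sigma>' ''wq'' 0 = v * n \<and>
     \<sigma>' ''tsz'' 0 = card (snd (?L (Suc v))) \<and> pointP ''x'' (fst (?L (Suc v))) \<sigma>' \<and>
     (\<forall>m. \<sigma>' ''tm'' m = (if length ts * (r * s) \<le> m \<and> m < length ts * (r * s) + Suc v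
        then of_bool (m - length ts * (r * s) \<in> snd (?L (Suc v))) else \<sigma> ''tm'' m))"
    have body: "dt (Seq (QF ''f1'' (hybE eraseE (Const 0))) (Seq ?C (Incr ''wq'' (V ''n'')))) \<sigma>1
        (Suc ((4 * n + 5) + Suc (Suc (4 * n + 8) + 1))) (1 + (0 + 0))
        (\<lambda>\<sigma>'. \<sigma>' ''v'' 0 = v \<and> ?I (Suc v) (put ''v'' 0 (Suc v) \<sigma>'))"
    proof (rule dt_ht_Seq[OF Q], rule dt_ht_Seq[where Q="?J"])
      fix \<sigma>2 assume s2: "same {''q'', ''j'', ''f1''} \<sigma>1 \<sigma>2 \<and> \<sigma>2 ''f1'' 0 = of_bool res"
      have e2: "\<sigma>2 ''v'' 0 = v" "\<sigma>2 ''wq'' 0 = v * n" "\<sigma>2 ''tsz'' 0 = card u" "\<sigma>2 ''x'' = \<sigma>1 ''x''"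
          "\<sigma>2 ''tm'' = \<sigma>1 ''tm''" "\<sigma>2 ''tp'' 0 = length ts * (r * s)" "\<sigma>2 ''n'' 0 = n"
        using sameD[OF conjunct1[OF s2]] I1 sameD[OF s1] tp base_n[OF b1] by simp_all
      have s2': "same ?W \<sigma> \<sigma>2" by (rule same_trans[OF s1 conjunct1[OF s2]]) simp
      \<comment> \<open>Both branches write one bit at column \<open>v\<close> of the new row; this
        treats them together.\<close>
      have tm: "((\<sigma>1 ''tm'')(length ts * (r * s) + v := of_bool B)) m =
         (if length ts * (r * s) \<le> m \<and> m < length ts * (r * s) + Suc v
          then of_bool (m - length ts * (r * s) \<in> U) else \<sigma> ''tm'' m)"
        if "(v \<in> U) = B" "\<And>w. w < v \<Longrightarrow> (w \<in> U) = (w \<in> u)" for m U B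
        using that by (auto simp: I1(5) less_Suc_eq)
      have bv: "bval (Less (Const 0) (V ''f1'')) \<sigma>2 = res" using s2 by simp
      have "dt (if bval (Less (Const 0) (V ''f1'')) \<sigma>2 then Seq (Fill ''x'' (Const 0) eraseE) (Assign ''tm'' (Plus (V ''tp'') (V ''v'')) (Const 0))
        else Seq (Incr ''tsz'' (Const 1)) (Assign ''tm'' (Plus (V ''tp'') (V ''v'')) (Const 1))) \<sigma>2 (4 * n + 8) 0 ?J"
      proof (cases res)
        case True
        have "dt (Seq (Fill ''x'' (Const 0) eraseE) (Assign ''tm'' (Plus (V ''tp'') (V ''v'')) (Const 0))) \<sigma>2 (Suc ((4 * n + 3) + 1)) (0 + 0) ?J"
        proof (rule dt_ht_Seq[OF dt_Fill[where o'=0 and g="\<lambda>i. of_bool (y' i)"]])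
          show "\<sigma>2 ''n'' 0 = n" by fact
          fix \<sigma>' i assume s': "same {''x'', ''j''} \<sigma>2 \<sigma>'" "\<sigma>' ''j'' 0 = i" "i < n" "\<sigma>' ''x'' (0 + i) = \<sigma>2 ''x'' (0 + i)"
          have "same {''q'', ''j'', ''f1'', ''x''} \<sigma>1 \<sigma>'" by (rule same_trans[OF conjunct1[OF s2] s'(1)]) simp
          then show "aval eraseE \<sigma>' = of_bool (y' i)" by (rule er) (use s' e2 in simp_all)
        next
          fix \<sigma>3 assume s3: "same {''x'', ''j''} \<sigma>2 \<sigma>3 \<and>
             (\<forall>m. \<sigma>3 ''x'' m = (if 0 \<le> m \<and> m < 0 + n then of_bool (y' (m - 0)) else \<sigma>2 ''x'' m))"
          have e3: "\<sigma>3 ''v'' 0 = v" "\<sigma>3 ''wq'' 0 = v * n" "\<sigma>3 ''tsz'' 0 = card u"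
             "\<sigma>3 ''tm'' = \<sigma>1 ''tm''" "\<sigma>3 ''tp'' 0 = length ts * (r * s)" "pointP ''x'' y' \<sigma>3"
            using sameD[OF conjunct1[OF s3]] e2 s3 by (simp_all add: pointP_def)
          have s3': "same ?W \<sigma> \<sigma>3" by (rule same_trans[OF s2' conjunct1[OF s3]]) simp
          have tm0: "((\<sigma>1 ''tm'')(length ts * (r * s) + v := 0)) m =
             (if length ts * (r * s) \<le> m \<and> m < length ts * (r * s) + Suc v
              then of_bool (m - length ts * (r * s) \<in> u) else \<sigma> ''tm'' m)" for m
            using tm[of u False m] vu by simp
          show "dt (Assign ''tm'' (Plus (V ''tp'') (V ''v'')) (Const 0)) \<sigma>3 1 0 ?J"
            unfolding L if_P[OF True] fst_conv snd_conv
          proof (rule dt_Assign, intro conjI, goal_cases)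
            case 1 show ?case by (intro same_put s3') simp
          next
            case 5 show ?case using e3(6) by (simp add: put_apply pointP_def)
          next
            case 6 show ?case using tm0 by (simp add: put_apply e3)
          qed (simp_all add: put_apply e3)
        qed simp_all
        then show ?thesis unfolding bv if_P[OF True] by (rule ht_mono) (assumption | simp)+
      next
        case False
        have tm1: "((\<sigma>1 ''tm'')(length ts * (r * s) + v := 1)) m =
             (if length ts * (r * s) \<le> m \<and> m < length ts * (r * s) + Suc v
              then of_bool (m - length ts * (r * s) \<in> insert v u) else \<sigma> ''tm'' m)" for m
          using tm[of "insert v u" True m] by simp
        have "dt (Seq (Incr ''tsz'' (Const 1)) (Assign ''tm'' (Plus (V ''tp'') (V ''v'')) (Const 1))) \<sigma>2 (1 + 2) 0 ?J"
          unfolding L if_not_P[OF False] fst_conv snd_conv Incr_def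
        proof (rule dt_Assign_Seq, rule dt_Assign, intro conjI, goal_cases)
          case 1 show ?case by (intro same_put s2') simp_all
        next
          case 5 show ?case using I1(4) by (simp add: put_apply pointP_def e2)
        next
          case 6 show ?case using tm1 by (simp add: put_apply e2)
        qed (simp_all add: put_apply e2 u_card)
        then show ?thesis unfolding bv if_not_P[OF False] by (rule ht_mono) (assumption | simp)+
      qed
      then show "dt ?C \<sigma>2 (Suc (4 * n + 8)) 0 ?J" by (rule ht_Cond)
    next
      fix \<sigma>2 \<sigma>3 assume J: "?J \<sigma>3"
      have n3: "\<sigma>3 ''n'' 0 = n" using sameD[OF conjunct1[OF J], of "''n''"] base_n[OF b] by simp
      show "dt (Incr ''wq'' (V ''n'')) \<sigma>3 1 0 (\<lambda>\<sigma>'. \<sigma>' ''v'' 0 = v \<and> ?I (Suc v) (put ''v'' 0 (Suc v) \<sigma>'))"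
        unfolding Incr_def
      proof (rule dt_Assign, intro conjI, goal_cases)
        case 2 show ?case by (intro same_put conjunct1[OF J]) simp_all
      next
        case 6 show ?case using J by (simp add: put_apply pointP_def del: learn.simps)
      next
        case 7 show ?case using J by (simp add: put_apply del: learn.simps)
      qed (use J n3 in \<open>simp_all add: put_apply del: learn.simps\<close>)
    qed
    show ?case by (rule ht_mono[OF body]) simp_all
  qed
  then show ?thesis
  proof (rule ht_mono)
    fix \<sigma>' assume I: "?I (length cs) \<sigma>'"
    have "termsP cs (ts @ [t]) \<sigma>''" if s'': "same {''nt''} \<sigma>' \<sigma>''" "\<sigma>'' ''nt'' 0 = Suc (length ts)" for \<sigma>''
      unfolding termsP_def
    proof (intro conjI allI impI)
      fix u v assume u: "u < length (ts @ [t])" and v: "v < length cs"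
      have tm: "\<sigma>'' ''tm'' = \<sigma>' ''tm''" using sameD[OF s''(1)] by simp
      show "\<sigma>'' ''tm'' (u * (r * s) + v) = of_bool (v \<in> (ts @ [t]) ! u)"
      proof (cases "u < length ts")
        case True
        \<comment> \<open>Column indices stay below the row width because there are at most
          \<open>r * s\<close> slots, so the earlier rows are untouched.\<close>
        have "u * (r * s) + v < Suc u * (r * s)" using v len by simp
        also have "\<dots> \<le> length ts * (r * s)" using True by (intro mult_le_mono1) simp
        finally have "\<sigma>'' ''tm'' (u * (r * s) + v) = \<sigma> ''tm'' (u * (r * s) + v)" using I tm by simp
        then show ?thesis using T True v by (simp add: termsP_def nth_append)
      next
        case False
        then have "u = length ts" using u by simp
        then show ?thesis using I tm v by (simp add: t)
      qed
    qed (use s'' in simp)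
    then show "same ?W \<sigma> \<sigma>' \<and> \<sigma>' ''tsz'' 0 = card t \<and>
        (\<forall>\<sigma>''. same {''nt''} \<sigma>' \<sigma>'' \<longrightarrow> \<sigma>'' ''nt'' 0 = Suc (length ts) \<longrightarrow> termsP cs (ts @ [t]) \<sigma>'')"
      using I t by blast
  qed (simp_all add: algebra_simps)
qed

end

section \<open>One round of each of the two sample loops\<close>

definition BodyA :: com where
  "BodyA = Seq (Sample ''x'') (Seq (QF ''fx'' (Elem ''x'' (V ''j''))) (Seq (QF ''f0'' (hybE (Elem ''x'' (V ''j'')) (Const 0)))
     (Cond (Less (Const 0) (eqE (V ''fx'') (V ''f0''))) (Incr ''cnt'' (Const 1))
        (Seq Search (Cond (Less (V ''nb'') (V ''k'')) (Seq Add_slot (Set ''cnt'' (Const 0))) (Set ''ok'' (Const 0)))))))"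

definition Update :: com where
  "Update = Seq Learn (Cond (Conj (Neg (Less (V ''r'') (V ''tsz''))) (Less (V ''nt'') (V ''s'')))
     (Seq (Incr ''nt'' (Const 1)) (Set ''cnt'' (Const 0))) (Set ''ok'' (Const 0)))"

definition BodyC :: com where
  "BodyC = Seq (Sample ''x'') (Seq Eval_slots (Seq Eval_terms (Seq (QF ''f0'' (hybE (Elem ''x'' (V ''j'')) (Const 0)))
     (Cond (Less (V ''oke'') (Const 1)) (Set ''ok'' (Const 0))
       (Cond (Less (Const 0) (eqE (V ''f0'') (V ''h''))) (Incr ''cnt'' (Const 1))
         (Cond (Less (Const 0) (V ''h'')) (Set ''ok'' (Const 0)) Update))))))"

context machine
begin

lemma dt_hyb0:
  assumes b: "base p \<sigma>" and S: "slotsP cs \<sigma>" and x: "pointP ''x'' x \<sigma>"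
  shows "dt (QF ''f0'' (hybE (Elem ''x'' (V ''j'')) (Const 0))) \<sigma> (4 * n + 5) 1
     (\<lambda>\<sigma>'. same {''q'', ''j'', ''f0''} \<sigma> \<sigma>' \<and> \<sigma>' ''f0'' 0 = of_bool (ask (hyb p (fst ` set cs) 0 x)))"
proof (rule dt_QF_base[OF b])
  fix \<sigma>' i assume s: "same {''q'', ''j''} \<sigma> \<sigma>'" "\<sigma>' ''j'' 0 = i" "i < n"
  show "aval (hybE (Elem ''x'' (V ''j'')) (Const 0)) \<sigma>' = of_bool (hyb p (fst ` set cs) 0 x i)"
  proof (rule aval_hyb[where \<sigma>=\<sigma>', OF _ _ s(2,3)])
    show "base p \<sigma>'" by (rule base_same[OF b s(1)]) simp
    show "slotsP cs \<sigma>'" by (rule slotsP_same[OF S s(1)]) simp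
    show "aval (Elem ''x'' (V ''j'')) \<sigma>' = of_bool (x i)"
      by (rule aval_point[where \<sigma>=\<sigma>', OF pointP_same[OF x s(1)] s(2,3)]) simp
  qed simp
qed

lemma dt_Search:
  assumes b: "base p \<sigma>" and S: "slotsP cs \<sigma>" and x: "pointP ''x'' x \<sigma>"
    and f0: "\<sigma> ''f0'' 0 = of_bool (ask (hyb p (fst ` set cs) 0 x))"
  shows "dt Search \<sigma> (10 + l * (4 * n + 20)) l
     (\<lambda>\<sigma>'. same {''lo'', ''i'', ''po'', ''q'', ''j'', ''fh''} \<sigma> \<sigma>' \<and> \<sigma>' ''lo'' 0 = bsearch p (fst ` set cs) x l 0)"
proof -
  let ?W = "{''lo'', ''i'', ''po'', ''q'', ''j'', ''fh''}"
  let ?B = "bsearch p (fst ` set cs) x"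
  \<comment> \<open>The invariant says that the search continued from the present \<open>lo\<close>
    ends where the whole search ends.\<close>
  let ?I = "\<lambda>i \<sigma>'. same ?W \<sigma> \<sigma>' \<and> \<sigma>' ''i'' 0 = i \<and> ?B (l - i) (\<sigma>' ''lo'' 0) = ?B l 0"
  have "dt Search \<sigma> (3 + l * ((4 * n + 10) + 3) + 2) (l * 1) (?I l)"
    unfolding Search_def
  proof (rule dt_Assign_Seq, rule ht_For_dt[where I="?I"], goal_cases)
    case 1
    show ?case by (intro conjI same_put same_refl) (simp_all add: put_apply)
  next
    case (2 i \<sigma>1)
    then have "base p \<sigma>1" using base_same[OF b, of ?W \<sigma>1] by simp
    then show ?case by (simp add: base_def)
  next
    case (3 i \<sigma>1)
    then show ?case by simp
  next
    case (4 i \<sigma>1)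
    note I = 4(2)
    define h where "h = (\<lambda>t. ask (hyb p (fst ` set cs) t x))"
    define lo where "lo = \<sigma>1 ''lo'' 0"
    have b1: "base p \<sigma>1" by (rule base_same[OF b conjunct1[OF I]]) simp
    define \<sigma>2 where "\<sigma>2 = put ''po'' 0 (2 ^ (l - Suc i)) \<sigma>1"
    have po: "aval (Elem ''pow'' (Minus (V ''l'') (Plus (V ''i'') (Const 1)))) \<sigma>1 = 2 ^ (l - Suc i)"
      using b1 I by (simp add: base_def)
    have s2: "same ?W \<sigma> \<sigma>2" unfolding \<sigma>2_def by (rule same_put[OF conjunct1[OF I]]) simp
    have v2: "\<sigma>2 ''lo'' 0 = lo" "\<sigma>2 ''po'' 0 = 2 ^ (l - Suc i)" "\<sigma>2 ''i'' 0 = i"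
      using I by (simp_all add: \<sigma>2_def put_apply lo_def)
    have b2: "base p \<sigma>2" by (rule base_same[OF b s2]) simp
    have Q: "dt (QF ''fh'' (hybE (Elem ''x'' (V ''j'')) (Plus (V ''lo'') (V ''po'')))) \<sigma>2 (4 * n + 5) 1
       (\<lambda>\<sigma>'. same {''q'', ''j'', ''fh''} \<sigma>2 \<sigma>' \<and> \<sigma>' ''fh'' 0 = of_bool (h (lo + 2 ^ (l - Suc i))))"
      unfolding h_def
    proof (rule dt_QF_base[OF b2])
      fix \<sigma>' m assume s: "same {''q'', ''j''} \<sigma>2 \<sigma>'" "\<sigma>' ''j'' 0 = m" "m < n"
      have s': "same ?W \<sigma> \<sigma>'" by (rule same_trans[OF s2 s(1)]) simp
      show "aval (hybE (Elem ''x'' (V ''j'')) (Plus (V ''lo'') (V ''po''))) \<sigma>' =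
          of_bool (hyb p (fst ` set cs) (lo + 2 ^ (l - Suc i)) x m)"
      proof (rule aval_hyb[where \<sigma>=\<sigma>', OF _ _ s(2,3)])
        show "base p \<sigma>'" by (rule base_same[OF b2 s(1)]) simp
        show "slotsP cs \<sigma>'" by (rule slotsP_same[OF S s']) simp
        show "aval (Elem ''x'' (V ''j'')) \<sigma>' = of_bool (x m)"
          by (rule aval_point[where \<sigma>=\<sigma>', OF pointP_same[OF x s'] s(2,3)]) simp
        show "aval (Plus (V ''lo'') (V ''po'')) \<sigma>' = lo + 2 ^ (l - Suc i)"
          using sameD[OF s(1)] v2 by simp
      qed
    qed
    have li: "l - i = Suc (l - Suc i)" using 4(1) by simp
    have inv: "?B (l - Suc i) (if h (lo + 2 ^ (l - Suc i)) = h 0 then lo + 2 ^ (l - Suc i) else lo) = ?B l 0"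
      using I unfolding li bsearch.simps h_def lo_def by blast
    have "dt (Seq (Set ''po'' (Elem ''pow'' (Minus (V ''l'') (Plus (V ''i'') (Const 1)))))
     (Seq (QF ''fh'' (hybE (Elem ''x'' (V ''j'')) (Plus (V ''lo'') (V ''po''))))
       (Cond (Less (Const 0) (eqE (V ''fh'') (V ''f0''))) (Incr ''lo'' (V ''po'')) Skip))) \<sigma>1
       (Suc ((4 * n + 5) + Suc 1) + 2) (1 + 0) (\<lambda>\<sigma>'. \<sigma>' ''i'' 0 = i \<and> ?I (Suc i) (put ''i'' 0 (Suc i) \<sigma>'))"
    proof (rule dt_Assign_Seq, unfold po aval.simps(1) \<sigma>2_def[symmetric], rule dt_ht_Seq[OF Q], rule ht_Cond)
      fix \<sigma>3 assume s3: "same {''q'', ''j'', ''fh''} \<sigma>2 \<sigma>3 \<and> \<sigma>3 ''fh'' 0 = of_bool (h (lo + 2 ^ (l - Suc i)))"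
      have s3': "same ?W \<sigma> \<sigma>3" by (rule same_trans[OF s2 conjunct1[OF s3]]) simp
      have v3: "\<sigma>3 ''f0'' 0 = of_bool (h 0)" "\<sigma>3 ''lo'' 0 = lo" "\<sigma>3 ''po'' 0 = 2 ^ (l - Suc i)" "\<sigma>3 ''i'' 0 = i"
        using sameD[OF s3', of "''f0''"] f0 sameD[OF conjunct1[OF s3]] v2 by (simp_all add: h_def)
      let ?c = "h (lo + 2 ^ (l - Suc i)) = h 0"
      have bv: "bval (Less (Const 0) (eqE (V ''fh'') (V ''f0''))) \<sigma>3 \<longleftrightarrow> ?c"
        using s3 v3 by (simp add: aval_eqE)
      show "dt (if bval (Less (Const 0) (eqE (V ''fh'') (V ''f0''))) \<sigma>3 then Incr ''lo'' (V ''po'') else Skip) \<sigma>3 1 0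
        (\<lambda>\<sigma>'. \<sigma>' ''i'' 0 = i \<and> ?I (Suc i) (put ''i'' 0 (Suc i) \<sigma>'))"
      proof (cases ?c)
        case True
        show ?thesis unfolding bv if_P[OF True] Incr_def
          by (rule dt_Assign, intro conjI same_put s3') (use inv True in \<open>simp_all add: put_apply v3\<close>)
      next
        case False
        show ?thesis unfolding bv if_not_P[OF False]
          by (rule dt_Skip, intro conjI same_put s3') (use inv False in \<open>simp_all add: put_apply v3\<close>)
      qed
    qed
    then show ?case by (rule ht_mono) simp_all
  qed
  then show ?thesis by (rule ht_mono) (simp_all add: algebra_simps)
qed

lemma dt_Add_slot:
  assumes b: "base p \<sigma>" and S: "slotsP cs \<sigma>" and x: "pointP ''x'' x \<sigma>"
    and f0: "\<sigma> ''f0'' 0 = of_bool (ask (hyb p (fst ` set cs) 0 x))"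
    and lo: "\<sigma> ''lo'' 0 = bsearch p (fst ` set cs) x l 0"
  shows "dt Add_slot \<sigma> (4 * n + 20) 0
     (\<lambda>\<sigma>'. same ({''j''} \<union> varsS) \<sigma> \<sigma>' \<and> slotsP (cs @ [newslot p (fst ` set cs) l x]) \<sigma>')"
proof -
  define B where "B = bsearch p (fst ` set cs) x l 0"
  define a where "a = ask (hyb p (fst ` set cs) 0 x)"
  define w where "w = hyb p (fst ` set cs) (B + of_bool a) x"
  have new: "newslot p (fst ` set cs) l x = (B, w)"
    by (simp add: newslot_def B_def a_def w_def Let_def)
  define m where "m = length cs"
  have S0: "\<sigma> ''nb'' 0 = m" "\<sigma> ''wp'' 0 = m * n" "\<And>v. v < m \<Longrightarrow> \<sigma> ''bl'' v = fst (cs ! v)"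
     "\<And>v j. v < m \<Longrightarrow> j < n \<Longrightarrow> \<sigma> ''w'' (v * n + j) = of_bool (snd (cs ! v) j)"
     "\<And>B. \<sigma> ''kn'' B = of_bool (B \<in> fst ` set cs)"
    using S by (auto simp: slotsP_def m_def)
  define \<sigma>1 where "\<sigma>1 = put ''bl'' m B \<sigma>"
  have s1: "same {''bl''} \<sigma> \<sigma>1" unfolding \<sigma>1_def by (intro same_put same_refl) simp
  have b1: "base p \<sigma>1" by (rule base_same[OF b s1]) simp
  have F: "dt (Fill ''w'' (V ''wp'') (hybE (Elem ''x'' (V ''j'')) (Plus (V ''lo'') (V ''f0'')))) \<sigma>1 (4 * n + 3) 0
     (\<lambda>\<sigma>'. same {''w'', ''j''} \<sigma>1 \<sigma>' \<and> (\<forall>i. \<sigma>' ''w'' i = (if m * n \<le> i \<and> i < m * n + n then of_bool (w (i - m * n)) else \<sigma>1 ''w'' i)))"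
  proof (rule dt_Fill, goal_cases)
    case 1 show ?case by (rule base_n[OF b1])
  next
    case 2 show ?case by simp
  next
    case (3 \<sigma>') then show ?case using sameD[OF 3] S0 by (simp add: \<sigma>1_def put_apply)
  next
    case (4 \<sigma>' i)
    have s: "same {''bl'', ''w'', ''j''} \<sigma> \<sigma>'" by (rule same_trans[OF s1 4(1)]) simp
    have e: "\<sigma>' ''pi'' = \<sigma> ''pi''" "\<sigma>' ''kn'' = \<sigma> ''kn''" "\<sigma>' ''x'' = \<sigma> ''x''" "\<sigma>' ''lo'' 0 = B" "\<sigma>' ''f0'' 0 = of_bool a"
      using sameD[OF s] lo f0 by (simp_all add: B_def a_def)
    have "aval (hybE (Elem ''x'' (V ''j'')) (Plus (V ''lo'') (V ''f0''))) \<sigma>' =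
        of_bool (x i \<and> (p i \<in> fst ` set cs \<or> p i < aval (Plus (V ''lo'') (V ''f0'')) \<sigma>'))"
      by (rule aval_hybE) (use e 4(2,3) x b S0 in \<open>simp_all add: pointP_def base_def\<close>)
    then show ?case by (simp add: w_def hyb_def e)
  qed
  have "dt Add_slot \<sigma> (Suc ((4 * n + 3) + (1 + 2 + 2)) + 2) (0 + 0)
     (\<lambda>\<sigma>'. same ({''j''} \<union> varsS) \<sigma> \<sigma>' \<and> slotsP (cs @ [(B, w)]) \<sigma>')"
    unfolding Add_slot_def
  proof (rule dt_Assign_Seq, rule dt_ht_Seq)
    show "dt (Fill ''w'' (V ''wp'') (hybE (Elem ''x'' (V ''j'')) (Plus (V ''lo'') (V ''f0''))))
      (put ''bl'' (aval (V ''nb'') \<sigma>) (aval (V ''lo'') \<sigma>) \<sigma>) (4 * n + 3) 0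
      (\<lambda>\<sigma>'. same {''w'', ''j''} \<sigma>1 \<sigma>' \<and> (\<forall>i. \<sigma>' ''w'' i = (if m * n \<le> i \<and> i < m * n + n then of_bool (w (i - m * n)) else \<sigma>1 ''w'' i)))"
      using F by (simp add: \<sigma>1_def S0 lo B_def)
  next
    fix \<sigma>2 assume s2: "same {''w'', ''j''} \<sigma>1 \<sigma>2 \<and>
       (\<forall>i. \<sigma>2 ''w'' i = (if m * n \<le> i \<and> i < m * n + n then of_bool (w (i - m * n)) else \<sigma>1 ''w'' i))"
    have s2': "same ({''j''} \<union> varsS) \<sigma> \<sigma>2" by (rule same_trans[OF s1 conjunct1[OF s2]]) simp
    have v2: "\<sigma>2 ''bl'' = (\<sigma> ''bl'')(m := B)" "\<sigma>2 ''nb'' 0 = m" "\<sigma>2 ''wp'' 0 = m * n" "\<sigma>2 ''kn'' = \<sigma> ''kn''"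
       "\<sigma>2 ''lo'' 0 = B" "\<sigma>2 ''n'' 0 = n"
      using sameD[OF conjunct1[OF s2]] S0 lo base_n[OF b] by (simp_all add: \<sigma>1_def put_apply B_def)
    have w2: "\<sigma>2 ''w'' (v * n + j) = of_bool (snd ((cs @ [(B, w)]) ! v) j)" if "v < Suc m" "j < n" for v j
    proof (cases "v = m")
      case True
      then show ?thesis using s2 that by (simp add: m_def nth_append)
    next
      case False
      then have v: "v < m" using that by simp
      \<comment> \<open>Row \<open>v\<close> ends before the new row begins at
        \<open>m * n\<close>.\<close>
      have "v * n + j < Suc v * n" using that by simp
      also have "\<dots> \<le> m * n" using v by (intro mult_le_mono1) simp
      finally have "\<sigma>2 ''w'' (v * n + j) = \<sigma>1 ''w'' (v * n + j)" using s2 by simp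
      also have "\<dots> = \<sigma> ''w'' (v * n + j)" by (simp add: \<sigma>1_def put_apply)
      finally show ?thesis using S0(4)[OF v that(2)] v by (simp add: m_def nth_append)
    qed
    let ?\<sigma>3 = "put ''kn'' (aval (V ''lo'') \<sigma>2) (aval (Const 1) \<sigma>2) \<sigma>2"
    let ?\<sigma>4 = "put ''nb'' (aval (Const 0) ?\<sigma>3) (aval (Plus (V ''nb'') (Const 1)) ?\<sigma>3) ?\<sigma>3"
    let ?\<sigma>5 = "put ''wp'' (aval (Const 0) ?\<sigma>4) (aval (Plus (V ''wp'') (V ''n'')) ?\<sigma>4) ?\<sigma>4"
    have "same ({''j''} \<union> varsS) \<sigma> ?\<sigma>5" by (intro same_put s2') simp_all
    moreover have "slotsP (cs @ [(B, w)]) ?\<sigma>5"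
    proof -
      have "?\<sigma>5 ''nb'' 0 = Suc m" "?\<sigma>5 ''wp'' 0 = Suc m * n" "?\<sigma>5 ''bl'' = (\<sigma> ''bl'')(m := B)"
        "?\<sigma>5 ''w'' = \<sigma>2 ''w''" "?\<sigma>5 ''kn'' = (\<sigma> ''kn'')(B := 1)"
        by (simp_all add: put_apply v2)
      moreover have "((\<sigma> ''bl'')(m := B)) v = fst ((cs @ [(B, w)]) ! v)" if "v < Suc m" for v
        using that S0(3) by (auto simp: nth_append m_def less_Suc_eq)
      moreover have "((\<sigma> ''kn'')(B := 1)) B' = of_bool (B' \<in> fst ` set (cs @ [(B, w)]))" for B'
        using S0(5) by auto
      ultimately show ?thesis using w2 unfolding slotsP_def by (simp add: m_def)
    qed
    ultimately show "dt (Seq (Assign ''kn'' (V ''lo'') (Const 1)) (Seq (Incr ''nb'' (Const 1)) (Incr ''wp'' (V ''n'')))) \<sigma>2 (1 + 2 + 2) 0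
      (\<lambda>\<sigma>'. same ({''j''} \<union> varsS) \<sigma> \<sigma>' \<and> slotsP (cs @ [(B, w)]) \<sigma>')"
      unfolding Incr_def by (intro dt_Assign_Seq dt_Assign conjI)
  qed
  then show ?thesis unfolding new by (rule ht_mono) (assumption | simp)+
qed

text \<open>The clause on \<open>nt\<close> is carried along so that the second phase starts with an
  empty hypothesis.\<close>

definition invA :: "(nat \<Rightarrow> nat) \<Rightarrow> store \<Rightarrow> slots \<Rightarrow> bool" where
  "invA p \<sigma> cs \<longleftrightarrow> base p \<sigma> \<and> slotsP cs \<sigma> \<and> \<sigma> ''nt'' 0 = 0"

text \<open>Every round is charged with a full binary search, although only a discrepancy triggers
  one; this costs a logarithmic factor.\<close>

lemma ht_BodyA:
  assumes D: "set_pmf D \<subseteq> cube n" and inv: "invA p \<sigma> cs" and cnt: "\<sigma> ''cnt'' 0 = j" and ok: "\<sigma> ''ok'' 0 = 1"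
  shows "ht BodyA \<sigma> (20 * n + 80 + l * (4 * n + 20)) (l + 3) (stepA (r * s) l p cs)
     (\<lambda>\<sigma>' out. case out of
         Pass \<Rightarrow> invA p \<sigma>' cs \<and> \<sigma>' ''cnt'' 0 = Suc j \<and> \<sigma>' ''ok'' 0 = 1
       | Change cs' \<Rightarrow> invA p \<sigma>' cs' \<and> \<sigma>' ''cnt'' 0 = 0 \<and> \<sigma>' ''ok'' 0 = 1 \<and>
           length cs' = Suc (length cs) \<and> length cs' \<le> r * s
       | Rej \<Rightarrow> \<sigma>' ''ok'' 0 = 0)" (is "ht _ _ _ _ _ ?R")
proof -
  have b: "base p \<sigma>" and S: "slotsP cs \<sigma>" and nt: "\<sigma> ''nt'' 0 = 0" using inv by (simp_all add: invA_def)
  let ?Bs = "fst ` set cs"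
  let ?ts = "10 + l * (4 * n + 20)"
  have "ht BodyA \<sigma> (Suc (1 + Suc ((4 * n + 5) + Suc ((4 * n + 5) + Suc (Suc (?ts + Suc (Suc (4 * n + 20 + 1)))))))) (1 + (1 + (1 + (l + 0))))
     (stepA (r * s) l p cs) ?R"
    unfolding BodyA_def stepA_def
  proof (rule ht_map_Seq[OF ht_Sample[where R="\<lambda>\<sigma>' v. v \<in> set_pmf D \<and> \<sigma>' = put_point n ''x'' v \<sigma>"]])
    fix \<sigma>1 v assume "v \<in> set_pmf D \<and> \<sigma>1 = put_point n ''x'' v \<sigma>"
    then have v: "v \<in> cube n" and \<sigma>1: "\<sigma>1 = put_point n ''x'' v \<sigma>" using D by auto
    define x where "x = (!) v"
    define F where "F = ask (hyb p ?Bs 0 x)"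
    have s1: "same {''x''} \<sigma> \<sigma>1" unfolding \<sigma>1 by (intro same_put_point same_refl) simp
    have x1: "pointP ''x'' x \<sigma>1" by (simp add: pointP_def \<sigma>1 put_point_def x_def)
    have b1: "base p \<sigma>1" by (rule base_same[OF b s1]) simp
    have S1: "slotsP cs \<sigma>1" by (rule slotsP_same[OF S s1]) simp
    let ?out = "if ask x = F then Pass
        else if length cs < r * s then Change (cs @ [newslot p ?Bs l x]) else Rej"
    have Q: "dt (QF ''fx'' (Elem ''x'' (V ''j''))) \<sigma>1 (4 * n + 5) 1
       (\<lambda>\<sigma>'. same {''q'', ''j'', ''fx''} \<sigma>1 \<sigma>' \<and> \<sigma>' ''fx'' 0 = of_bool (ask x))"
    proof (rule dt_QF_base[OF b1])
      fix \<sigma>' i assume s: "same {''q'', ''j''} \<sigma>1 \<sigma>'" "\<sigma>' ''j'' 0 = i" "i < n"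
      show "aval (Elem ''x'' (V ''j'')) \<sigma>' = of_bool (x i)"
        by (rule aval_point[where \<sigma>=\<sigma>', OF pointP_same[OF x1 s(1)] s(2,3)]) simp
    qed
    show "dt (Seq (QF ''fx'' (Elem ''x'' (V ''j''))) (Seq (QF ''f0'' (hybE (Elem ''x'' (V ''j'')) (Const 0)))
     (Cond (Less (Const 0) (eqE (V ''fx'') (V ''f0''))) (Incr ''cnt'' (Const 1))
        (Seq Search (Cond (Less (V ''nb'') (V ''k'')) (Seq Add_slot (Set ''cnt'' (Const 0))) (Set ''ok'' (Const 0))))))) \<sigma>1
     (Suc ((4 * n + 5) + Suc ((4 * n + 5) + Suc (Suc (?ts + Suc (Suc (4 * n + 20 + 1))))))) (1 + (1 + (l + 0)))
     (\<lambda>\<sigma>'. ?R \<sigma>' (let x = (!) v; Bs = ?Bs in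
        if ask x = ask (hyb p Bs 0 x) then Pass
        else if length cs < r * s then Change (cs @ [newslot p Bs l x]) else Rej))"
      unfolding Let_def x_def[symmetric] F_def[symmetric]
    proof (rule dt_ht_Seq[OF Q])
      fix \<sigma>2 assume s2: "same {''q'', ''j'', ''fx''} \<sigma>1 \<sigma>2 \<and> \<sigma>2 ''fx'' 0 = of_bool (ask x)"
      have b2: "base p \<sigma>2" by (rule base_same[OF b1 conjunct1[OF s2]]) simp
      have S2: "slotsP cs \<sigma>2" by (rule slotsP_same[OF S1 conjunct1[OF s2]]) simp
      have x2: "pointP ''x'' x \<sigma>2" by (rule pointP_same[OF x1 conjunct1[OF s2]]) simp
      show "dt (Seq (QF ''f0'' (hybE (Elem ''x'' (V ''j'')) (Const 0)))
       (Cond (Less (Const 0) (eqE (V ''fx'') (V ''f0''))) (Incr ''cnt'' (Const 1))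
        (Seq Search (Cond (Less (V ''nb'') (V ''k'')) (Seq Add_slot (Set ''cnt'' (Const 0))) (Set ''ok'' (Const 0)))))) \<sigma>2
       (Suc ((4 * n + 5) + Suc (Suc (?ts + Suc (Suc (4 * n + 20 + 1)))))) (1 + (l + 0)) (\<lambda>\<sigma>'. ?R \<sigma>' ?out)"
      proof (rule dt_ht_Seq[OF dt_hyb0[OF b2 S2 x2]], rule ht_Cond)
        fix \<sigma>3 assume s3: "same {''q'', ''j'', ''f0''} \<sigma>2 \<sigma>3 \<and> \<sigma>3 ''f0'' 0 = of_bool (ask (hyb p ?Bs 0 x))"
        have b3: "base p \<sigma>3" by (rule base_same[OF b2 conjunct1[OF s3]]) simp
        have S3: "slotsP cs \<sigma>3" by (rule slotsP_same[OF S2 conjunct1[OF s3]]) simp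
        have x3: "pointP ''x'' x \<sigma>3" by (rule pointP_same[OF x2 conjunct1[OF s3]]) simp
        have v3: "\<sigma>3 ''fx'' 0 = of_bool (ask x)" "\<sigma>3 ''f0'' 0 = of_bool F" "\<sigma>3 ''cnt'' 0 = j" "\<sigma>3 ''ok'' 0 = 1" "\<sigma>3 ''nt'' 0 = 0"
          using s2 s3 sameD[OF conjunct1[OF s3]] sameD[OF conjunct1[OF s2]] sameD[OF s1] cnt ok nt
          by (simp_all add: F_def)
        have bv: "bval (Less (Const 0) (eqE (V ''fx'') (V ''f0''))) \<sigma>3 \<longleftrightarrow> ask x = F"
          using v3 by (simp add: aval_eqE)
        let ?else = "Seq Search (Cond (Less (V ''nb'') (V ''k'')) (Seq Add_slot (Set ''cnt'' (Const 0))) (Set ''ok'' (Const 0)))"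
        show "dt (if bval (Less (Const 0) (eqE (V ''fx'') (V ''f0''))) \<sigma>3 then Incr ''cnt'' (Const 1) else ?else) \<sigma>3
          (Suc (?ts + Suc (Suc (4 * n + 20 + 1)))) (l + 0) (\<lambda>\<sigma>'. ?R \<sigma>' ?out)"
        proof (cases "ask x = F")
          case True
          have "same {''cnt''} \<sigma>3 (put ''cnt'' 0 (Suc j) \<sigma>3)" by (intro same_put same_refl) simp
          then have "invA p (put ''cnt'' 0 (Suc j) \<sigma>3) cs"
            using base_same[OF b3] slotsP_same[OF S3] v3 by (simp add: invA_def put_apply)
          then have "dt (Incr ''cnt'' (Const 1)) \<sigma>3 1 0 (\<lambda>\<sigma>'. ?R \<sigma>' ?out)"
            unfolding Incr_def if_P[OF True] outcome.case by (intro dt_Assign) (simp add: v3 put_apply)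
          then show ?thesis unfolding bv if_P[OF True] by (rule ht_mono) (assumption | simp)+
        next
          case False
          show ?thesis unfolding bv if_not_P[OF False]
          proof (rule dt_ht_Seq[OF dt_Search[OF b3 S3 x3]], goal_cases)
            case 1 show ?case using s3 by blast
          next
            case (2 \<sigma>4)
            have b4: "base p \<sigma>4" by (rule base_same[OF b3 conjunct1[OF 2]]) simp
            have S4: "slotsP cs \<sigma>4" by (rule slotsP_same[OF S3 conjunct1[OF 2]]) simp
            have x4: "pointP ''x'' x \<sigma>4" by (rule pointP_same[OF x3 conjunct1[OF 2]]) simp
            have v4: "\<sigma>4 ''f0'' 0 = of_bool (ask (hyb p ?Bs 0 x))" "\<sigma>4 ''ok'' 0 = 1" "\<sigma>4 ''nt'' 0 = 0"
              using sameD[OF conjunct1[OF 2]] v3 by (simp_all add: F_def)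
            have bv4: "bval (Less (V ''nb'') (V ''k'')) \<sigma>4 \<longleftrightarrow> length cs < r * s"
              using b4 S4 by (simp add: base_def slotsP_def)
            show ?case
            proof (rule ht_Cond, cases "length cs < r * s")
              case True
              have "dt (if bval (Less (V ''nb'') (V ''k'')) \<sigma>4 then Seq Add_slot (Set ''cnt'' (Const 0)) else Set ''ok'' (Const 0)) \<sigma>4
                  (Suc (4 * n + 20 + 1)) (0 + 0) (\<lambda>\<sigma>'. ?R \<sigma>' (if length cs < r * s then Change (cs @ [newslot p ?Bs l x]) else Rej))"
                unfolding bv4 if_P[OF True] outcome.case
              proof (rule dt_ht_Seq[OF dt_Add_slot[OF b4 S4 x4 v4(1) conjunct2[OF 2]]])
                fix \<sigma>5 assume s5: "same ({''j''} \<union> varsS) \<sigma>4 \<sigma>5 \<and> slotsP (cs @ [newslot p ?Bs l x]) \<sigma>5"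
                have s6: "same {''cnt''} \<sigma>5 (put ''cnt'' 0 0 \<sigma>5)" by (intro same_put same_refl) simp
                have s6': "same ({''j'', ''cnt''} \<union> varsS) \<sigma>4 (put ''cnt'' 0 0 \<sigma>5)"
                  by (rule same_trans[OF conjunct1[OF s5] s6]) simp
                have "base p (put ''cnt'' 0 0 \<sigma>5)" by (rule base_same[OF b4 s6']) simp
                moreover have "slotsP (cs @ [newslot p ?Bs l x]) (put ''cnt'' 0 0 \<sigma>5)"
                  by (rule slotsP_same[OF conjunct2[OF s5] s6]) simp
                ultimately show "dt (Set ''cnt'' (Const 0)) \<sigma>5 1 0 (\<lambda>\<sigma>'. invA p \<sigma>' (cs @ [newslot p ?Bs l x]) \<and> \<sigma>' ''cnt'' 0 = 0 \<and> \<sigma>' ''ok'' 0 = 1 \<and>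
                   length (cs @ [newslot p ?Bs l x]) = Suc (length cs) \<and> length (cs @ [newslot p ?Bs l x]) \<le> r * s)"
                  using True sameD[OF conjunct1[OF s5]] v4 by (intro dt_Assign) (simp add: invA_def put_apply)
              qed
              then show "dt (if bval (Less (V ''nb'') (V ''k'')) \<sigma>4 then Seq Add_slot (Set ''cnt'' (Const 0)) else Set ''ok'' (Const 0)) \<sigma>4
                  (Suc (4 * n + 20 + 1)) 0 (\<lambda>\<sigma>'. ?R \<sigma>' (if length cs < r * s then Change (cs @ [newslot p ?Bs l x]) else Rej))"
                by (simp only: add_0_right)
            next
              case False
              have "dt (Set ''ok'' (Const 0)) \<sigma>4 1 0 (\<lambda>\<sigma>'. \<sigma>' ''ok'' 0 = 0)"
                by (rule dt_Assign) (simp add: put_apply)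
              then show "dt (if bval (Less (V ''nb'') (V ''k'')) \<sigma>4 then Seq Add_slot (Set ''cnt'' (Const 0)) else Set ''ok'' (Const 0)) \<sigma>4
                  (Suc (4 * n + 20 + 1)) 0 (\<lambda>\<sigma>'. ?R \<sigma>' (if length cs < r * s then Change (cs @ [newslot p ?Bs l x]) else Rej))"
                unfolding bv4 if_not_P[OF False] outcome.case by (rule ht_mono) (assumption | simp)+
            qed
          qed
        qed
      qed
    qed
  qed simp
  then show ?thesis by (rule ht_mono) (assumption | simp)+
qed

end

context machine
begin

definition invC :: "(nat \<Rightarrow> nat) \<Rightarrow> slots \<Rightarrow> store \<Rightarrow> nat set list \<Rightarrow> bool" where
  "invC p cs \<sigma> ts \<longleftrightarrow> base p \<sigma> \<and> slotsP cs \<sigma> \<and> termsP cs ts \<sigma> \<and> (\<forall>t\<in>set ts. t \<subseteq> {..<length cs})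
     \<and> length ts \<le> s"

lemma dt_Update:
  assumes b: "base p \<sigma>" and S: "slotsP cs \<sigma>" and T: "termsP cs ts \<sigma>" and x: "pointP ''x'' x \<sigma>"
    and ts: "\<forall>t\<in>set ts. t \<subseteq> {..<length cs}" and tp: "\<sigma> ''tp'' 0 = length ts * (r * s)"
    and len: "length cs \<le> r * s" and ok: "\<sigma> ''ok'' 0 = 1"
    and t: "t = snd (learn p cs x (length cs))"
  shows "dt Update \<sigma> (20 + length cs * (8 * n + 30)) (length cs)
     (\<lambda>\<sigma>'. if card t \<le> r \<and> length ts < s then invC p cs \<sigma>' (ts @ [t]) \<and> \<sigma>' ''cnt'' 0 = 0 \<and> \<sigma>' ''ok'' 0 = 1
        else \<sigma>' ''ok'' 0 = 0)" (is "dt _ _ _ _ ?R")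
proof -
  let ?W = "{''tsz'', ''wq'', ''v'', ''q'', ''j'', ''f1'', ''x'', ''tm''}"
  have "dt Update \<sigma> (Suc ((10 + length cs * (8 * n + 30)) + Suc 3)) (length cs + 0) ?R"
    unfolding Update_def
  proof (rule dt_ht_Seq[OF dt_Learn[OF b S T x tp len t]], rule ht_Cond)
    fix \<sigma>1 assume s1: "same ?W \<sigma> \<sigma>1 \<and> \<sigma>1 ''tsz'' 0 = card t \<and>
        (\<forall>\<sigma>''. same {''nt''} \<sigma>1 \<sigma>'' \<longrightarrow> \<sigma>'' ''nt'' 0 = Suc (length ts) \<longrightarrow> termsP cs (ts @ [t]) \<sigma>'')"
    have b1: "base p \<sigma>1" by (rule base_same[OF b conjunct1[OF s1]]) simp
    have S1: "slotsP cs \<sigma>1" by (rule slotsP_same[OF S conjunct1[OF s1]]) simp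
    have v1: "\<sigma>1 ''nt'' 0 = length ts" "\<sigma>1 ''ok'' 0 = 1"
      using sameD[OF conjunct1[OF s1]] T ok by (simp_all add: termsP_def)
    let ?b = "Conj (Neg (Less (V ''r'') (V ''tsz''))) (Less (V ''nt'') (V ''s''))"
    have bv: "bval ?b \<sigma>1 \<longleftrightarrow> card t \<le> r \<and> length ts < s"
      using b1 s1 v1 by (simp add: base_def not_less)
    show "dt (if bval ?b \<sigma>1 then Seq (Incr ''nt'' (Const 1)) (Set ''cnt'' (Const 0)) else Set ''ok'' (Const 0)) \<sigma>1 3 0 ?R"
    proof (cases "card t \<le> r \<and> length ts < s")
      case True
      define \<sigma>2 where "\<sigma>2 = put ''nt'' 0 (Suc (length ts)) \<sigma>1"
      define \<sigma>3 where "\<sigma>3 = put ''cnt'' 0 0 \<sigma>2"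
      have s2: "same {''nt''} \<sigma>1 \<sigma>2" unfolding \<sigma>2_def by (intro same_put same_refl) simp
      have s3: "same {''cnt''} \<sigma>2 \<sigma>3" unfolding \<sigma>3_def by (intro same_put same_refl) simp
      have s23: "same {''nt'', ''cnt''} \<sigma>1 \<sigma>3" by (rule same_trans[OF s2 s3]) simp
      have "termsP cs (ts @ [t]) \<sigma>2" using s1 s2 by (simp add: \<sigma>2_def put_apply)
      then have "termsP cs (ts @ [t]) \<sigma>3" by (rule termsP_same[OF _ s3]) simp
      moreover have "base p \<sigma>3" by (rule base_same[OF b1 s23]) simp
      moreover have "slotsP cs \<sigma>3" by (rule slotsP_same[OF S1 s23]) simp
      moreover have "t \<subseteq> {..<length cs}" unfolding t by (rule learn_slots)
      ultimately have i3: "invC p cs \<sigma>3 (ts @ [t])" using ts True by (simp add: invC_def)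
      have "dt (Seq (Incr ''nt'' (Const 1)) (Set ''cnt'' (Const 0))) \<sigma>1 (1 + 2) 0
         (\<lambda>\<sigma>'. invC p cs \<sigma>' (ts @ [t]) \<and> \<sigma>' ''cnt'' 0 = 0 \<and> \<sigma>' ''ok'' 0 = 1)"
        unfolding Incr_def
        by (rule dt_Assign_Seq, rule dt_Assign)
           (use i3 v1 in \<open>simp add: \<sigma>3_def \<sigma>2_def, simp add: put_apply\<close>)
      then show ?thesis unfolding bv if_P[OF True] by (rule ht_mono) (assumption | simp)+
    next
      case False
      have "dt (Set ''ok'' (Const 0)) \<sigma>1 1 0 (\<lambda>\<sigma>'. \<sigma>' ''ok'' 0 = 0)"
        by (rule dt_Assign) (simp add: put_apply)
      then show ?thesis unfolding bv if_not_P[OF False] by (rule ht_mono) (assumption | simp)+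
    qed
  qed
  then show ?thesis by (rule ht_mono) (assumption | simp)+
qed

text \<open>The bounds use \<open>r * s\<close> and \<open>s\<close> in place of the current numbers
  of slots and terms, which makes them uniform along the stream.\<close>

lemma ht_BodyC:
  assumes D: "set_pmf D \<subseteq> cube n" and inv: "invC p cs \<sigma> ts" and cnt: "\<sigma> ''cnt'' 0 = j" and ok: "\<sigma> ''ok'' 0 = 1"
    and len: "length cs \<le> r * s"
  shows "ht BodyC \<sigma> (60 + 4 * n + r * s * (l * (50 * n + 83) + 30) + s * (r * s * 4 + 20) + r * s * (8 * n + 30))
     (2 + r * s * (l * 7 + 1)) (stepC s r l p cs ts)
     (\<lambda>\<sigma>' out. case out of
         Pass \<Rightarrow> invC p cs \<sigma>' ts \<and> \<sigma>' ''cnt'' 0 = Suc j \<and> \<sigma>' ''ok'' 0 = 1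
       | Change ts' \<Rightarrow> invC p cs \<sigma>' ts' \<and> \<sigma>' ''cnt'' 0 = 0 \<and> \<sigma>' ''ok'' 0 = 1 \<and>
           length ts' = Suc (length ts) \<and> length ts' \<le> s
       | Rej \<Rightarrow> \<sigma>' ''ok'' 0 = 0)" (is "ht _ _ ?T ?Q _ ?R")
proof -
  have b: "base p \<sigma>" and S: "slotsP cs \<sigma>" and T: "termsP cs ts \<sigma>"
    and ts: "\<forall>t\<in>set ts. t \<subseteq> {..<length cs}" and lts: "length ts \<le> s" using inv by (simp_all add: invC_def)
  let ?Bs = "fst ` set cs"
  define m where "m = length cs"
  let ?te = "10 + m * (l * (50 * n + 83) + 30)"
  let ?tt = "10 + length ts * (m * 4 + 20)"
  let ?tu = "20 + m * (8 * n + 30)"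
  let ?dec = "Cond (Less (V ''oke'') (Const 1)) (Set ''ok'' (Const 0))
       (Cond (Less (Const 0) (eqE (V ''f0'') (V ''h''))) (Incr ''cnt'' (Const 1))
         (Cond (Less (Const 0) (V ''h'')) (Set ''ok'' (Const 0)) Update))"
  have main: "ht BodyC \<sigma> (Suc (1 + Suc (?te + Suc (?tt + Suc ((4 * n + 5) + Suc (Suc (Suc ?tu)))))))
     (1 + (m * (l * 7) + (0 + (1 + m)))) (stepC s r l p cs ts) ?R"
    unfolding BodyC_def stepC_def
  proof (rule ht_Seq[OF ht_Sample[where R="\<lambda>\<sigma>' v. v \<in> set_pmf D \<and> \<sigma>' = put_point n ''x'' v \<sigma>"]])
    fix \<sigma>1 v assume "v \<in> set_pmf D \<and> \<sigma>1 = put_point n ''x'' v \<sigma>"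
    then have v: "v \<in> cube n" and \<sigma>1: "\<sigma>1 = put_point n ''x'' v \<sigma>" using D by auto
    define x where "x = (!) v"
    define F where "F = ask (hyb p ?Bs 0 x)"
    define t where "t = snd (learn p cs x (length cs))"
    have s1: "same {''x''} \<sigma> \<sigma>1" unfolding \<sigma>1 by (intro same_put_point same_refl) simp
    have x1: "pointP ''x'' x \<sigma>1" by (simp add: pointP_def \<sigma>1 put_point_def x_def)
    have b1: "base p \<sigma>1" by (rule base_same[OF b s1]) simp
    have S1: "slotsP cs \<sigma>1" by (rule slotsP_same[OF S s1]) simp
    have T1: "termsP cs ts \<sigma>1" by (rule termsP_same[OF T s1]) simp
    let ?out = "\<lambda>e. if \<not> fst e then Rej
       else if F = holds ts (snd e) then Pass
       else if holds ts (snd e) then Rej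
       else if card t \<le> r \<and> length ts < s then Change (ts @ [t]) else Rej"
    show "ht (Seq Eval_slots (Seq Eval_terms (Seq (QF ''f0'' (hybE (Elem ''x'' (V ''j'')) (Const 0))) ?dec))) \<sigma>1
       (Suc (?te + Suc (?tt + Suc ((4 * n + 5) + Suc (Suc (Suc ?tu)))))) (m * (l * 7) + (0 + (1 + m)))
       (let x = (!) v in map_pmf (\<lambda>e.
         if \<not> fst e then Rej
         else if ask (hyb p ?Bs 0 x) = holds ts (snd e) then Pass
         else if holds ts (snd e) then Rej
         else let t = snd (learn p cs x (length cs)) in
           if card t \<le> r \<and> length ts < s then Change (ts @ [t]) else Rej) (evals l p cs x)) ?R"
      unfolding Let_def x_def[symmetric] F_def[symmetric] t_def[symmetric] m_def
    proof (rule ht_map_Seq[OF ht_Eval_slots[OF b1 S1 x1]])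
      fix \<sigma>2 e assume s2: "same varsEval \<sigma>1 \<sigma>2 \<and> \<sigma>2 ''oke'' 0 = of_bool (fst e) \<and> (\<forall>v<length cs. \<sigma>2 ''val'' v = of_bool (snd e v))"
      have b2: "base p \<sigma>2" by (rule base_same[OF b1 conjunct1[OF s2]]) simp
      have S2: "slotsP cs \<sigma>2" by (rule slotsP_same[OF S1 conjunct1[OF s2]]) simp
      have T2: "termsP cs ts \<sigma>2" by (rule termsP_same[OF T1 conjunct1[OF s2]]) simp
      have x2: "pointP ''x'' x \<sigma>2" by (rule pointP_same[OF x1 conjunct1[OF s2]]) simp
      have val2: "\<forall>v<length cs. \<sigma>2 ''val'' v = of_bool (snd e v)" using s2 by blast
      show "dt (Seq Eval_terms (Seq (QF ''f0'' (hybE (Elem ''x'' (V ''j'')) (Const 0))) ?dec)) \<sigma>2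
         (Suc (10 + length ts * (length cs * 4 + 20) + Suc ((4 * n + 5) + Suc (Suc (Suc (20 + length cs * (8 * n + 30)))))))
         (0 + (1 + length cs)) (\<lambda>\<sigma>'. ?R \<sigma>' (?out e))"
      proof (rule dt_ht_Seq[OF dt_Eval_terms[OF b2 S2 T2 ts val2]])
        let ?W3 = "{''h'', ''tp'', ''u'', ''to'', ''v''}"
        fix \<sigma>3 assume s3: "same ?W3 \<sigma>2 \<sigma>3 \<and> \<sigma>3 ''h'' 0 = of_bool (holds ts (snd e)) \<and> \<sigma>3 ''tp'' 0 = length ts * (r * s)"
        have b3: "base p \<sigma>3" by (rule base_same[OF b2 conjunct1[OF s3]]) simp
        have S3: "slotsP cs \<sigma>3" by (rule slotsP_same[OF S2 conjunct1[OF s3]]) simp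
        have T3: "termsP cs ts \<sigma>3" by (rule termsP_same[OF T2 conjunct1[OF s3]]) simp
        have x3: "pointP ''x'' x \<sigma>3" by (rule pointP_same[OF x2 conjunct1[OF s3]]) simp
        show "dt (Seq (QF ''f0'' (hybE (Elem ''x'' (V ''j'')) (Const 0))) ?dec) \<sigma>3
           (Suc ((4 * n + 5) + Suc (Suc (Suc (20 + length cs * (8 * n + 30)))))) (1 + length cs) (\<lambda>\<sigma>'. ?R \<sigma>' (?out e))"
        proof (rule dt_ht_Seq[OF dt_hyb0[OF b3 S3 x3]])
          fix \<sigma>4 assume s4: "same {''q'', ''j'', ''f0''} \<sigma>3 \<sigma>4 \<and> \<sigma>4 ''f0'' 0 = of_bool (ask (hyb p ?Bs 0 x))"
          have b4: "base p \<sigma>4" by (rule base_same[OF b3 conjunct1[OF s4]]) simp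
          have S4: "slotsP cs \<sigma>4" by (rule slotsP_same[OF S3 conjunct1[OF s4]]) simp
          have T4: "termsP cs ts \<sigma>4" by (rule termsP_same[OF T3 conjunct1[OF s4]]) simp
          have x4: "pointP ''x'' x \<sigma>4" by (rule pointP_same[OF x3 conjunct1[OF s4]]) simp
          have v4: "\<sigma>4 ''f0'' 0 = of_bool F" "\<sigma>4 ''h'' 0 = of_bool (holds ts (snd e))" "\<sigma>4 ''tp'' 0 = length ts * (r * s)"
            "\<sigma>4 ''oke'' 0 = of_bool (fst e)" "\<sigma>4 ''ok'' 0 = 1" "\<sigma>4 ''cnt'' 0 = j"
            using s4 s3 s2 sameD[OF conjunct1[OF s4]] sameD[OF conjunct1[OF s3]] sameD[OF conjunct1[OF s2]] sameD[OF s1] ok cnt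
            by (simp_all add: F_def)
          have rej: "dt (Set ''ok'' (Const 0)) \<sigma>4 1 0 (\<lambda>\<sigma>'. ?R \<sigma>' Rej)"
            unfolding outcome.case by (rule dt_Assign) (simp add: put_apply)
          have bv: "bval (Less (V ''oke'') (Const 1)) \<sigma>4 \<longleftrightarrow> \<not> fst e"
            "bval (Less (Const 0) (eqE (V ''f0'') (V ''h''))) \<sigma>4 \<longleftrightarrow> F = holds ts (snd e)"
            "bval (Less (Const 0) (V ''h'')) \<sigma>4 \<longleftrightarrow> holds ts (snd e)"
            using v4 by (simp_all add: aval_eqE)
          have upd: "dt (if bval (Less (Const 0) (V ''h'')) \<sigma>4 then Set ''ok'' (Const 0) else Update) \<sigma>4
             (20 + length cs * (8 * n + 30)) (length cs)
             (\<lambda>\<sigma>'. ?R \<sigma>' (if holds ts (snd e) then Rej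
               else if card t \<le> r \<and> length ts < s then Change (ts @ [t]) else Rej))"
          proof (cases "holds ts (snd e)")
            case True
            show ?thesis unfolding bv if_P[OF True] by (rule ht_mono[OF rej]) (assumption | simp)+
          next
            case False
            show ?thesis unfolding bv if_not_P[OF False]
            proof (rule ht_mono[OF dt_Update[OF b4 S4 T4 x4 ts v4(3) len v4(5) t_def]])
              fix \<sigma>5 assume "if card t \<le> r \<and> length ts < s then invC p cs \<sigma>5 (ts @ [t]) \<and> \<sigma>5 ''cnt'' 0 = 0 \<and> \<sigma>5 ''ok'' 0 = 1
                 else \<sigma>5 ''ok'' 0 = 0"
              then show "?R \<sigma>5 (if card t \<le> r \<and> length ts < s then Change (ts @ [t]) else Rej)"
                by (cases "card t \<le> r \<and> length ts < s") auto
            qed simp_all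
          qed
          have pass: "dt (if bval (Less (Const 0) (eqE (V ''f0'') (V ''h''))) \<sigma>4 then Incr ''cnt'' (Const 1)
               else Cond (Less (Const 0) (V ''h'')) (Set ''ok'' (Const 0)) Update) \<sigma>4
             (Suc (20 + length cs * (8 * n + 30))) (length cs)
             (\<lambda>\<sigma>'. ?R \<sigma>' (if F = holds ts (snd e) then Pass else if holds ts (snd e) then Rej
               else if card t \<le> r \<and> length ts < s then Change (ts @ [t]) else Rej))"
          proof (cases "F = holds ts (snd e)")
            case True
            have s5: "same {''cnt''} \<sigma>4 (put ''cnt'' 0 (Suc j) \<sigma>4)" by (intro same_put same_refl) simp
            have "invC p cs (put ''cnt'' 0 (Suc j) \<sigma>4) ts"
              using base_same[OF b4 s5] slotsP_same[OF S4 s5] termsP_same[OF T4 s5] ts lts by (simp add: invC_def)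
            then have "dt (Incr ''cnt'' (Const 1)) \<sigma>4 1 0 (\<lambda>\<sigma>'. ?R \<sigma>' Pass)"
              unfolding Incr_def outcome.case by (intro dt_Assign) (simp add: v4, simp add: v4 put_apply)
            then show ?thesis unfolding bv if_P[OF True] by (rule ht_mono) (assumption | simp)+
          next
            case False
            show ?thesis unfolding bv(2) if_not_P[OF False] by (rule ht_Cond[OF upd])
          qed
          show "dt ?dec \<sigma>4 (Suc (Suc (Suc (20 + length cs * (8 * n + 30))))) (length cs) (\<lambda>\<sigma>'. ?R \<sigma>' (?out e))"
          proof (rule ht_Cond, cases "\<not> fst e")
            case True
            show "dt (if bval (Less (V ''oke'') (Const 1)) \<sigma>4 then Set ''ok'' (Const 0)
               else Cond (Less (Const 0) (eqE (V ''f0'') (V ''h''))) (Incr ''cnt'' (Const 1))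
                 (Cond (Less (Const 0) (V ''h'')) (Set ''ok'' (Const 0)) Update)) \<sigma>4
               (Suc (Suc (20 + length cs * (8 * n + 30)))) (length cs) (\<lambda>\<sigma>'. ?R \<sigma>' (?out e))"
              unfolding bv(1) if_P[OF True] by (rule ht_mono[OF rej]) (assumption | simp)+
          next
            case False
            show "dt (if bval (Less (V ''oke'') (Const 1)) \<sigma>4 then Set ''ok'' (Const 0)
               else Cond (Less (Const 0) (eqE (V ''f0'') (V ''h''))) (Incr ''cnt'' (Const 1))
                 (Cond (Less (Const 0) (V ''h'')) (Set ''ok'' (Const 0)) Update)) \<sigma>4
               (Suc (Suc (20 + length cs * (8 * n + 30)))) (length cs) (\<lambda>\<sigma>'. ?R \<sigma>' (?out e))"
              unfolding bv(1) if_not_P[OF False] by (rule ht_Cond[OF pass])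
          qed
        qed
      qed
    qed
  qed simp
  have mk: "m \<le> r * s" using len by (simp add: m_def)
  show ?thesis
  proof (rule ht_mono[OF main])
    have "m * (l * (50 * n + 83) + 30) \<le> r * s * (l * (50 * n + 83) + 30)" "m * (8 * n + 30) \<le> r * s * (8 * n + 30)"
      by (rule mult_le_mono1[OF mk])+
    moreover have "length ts * (m * 4 + 20) \<le> s * (r * s * 4 + 20)" using mk lts by (intro mult_le_mono) auto
    ultimately show "Suc (1 + Suc (?te + Suc (?tt + Suc ((4 * n + 5) + Suc (Suc (Suc ?tu)))))) \<le> ?T" by linarith
    have "m * (l * 7 + 1) \<le> r * s * (l * 7 + 1)" by (rule mult_le_mono1[OF mk])
    then show "1 + (m * (l * 7) + (0 + (1 + m))) \<le> ?Q" by (simp add: algebra_simps)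
  qed
qed

end

section \<open>Computing the parameters, drawing the partition, and the whole program\<close>

definition Mul :: "string \<Rightarrow> aexp \<Rightarrow> aexp \<Rightarrow> com" where
  "Mul dst e1 e2 = Seq (Set dst (Const 0)) (For ''i'' e1 (Incr dst e2))"

text \<open>Rounded-up division by repeated addition. It takes about \<open>b / a\<close> rounds,
  which is polynomial in 1/\<epsilon> however large the two numbers are.\<close>

definition Inverse_eps :: com where
  "Inverse_eps = Seq (Set ''e'' (Const 0)) (Seq (Set ''acc'' (Const 0))
     (While (Less (V ''acc'') (Elem ''eps'' (Const 1)))
       (Seq (Incr ''acc'' (Elem ''eps'' (Const 0))) (Incr ''e'' (Const 1)))))"

text \<open>Doubling provides all powers up to \<open>2 ^ l\<close>, needed as search widths and for
  drawing block numbers, and finds \<open>l\<close> on the way.\<close>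

definition Powers :: com where
  "Powers = Seq (Set ''l'' (Const 0)) (Seq (Set ''pow'' (Const 1))
     (While (Less (Elem ''pow'' (V ''l'')) (V ''wt''))
       (Seq (Assign ''pow'' (Plus (V ''l'') (Const 1)) (Plus (Elem ''pow'' (V ''l'')) (Elem ''pow'' (V ''l''))))
         (Incr ''l'' (Const 1)))))"

definition Init :: com where
  "Init = Seq (Mul ''k'' (V ''r'') (V ''s'')) (Seq Inverse_eps
     (Seq (Set ''g'' (Plus (Plus (V ''k'') (V ''e'')) (Plus (V ''k'') (V ''e''))))
     (Seq (Mul ''wt'' (V ''g'') (V ''g'')) (Seq Powers
     (Seq (Mul ''el'' (V ''e'') (V ''l'')) (Mul ''N'' (Const 40) (V ''el'')))))))"

definition Partition :: com where
  "Partition = For ''i'' (V ''n'') (Seq (Set ''rv'' (Const 0))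
     (Seq (For ''j'' (V ''l'') (Seq (Flip ''c'')
        (Cond (Less (Const 0) (V ''c'')) (Incr ''rv'' (Elem ''pow'' (V ''j''))) Skip)))
      (Assign ''pi'' (V ''i'') (V ''rv''))))"

definition Loop :: "com \<Rightarrow> com" where
  "Loop c = While (Conj (Less (Elem ''cnt'' (Const 0)) (Elem ''N'' (Const 0))) (Less (Const 0) (Elem ''ok'' (Const 0)))) c"

text \<open>A fraction above 1 is handled apart: then \<epsilon> exceeds 1 and no function is far.
  In the main branch \<open>a\<close> is at most \<open>b\<close>, which bounds the rounded-up
  inverse by a multiple of 1/\<epsilon>.\<close>

definition Tester :: com where
  "Tester = Cond (Less (Elem ''eps'' (Const 1)) (Elem ''eps'' (Const 0))) (Set ''accept'' (Const 1))
     (Seq Init (Seq Partition (Seq (Set ''ok'' (Const 1)) (Seq (Set ''cnt'' (Const 0)) (Seq (Loop BodyA)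
       (Seq (Set ''cnt'' (Const 0)) (Seq (Loop BodyC) (Set ''accept'' (V ''ok'')))))))))"

definition inv_eps :: "nat \<Rightarrow> nat \<Rightarrow> nat" where
  "inv_eps a b = (LEAST e. b \<le> e * a)"

text \<open>For positive parameters with s \<le> k, the square of 2 (k + e) dominates 3 k^2 for
  collisions, 4 e k for misread literals and 3 (k + s + 2) for overlooked bad states. It is written
  with sums, as the program computes it.\<close>

definition level :: "nat \<Rightarrow> nat \<Rightarrow> nat" where
  "level k e = (LEAST l. (k + e + (k + e)) * (k + e + (k + e)) \<le> 2 ^ l)"

lemma level_least: "(k + e + (k + e)) * (k + e + (k + e)) \<le> 2 ^ level k e"
  unfolding level_def by (rule LeastI[of "\<lambda>l. _ \<le> 2 ^ l"]) (rule less_imp_le[OF less_exp])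

context oracles
begin

text \<open>For loops whose number of rounds is known to the proof but not to the program.\<close>

lemma dt_While_count:
  assumes "I 0 \<sigma>" "\<And>i \<sigma>. i < m \<Longrightarrow> I i \<sigma> \<Longrightarrow> bval b \<sigma> \<and> dt c \<sigma> t q (I (Suc i))"
    "\<And>\<sigma>. I m \<sigma> \<Longrightarrow> \<not> bval b \<sigma>"
  shows "dt (While b c) \<sigma> (1 + m * (t + 1)) (m * q) (I m)"
proof -
  have "dt (While b c) \<sigma> (1 + k * (t + 1)) (k * q) (I m)" if "I i \<sigma>" "i + k = m" for k i \<sigma>
    using that
  proof (induction k arbitrary: i \<sigma>)
    case 0
    then show ?case using assms(3) by (simp add: ht_While_False)
  next
    case (Suc k)
    have i: "i < m" using Suc.prems by simp
    have "dt (While b c) \<sigma> (Suc (t + (1 + k * (t + 1)))) (q + k * q) (I m)"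
      using ht_While_True[where B="\<lambda>_. return_pmf ()", OF conjunct1[OF assms(2)[OF i Suc.prems(1)]] conjunct2[OF assms(2)[OF i Suc.prems(1)]]
          Suc.IH[of "Suc i"]] Suc.prems(2) by (simp add: bind_return_pmf)
    then show ?case by (rule ht_mono) (assumption | simp)+
  qed
  from this[of 0 \<sigma> m] show ?thesis using assms(1) by simp
qed

lemma dt_Mul:
  assumes "\<And>\<sigma>'. same {dst, ''i''} \<sigma> \<sigma>' \<Longrightarrow> aval e1 \<sigma>' = A" "\<And>\<sigma>'. same {dst, ''i''} \<sigma> \<sigma>' \<Longrightarrow> aval e2 \<sigma>' = B" "dst \<noteq> ''i''"
  shows "dt (Mul dst e1 e2) \<sigma> (5 + A * 4) 0 (\<lambda>\<sigma>'. same {dst, ''i''} \<sigma> \<sigma>' \<and> \<sigma>' dst 0 = A * B)"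
proof -
  let ?I = "\<lambda>i \<sigma>'. same {dst, ''i''} \<sigma> \<sigma>' \<and> \<sigma>' ''i'' 0 = i \<and> \<sigma>' dst 0 = i * B"
  have "dt (Mul dst e1 e2) \<sigma> (3 + A * (1 + 3) + 2) (A * 0) (?I A)"
    unfolding Mul_def
  proof (rule dt_Assign_Seq, rule ht_For_dt[where I="?I"], goal_cases)
    case 1 show ?case using assms(3) by (intro conjI same_put same_refl) (simp_all add: put_apply)
  next
    case (2 i \<sigma>1) then show ?case using assms(1) by blast
  next
    case (3 i \<sigma>1) then show ?case by blast
  next
    case (4 i \<sigma>1)
    show ?case unfolding Incr_def
      by (rule dt_Assign, intro conjI same_put conjunct1[OF 4(2)])
         (use 4(2) assms in \<open>simp_all add: put_apply\<close>)
  qed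
  then show ?thesis by (rule ht_mono) (blast | simp)+
qed

lemma dt_Inverse_eps:
  assumes "\<sigma> ''eps'' 0 = a" "\<sigma> ''eps'' 1 = b" "0 < a"
  shows "dt Inverse_eps \<sigma> (10 + inv_eps a b * 4) 0
    (\<lambda>\<sigma>'. same {''e'', ''acc''} \<sigma> \<sigma>' \<and> \<sigma>' ''e'' 0 = inv_eps a b)"
proof -
  let ?I = "\<lambda>i \<sigma>'. same {''e'', ''acc''} \<sigma> \<sigma>' \<and> \<sigma>' ''e'' 0 = i \<and> \<sigma>' ''acc'' 0 = i * a"
  have ex: "b \<le> b * a" using assms(3) by simp
  have "dt Inverse_eps \<sigma> (1 + inv_eps a b * ((1 + 2) + 1) + 2 + 2) (inv_eps a b * 0) (?I (inv_eps a b))"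
    unfolding Inverse_eps_def
  proof (rule dt_Assign_Seq, rule dt_Assign_Seq, rule dt_While_count[where I="?I"], goal_cases)
    case 1 show ?case by (intro conjI same_put same_refl) (simp_all add: put_apply)
  next
    case (2 i \<sigma>1)
    have e: "\<sigma>1 ''eps'' = \<sigma> ''eps''" using sameD[OF conjunct1[OF 2(2)], of "''eps''"] by simp
    have "\<not> b \<le> i * a" using not_less_Least[of i "\<lambda>e. b \<le> e * a"] 2(1) by (simp add: inv_eps_def)
    then have "bval (Less (V ''acc'') (Elem ''eps'' (Const 1))) \<sigma>1" using 2 e assms by simp
    moreover have "dt (Seq (Incr ''acc'' (Elem ''eps'' (Const 0))) (Incr ''e'' (Const 1))) \<sigma>1 (1 + 2) 0 (?I (Suc i))"
      unfolding Incr_def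
      by (rule dt_Assign_Seq, rule dt_Assign, intro conjI same_put conjunct1[OF 2(2)])
         (use 2(2) e assms in \<open>simp_all add: put_apply\<close>)
    ultimately show ?case by blast
  next
    case (3 \<sigma>1)
    have e: "\<sigma>1 ''eps'' = \<sigma> ''eps''" using sameD[OF conjunct1[OF 3], of "''eps''"] by simp
    have "b \<le> inv_eps a b * a" unfolding inv_eps_def by (rule LeastI[of "\<lambda>e. b \<le> e * a"], rule ex)
    then show ?case using 3 e assms by simp
  qed
  then show ?thesis by (rule ht_mono) (blast | simp)+
qed

lemma dt_Powers:
  assumes wt: "\<sigma> ''wt'' 0 = (k + e + (k + e)) * (k + e + (k + e))"
  shows "dt Powers \<sigma> (10 + level k e * 4) 0
    (\<lambda>\<sigma>'. same {''l'', ''pow''} \<sigma> \<sigma>' \<and> \<sigma>' ''l'' 0 = level k e \<and> (\<forall>i\<le>level k e. \<sigma>' ''pow'' i = 2 ^ i))"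
proof -
  let ?I = "\<lambda>i \<sigma>'. same {''l'', ''pow''} \<sigma> \<sigma>' \<and> \<sigma>' ''l'' 0 = i \<and> (\<forall>j\<le>i. \<sigma>' ''pow'' j = 2 ^ j)"
  have "dt Powers \<sigma> (1 + level k e * ((1 + 2) + 1) + 2 + 2) (level k e * 0) (?I (level k e))"
    unfolding Powers_def
  proof (rule dt_Assign_Seq, rule dt_Assign_Seq, rule dt_While_count[where I="?I"], goal_cases)
    case 1 show ?case by (intro conjI same_put same_refl) (simp_all add: put_apply)
  next
    case (2 i \<sigma>1)
    have w: "\<sigma>1 ''wt'' = \<sigma> ''wt''" using sameD[OF conjunct1[OF 2(2)], of "''wt''"] by simp
    have "\<not> (k + e + (k + e)) * (k + e + (k + e)) \<le> 2 ^ i"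
      using not_less_Least[of i "\<lambda>l. (k + e + (k + e)) * (k + e + (k + e)) \<le> 2 ^ l"] 2(1) unfolding level_def by blast
    then have "bval (Less (Elem ''pow'' (V ''l'')) (V ''wt'')) \<sigma>1" using 2 w wt by simp
    moreover have "dt (Seq (Assign ''pow'' (Plus (V ''l'') (Const 1)) (Plus (Elem ''pow'' (V ''l'')) (Elem ''pow'' (V ''l''))))
         (Incr ''l'' (Const 1))) \<sigma>1 (1 + 2) 0 (?I (Suc i))"
      unfolding Incr_def
      by (rule dt_Assign_Seq, rule dt_Assign, intro conjI same_put conjunct1[OF 2(2)])
         (use 2(2) in \<open>auto simp: put_apply le_Suc_eq\<close>)
    ultimately show ?case by blast
  next
    case (3 \<sigma>1)
    have w: "\<sigma>1 ''wt'' = \<sigma> ''wt''" using sameD[OF conjunct1[OF 3], of "''wt''"] by simp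
    then show ?case using 3 wt level_least[of k e] by simp
  qed
  then show ?thesis by (rule ht_mono) (blast | simp)+
qed

lemma ht_Partition:
  assumes n: "\<sigma> ''n'' 0 = n" and l: "\<sigma> ''l'' 0 = l" and pow: "\<forall>i\<le>l. \<sigma> ''pow'' i = 2 ^ i"
  shows "ht Partition \<sigma> (3 + n * (l * 7 + 20)) 0 (rpart n l)
     (\<lambda>\<sigma>' p. same {''i'', ''j'', ''c'', ''rv'', ''pi''} \<sigma> \<sigma>' \<and> (\<forall>j<n. \<sigma>' ''pi'' j = p j))"
proof -
  let ?W = "{''i'', ''j'', ''c'', ''rv'', ''pi''}"
  let ?I = "\<lambda>i \<sigma>' p. same ?W \<sigma> \<sigma>' \<and> \<sigma>' ''i'' 0 = i \<and> (\<forall>j<i. \<sigma>' ''pi'' j = p j)"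
  have "ht Partition \<sigma> (3 + n * ((Suc ((3 + l * (Suc (1 + Suc 1) + 3)) + 1) + 2) + 3)) (n * (l * (0 + 0) + 0)) (rpart n l) (?I n)"
    unfolding Partition_def rpart_def
  proof (rule ht_For[where I="?I"], goal_cases)
    case 1 show ?case by (intro conjI same_put same_refl) (simp_all add: put_apply)
  next
    case (2 i \<sigma>1 p) then show ?case using sameD[OF conjunct1[OF 2], of "''n''"] n by simp
  next
    case (3 i \<sigma>1 p) then show ?case by blast
  next
    case (4 i \<sigma>1 p)
    note I = 4(2)
    define \<sigma>2 where "\<sigma>2 = put ''rv'' 0 0 \<sigma>1"
    have s2: "same ?W \<sigma> \<sigma>2" unfolding \<sigma>2_def by (rule same_put[OF conjunct1[OF I]]) simp
    let ?J = "\<lambda>m \<sigma>' v. same {''j'', ''c'', ''rv''} \<sigma>2 \<sigma>' \<and> \<sigma>' ''j'' 0 = m \<and> \<sigma>' ''rv'' 0 = v"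
    have inner: "ht (For ''j'' (V ''l'') (Seq (Flip ''c'')
        (Cond (Less (Const 0) (V ''c'')) (Incr ''rv'' (Elem ''pow'' (V ''j''))) Skip))) \<sigma>2
        (3 + l * (Suc (1 + Suc 1) + 3)) (l * (0 + 0)) (rnum l) (?J l)"
      unfolding rnum_def
    proof (rule ht_For[where I="?J"], goal_cases)
      case 1 show ?case by (intro conjI same_put same_refl) (simp_all add: put_apply \<sigma>2_def)
    next
      case (2 m \<sigma>3 v)
      then show ?case using sameD[OF conjunct1[OF 2], of "''l''"] sameD[OF s2, of "''l''"] l by simp
    next
      case (3 m \<sigma>3 v) then show ?case by blast
    next
      case (4 m \<sigma>3 v)
      note J = 4(2)
      have pm: "\<sigma>3 ''pow'' m = 2 ^ m"
        using sameD[OF conjunct1[OF J], of "''pow''"] sameD[OF s2, of "''pow''"] pow 4(1) by simp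
      show ?case
      proof (rule ht_map_Seq[OF ht_Flip[where R="\<lambda>\<sigma>' b. \<sigma>' = put ''c'' 0 (of_bool b) \<sigma>3"]], simp, rule ht_Cond)
        fix \<sigma>4 b assume \<sigma>4: "\<sigma>4 = put ''c'' 0 (of_bool b) \<sigma>3"
        have s4: "same {''j'', ''c'', ''rv''} \<sigma>2 \<sigma>4" unfolding \<sigma>4 by (rule same_put[OF conjunct1[OF J]]) simp
        have v4: "\<sigma>4 ''c'' 0 = of_bool b" "\<sigma>4 ''rv'' 0 = v" "\<sigma>4 ''j'' 0 = m" "\<sigma>4 ''pow'' m = 2 ^ m"
          using J pm by (simp_all add: \<sigma>4 put_apply)
        show "dt (if bval (Less (Const 0) (V ''c'')) \<sigma>4 then Incr ''rv'' (Elem ''pow'' (V ''j'')) else Skip) \<sigma>4 1 0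
          (\<lambda>\<sigma>'. \<sigma>' ''j'' 0 = m \<and> ?J (Suc m) (put ''j'' 0 (Suc m) \<sigma>') (v + (if b then 2 ^ m else 0)))"
        proof (cases b)
          case True
          then have "bval (Less (Const 0) (V ''c'')) \<sigma>4" by (simp add: v4)
          then show ?thesis unfolding Incr_def
            by (simp only: if_True, intro dt_Assign conjI same_put s4) (use True in \<open>simp_all add: put_apply v4\<close>)
        next
          case False
          then have "\<not> bval (Less (Const 0) (V ''c'')) \<sigma>4" by (simp add: v4)
          then show ?thesis
            by (simp only: if_False, intro dt_Skip conjI same_put s4) (use False in \<open>simp_all add: put_apply v4\<close>)
        qed
      qed
    qed
    show ?case
    proof (rule dt_Assign_Seq, unfold aval.simps(1) \<sigma>2_def[symmetric], rule ht_map_Seq[OF inner])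
      fix \<sigma>3 v assume J: "?J l \<sigma>3 v"
      have s3: "same ?W \<sigma> \<sigma>3" by (rule same_trans[OF s2 conjunct1[OF J]]) simp
      have v3: "\<sigma>3 ''i'' 0 = i" "\<sigma>3 ''pi'' = \<sigma>1 ''pi''" "\<sigma>3 ''rv'' 0 = v"
        using sameD[OF conjunct1[OF J]] J I by (simp_all add: \<sigma>2_def put_apply)
      show "dt (Assign ''pi'' (V ''i'') (V ''rv'')) \<sigma>3 1 0
         (\<lambda>\<sigma>'. \<sigma>' ''i'' 0 = i \<and> ?I (Suc i) (put ''i'' 0 (Suc i) \<sigma>') (p(i := v)))"
        by (rule dt_Assign, intro conjI same_put s3) (use I in \<open>auto simp: put_apply v3 less_Suc_eq\<close>)
    qed
  qed
  then show ?thesis by (rule ht_mono) (blast | simp add: algebra_simps)+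
qed

end

context machine
begin

text \<open>A product takes time linear in its first factor, which is how \<open>r\<close>, twice
  the sum of \<open>r * s\<close> and \<open>e\<close>, and \<open>e\<close> enter the bound. The
  product of \<open>e\<close> and \<open>l\<close> is formed apart, so that \<open>N\<close> needs
  only 40 additions.\<close>

lemma dt_Init:
  assumes \<sigma>: "\<sigma> ''n'' 0 = n" "\<sigma> ''s'' 0 = s" "\<sigma> ''r'' 0 = r" "\<sigma> ''eps'' 0 = a" "\<sigma> ''eps'' 1 = b" and a: "0 < a"
    and e: "e = inv_eps a b" and l: "l = level (r * s) e" and N: "N = 40 * (e * l)"
  shows "dt Init \<sigma> (300 + r * 4 + e * 8 + (r * s + e) * 8 + l * 4) 0
    (\<lambda>\<sigma>'. same {''k'', ''i'', ''e'', ''acc'', ''g'', ''wt'', ''l'', ''pow'', ''el'', ''N''} \<sigma> \<sigma>' \<and> \<sigma>' ''k'' 0 = r * s \<and>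
       \<sigma>' ''l'' 0 = l \<and> \<sigma>' ''N'' 0 = N \<and> (\<forall>i\<le>l. \<sigma>' ''pow'' i = 2 ^ i))" (is "dt _ _ _ _ ?R")
proof -
  let ?G = "r * s + e + (r * s + e)"
  have "dt Init \<sigma> (Suc ((5 + r * 4) + Suc ((10 + inv_eps a b * 4) + (Suc ((5 + ?G * 4) +
     Suc ((10 + level (r * s) e * 4) + Suc ((5 + e * 4) + (5 + 40 * 4)))) + 2)))) (0 + (0 + (0 + (0 + (0 + 0))))) ?R"
    unfolding Init_def
  proof (rule dt_ht_Seq[OF dt_Mul[where A=r and B=s]], goal_cases)
    case (1 \<sigma>') then show ?case using sameD[OF 1, of "''r''"] \<sigma> by simp
  next
    case (2 \<sigma>') then show ?case using sameD[OF 2, of "''s''"] \<sigma> by simp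
  next
    case 3 show ?case by simp
  next
    case (4 \<sigma>1)
    note s1 = 4
    show ?case
    proof (rule dt_ht_Seq[OF dt_Inverse_eps[OF _ _ a]], goal_cases)
      case 1 show ?case using sameD[OF conjunct1[OF s1], of "''eps''"] \<sigma> by simp
    next
      case 2 show ?case using sameD[OF conjunct1[OF s1], of "''eps''"] \<sigma> by simp
    next
      case (3 \<sigma>2)
      note s2 = 3
      let ?W2 = "{''k'', ''i'', ''e'', ''acc''}"
      have s2': "same ?W2 \<sigma> \<sigma>2" by (rule same_trans[OF conjunct1[OF s1] conjunct1[OF s2]]) simp
      have v2: "\<sigma>2 ''k'' 0 = r * s" "\<sigma>2 ''e'' 0 = e" using s1 s2 sameD[OF conjunct1[OF s2], of "''k''"] e by simp_all
      define \<sigma>3 where "\<sigma>3 = put ''g'' 0 ?G \<sigma>2"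
      let ?W3 = "{''k'', ''i'', ''e'', ''acc'', ''g''}"
      have s3: "same ?W3 \<sigma> \<sigma>3" unfolding \<sigma>3_def by (rule same_put[OF same_mono[OF s2']]) simp_all
      have v3: "\<sigma>3 ''k'' 0 = r * s" "\<sigma>3 ''e'' 0 = e" "\<sigma>3 ''g'' 0 = ?G" using v2 by (simp_all add: \<sigma>3_def put_apply)
      have g: "aval (Plus (Plus (V ''k'') (V ''e'')) (Plus (V ''k'') (V ''e''))) \<sigma>2 = ?G" using v2 by simp
      show ?case
      proof (rule dt_Assign_Seq, unfold g aval.simps(1) \<sigma>3_def[symmetric], rule dt_ht_Seq[OF dt_Mul[where A="?G" and B="?G"]], goal_cases)
        case (1 \<sigma>') then show ?case using sameD[OF 1, of "''g''"] v3 by simp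
      next
        case (2 \<sigma>') then show ?case using sameD[OF 2, of "''g''"] v3 by simp
      next
        case 3 show ?case by simp
      next
        case (4 \<sigma>4)
        note s4 = 4
        let ?W4 = "{''k'', ''i'', ''e'', ''acc'', ''g'', ''wt''}"
        have s4': "same ?W4 \<sigma> \<sigma>4" by (rule same_trans[OF s3 conjunct1[OF s4]]) simp
        have v4: "\<sigma>4 ''k'' 0 = r * s" "\<sigma>4 ''e'' 0 = e" using sameD[OF conjunct1[OF s4]] v3 by simp_all
        show ?case
        proof (rule dt_ht_Seq[OF dt_Powers[where \<sigma>=\<sigma>4, OF conjunct2[OF s4]]])
          fix \<sigma>5 assume s5: "same {''l'', ''pow''} \<sigma>4 \<sigma>5 \<and> \<sigma>5 ''l'' 0 = level (r * s) e \<and>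
             (\<forall>i\<le>level (r * s) e. \<sigma>5 ''pow'' i = 2 ^ i)"
          let ?W5 = "{''k'', ''i'', ''e'', ''acc'', ''g'', ''wt'', ''l'', ''pow''}"
          have s5': "same ?W5 \<sigma> \<sigma>5" by (rule same_trans[OF s4' conjunct1[OF s5]]) simp
          have v5: "\<sigma>5 ''k'' 0 = r * s" "\<sigma>5 ''e'' 0 = e" "\<sigma>5 ''l'' 0 = l" "\<forall>i\<le>l. \<sigma>5 ''pow'' i = 2 ^ i"
            using sameD[OF conjunct1[OF s5]] v4 s5 l by simp_all
          show "dt (Seq (Mul ''el'' (V ''e'') (V ''l'')) (Mul ''N'' (Const 40) (V ''el''))) \<sigma>5
              (Suc ((5 + e * 4) + (5 + 40 * 4))) (0 + 0) ?R"
          proof (rule dt_ht_Seq[OF dt_Mul[where A=e and B=l]], goal_cases)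
            case (1 \<sigma>') then show ?case using sameD[OF 1, of "''e''"] v5 by simp
          next
            case (2 \<sigma>') then show ?case using sameD[OF 2, of "''l''"] v5 by simp
          next
            case 3 show ?case by simp
          next
            case (4 \<sigma>6)
            note s6 = 4
            let ?W6 = "{''k'', ''i'', ''e'', ''acc'', ''g'', ''wt'', ''l'', ''pow'', ''el''}"
            have s6': "same ?W6 \<sigma> \<sigma>6" by (rule same_trans[OF s5' conjunct1[OF s6]]) simp
            have v6: "\<sigma>6 ''k'' 0 = r * s" "\<sigma>6 ''l'' 0 = l" "\<forall>i\<le>l. \<sigma>6 ''pow'' i = 2 ^ i"
              using sameD[OF conjunct1[OF s6]] v5 by simp_all
            show ?case
            proof (rule ht_mono[OF dt_Mul[where A=40 and B="e * l"]], goal_cases)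
              case (1 \<sigma>') show ?case by simp
            next
              case (2 \<sigma>') then show ?case using sameD[OF 2, of "''el''"] s6 by simp
            next
              case (6 \<sigma>7)
              have "same {''k'', ''i'', ''e'', ''acc'', ''g'', ''wt'', ''l'', ''pow'', ''el'', ''N''} \<sigma> \<sigma>7"
                by (rule same_trans[OF s6' conjunct1[OF 6(2)]]) simp
              then show ?case using 6(2) v6 sameD[OF conjunct1[OF 6(2)]] N by simp
            qed simp_all
          qed
        qed
      qed
    qed
  qed
  then show ?thesis by (rule ht_mono) (assumption | simp add: e[symmetric] l[symmetric])+
qed

definition timeA :: nat where
  "timeA = 20 * n + 80 + l * (4 * n + 20)"

definition timeC :: nat where
  "timeC = 60 + 4 * n + r * s * (l * (50 * n + 83) + 30) + s * (r * s * 4 + 20) + r * s * (8 * n + 30)"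

definition time :: "nat \<Rightarrow> nat" where
  "time e = 400 + r * 4 + e * 8 + (r * s + e) * 8 + l * 4 + n * (l * 7 + 20) +
     Suc (r * s) * N * (timeA + 1) + Suc s * N * (timeC + 1)"

definition calls :: nat where
  "calls = Suc (r * s) * N * (l + 3) + Suc s * N * (2 + r * s * (l * 7 + 1))"

lemma ht_LoopA:
  assumes D: "set_pmf D \<subseteq> cube n" and inv: "invA p \<sigma> []" and v: "\<sigma> ''cnt'' 0 = 0" "\<sigma> ''ok'' 0 = 1"
  shows "ht (Loop BodyA) \<sigma> (1 + Suc (r * s) * N * (timeA + 1)) (Suc (r * s) * N * (l + 3))
     (stream (stepA (r * s) l p) N (Suc (r * s) * N) [] 0)
     (\<lambda>\<sigma>' res. case res of None \<Rightarrow> \<sigma>' ''ok'' 0 = 0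
        | Some cs \<Rightarrow> (invA p \<sigma>' cs \<and> length cs \<le> r * s) \<and> \<sigma>' ''ok'' 0 = 1)"
  unfolding Loop_def
\<comment> \<open>The bound on the number of slots joins the invariant, because the second phase
  relies on it for its row width and its resources.\<close>
proof (rule ht_stream[where sz=length and k="r * s" and Inv="\<lambda>\<sigma> cs. invA p \<sigma> cs \<and> length cs \<le> r * s"], goal_cases)
  case (1 \<sigma>1 cs) then show ?case by (simp add: invA_def base_def)
next
  case (2 j \<sigma>1 cs)
  show ?case unfolding timeA_def
  proof (rule ht_mono[OF ht_BodyA[OF D conjunct1[OF 2(1)] 2(2,3)]], simp, simp)
    fix \<sigma>' out assume "case out of
         Pass \<Rightarrow> invA p \<sigma>' cs \<and> \<sigma>' ''cnt'' 0 = Suc j \<and> \<sigma>' ''ok'' 0 = 1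
       | Change cs' \<Rightarrow> invA p \<sigma>' cs' \<and> \<sigma>' ''cnt'' 0 = 0 \<and> \<sigma>' ''ok'' 0 = 1 \<and>
           length cs' = Suc (length cs) \<and> length cs' \<le> r * s
       | Rej \<Rightarrow> \<sigma>' ''ok'' 0 = 0"
    then show "case out of Pass \<Rightarrow> (invA p \<sigma>' cs \<and> length cs \<le> r * s) \<and> \<sigma>' ''cnt'' 0 = Suc j \<and> \<sigma>' ''ok'' 0 = 1
       | Change a' \<Rightarrow> (invA p \<sigma>' a' \<and> length a' \<le> r * s) \<and> \<sigma>' ''cnt'' 0 = 0 \<and> \<sigma>' ''ok'' 0 = 1 \<and>
            length a' = Suc (length cs) \<and> length a' \<le> r * s
       | Rej \<Rightarrow> \<sigma>' ''ok'' 0 = 0"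
      using 2(1) by (cases out) auto
  qed
qed (use inv v in simp_all)

lemma ht_LoopC:
  assumes D: "set_pmf D \<subseteq> cube n" and inv: "invA p \<sigma> cs" and len: "length cs \<le> r * s"
    and v: "\<sigma> ''cnt'' 0 = 0" "\<sigma> ''ok'' 0 = 1"
  shows "ht (Loop BodyC) \<sigma> (1 + Suc s * N * (timeC + 1)) (Suc s * N * (2 + r * s * (l * 7 + 1)))
     (stream (stepC s r l p cs) N (Suc s * N) [] 0)
     (\<lambda>\<sigma>' res. case res of None \<Rightarrow> \<sigma>' ''ok'' 0 = 0 | Some ts \<Rightarrow> invC p cs \<sigma>' ts \<and> \<sigma>' ''ok'' 0 = 1)"
  unfolding Loop_def
proof (rule ht_stream[where sz=length and k=s and Inv="\<lambda>\<sigma> ts. invC p cs \<sigma> ts"], goal_cases)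
  case (1 \<sigma>1 ts) then show ?case by (simp add: invC_def base_def)
next
  case (2 j \<sigma>1 ts)
  show ?case unfolding timeC_def by (rule ht_BodyC[OF D 2(1-3) len])
next
  case 3
  show ?case using inv by (simp add: invC_def invA_def termsP_def)
qed (use v in simp_all)

lemma dt_accept:
  "\<sigma> ''ok'' 0 = of_bool B \<Longrightarrow> dt (Set ''accept'' (V ''ok'')) \<sigma> 1 0 (\<lambda>\<sigma>'. (\<sigma>' ''accept'' 0 = 1) = B)"
  by (rule dt_Assign) (simp add: put_apply)

lemma ht_Tester:
  assumes D: "set_pmf D \<subseteq> cube n" and ab: "0 < a" "a \<le> b"
    and e: "e = inv_eps a b" and l: "l = level (r * s) e" and N: "N = 40 * (e * l)"
  shows "ht Tester (input n s r a b) (time e) calls (algo s r l N) (\<lambda>\<sigma>' b. (\<sigma>' ''accept'' 0 = 1) = b)" (is "ht _ ?\<sigma> _ _ _ ?R")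
proof -
  let ?WI = "{''k'', ''i'', ''e'', ''acc'', ''g'', ''wt'', ''l'', ''pow'', ''el'', ''N''}"
  let ?tA = "1 + Suc (r * s) * N * (timeA + 1)" and ?tC = "1 + Suc s * N * (timeC + 1)"
  let ?qA = "Suc (r * s) * N * (l + 3)" and ?qC = "Suc s * N * (2 + r * s * (l * 7 + 1))"
  have i: "?\<sigma> ''n'' 0 = n" "?\<sigma> ''s'' 0 = s" "?\<sigma> ''r'' 0 = r" "?\<sigma> ''eps'' 0 = a" "?\<sigma> ''eps'' 1 = b"
    "\<And>x. x \<notin> {''n'', ''s'', ''r'', ''eps''} \<Longrightarrow> ?\<sigma> x = (\<lambda>_. 0)"
    by (simp_all add: input_def put_def)
  have test: "bval (Less (Elem ''eps'' (Const 1)) (Elem ''eps'' (Const 0))) ?\<sigma> \<longleftrightarrow> False"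
    using i ab by simp
  have "ht (Seq Init (Seq Partition (Seq (Set ''ok'' (Const 1)) (Seq (Set ''cnt'' (Const 0)) (Seq (Loop BodyA)
       (Seq (Set ''cnt'' (Const 0)) (Seq (Loop BodyC) (Set ''accept'' (V ''ok'')))))))))
     ?\<sigma> (Suc ((300 + r * 4 + e * 8 + (r * s + e) * 8 + l * 4) + Suc ((3 + n * (l * 7 + 20)) +
        (Suc (?tA + (Suc (?tC + 1) + 2)) + 2 + 2)))) (0 + (0 + (?qA + (?qC + 0)))) (algo s r l N) ?R"
    unfolding algo_def
  proof (rule dt_ht_Seq[OF dt_Init[OF i(1-5) ab(1) e l N]], rule ht_Seq[OF ht_Partition], goal_cases)
    case (1 \<sigma>1) then show ?case using sameD[OF conjunct1[OF 1], of "''n''"] i(1) by simp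
  next
    case (2 \<sigma>1) then show ?case by blast
  next
    case (3 \<sigma>1) then show ?case by blast
  next
    case (4 \<sigma>1 \<sigma>2 p)
    note s1 = 4(1) and s2 = 4(3)
    let ?W2 = "?WI \<union> {''j'', ''c'', ''rv'', ''pi''}"
    have s2': "same ?W2 ?\<sigma> \<sigma>2" by (rule same_trans[OF conjunct1[OF s1] conjunct1[OF s2]]) simp
    define \<sigma>3 where "\<sigma>3 = put ''ok'' 0 1 \<sigma>2"
    define \<sigma>4 where "\<sigma>4 = put ''cnt'' 0 0 \<sigma>3"
    let ?W4 = "?W2 \<union> {''ok'', ''cnt''}"
    have s4: "same ?W4 ?\<sigma> \<sigma>4" unfolding \<sigma>4_def \<sigma>3_def
      by (intro same_put same_mono[OF s2']) simp_all
    have "base p \<sigma>4"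
      using s1 s2 sameD[OF conjunct1[OF s2]] sameD[OF s2'] i by (simp add: base_def \<sigma>4_def \<sigma>3_def put_apply)
    \<comment> \<open>Arrays not written so far are still zero, which encodes the empty list of
      slots and the empty hypothesis.\<close>
    moreover have "slotsP [] \<sigma>4" "\<sigma>4 ''nt'' 0 = 0"
      using sameD[OF s4] i(6) by (simp_all add: slotsP_def)
    ultimately have inv: "invA p \<sigma>4 []" by (simp add: invA_def)
    have v4: "\<sigma>4 ''cnt'' 0 = 0" "\<sigma>4 ''ok'' 0 = 1" by (simp_all add: \<sigma>4_def \<sigma>3_def put_apply)
    show ?case
    proof (rule dt_Assign_Seq, rule dt_Assign_Seq, unfold aval.simps(1) \<sigma>3_def[symmetric], unfold \<sigma>4_def[symmetric],
        rule ht_Seq[OF ht_LoopA[OF D inv v4]])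
      fix \<sigma>5 A assume A: "case A of None \<Rightarrow> \<sigma>5 ''ok'' 0 = 0
        | Some cs \<Rightarrow> (invA p \<sigma>5 cs \<and> length cs \<le> r * s) \<and> \<sigma>5 ''ok'' 0 = 1"
      define \<sigma>6 where "\<sigma>6 = put ''cnt'' 0 0 \<sigma>5"
      have s6: "same {''cnt''} \<sigma>5 \<sigma>6" unfolding \<sigma>6_def by (intro same_put same_refl) simp
      have "ht (Seq (Loop BodyC) (Set ''accept'' (V ''ok''))) \<sigma>6 (Suc (?tC + 1)) (?qC + 0) (case A of None \<Rightarrow> return_pmf False
         | Some cs \<Rightarrow> map_pmf (\<lambda>C. C \<noteq> None) (stream (stepC s r l p cs) N (Suc s * N) [] 0)) ?R"
      proof (cases A)
        case None
        then have ok6: "\<sigma>6 ''ok'' 0 = 0" using A by (simp add: \<sigma>6_def put_apply)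
        \<comment> \<open>After a rejection \<open>ok\<close> is 0 and the second loop ends at its
          first test. The type \<open>nat\<close> merely fixes the element type of an option that is
          always \<open>None\<close>.\<close>
        have "ht (Loop BodyC) \<sigma>6 (Suc 0) 0 (return_pmf None) (\<lambda>\<sigma>' C. case C of None \<Rightarrow> \<sigma>' ''ok'' 0 = 0 | Some (x :: nat) \<Rightarrow> True \<and> \<sigma>' ''ok'' 0 = 1)"
          unfolding Loop_def by (rule ht_While_False) (simp_all add: ok6)
        then have "ht (Seq (Loop BodyC) (Set ''accept'' (V ''ok''))) \<sigma>6 (Suc (Suc 0 + 1)) (0 + 0) (map_pmf (\<lambda>C. C \<noteq> None) (return_pmf (None :: nat option))) ?R"
          by (rule ht_map_Seq) (rule dt_accept, simp split: option.splits)
        moreover have "map_pmf (\<lambda>C. C \<noteq> None) (return_pmf (None :: nat option)) = return_pmf False"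
          by (simp add: map_return_pmf)
        ultimately show ?thesis unfolding None option.case by (simp only:) (erule ht_mono, simp_all)
      next
        case (Some cs)
        then have A': "invA p \<sigma>5 cs" "length cs \<le> r * s" "\<sigma>5 ''ok'' 0 = 1" using A by simp_all
        have "invA p \<sigma>6 cs"
          using A'(1) base_same[OF _ s6] slotsP_same[OF _ s6] sameD[OF s6, of "''nt''"] by (simp add: invA_def)
        moreover have "\<sigma>6 ''cnt'' 0 = 0" "\<sigma>6 ''ok'' 0 = 1" using A' by (simp_all add: \<sigma>6_def put_apply)
        ultimately show ?thesis unfolding Some option.case
          by (intro ht_map_Seq[OF ht_LoopC[OF D _ A'(2)]] dt_accept) (simp_all split: option.splits)
      qed
      then show "ht (Seq (Set ''cnt'' (Const 0)) (Seq (Loop BodyC) (Set ''accept'' (V ''ok'')))) \<sigma>5 (Suc (?tC + 1) + 2) (?qC + 0) (case A of None \<Rightarrow> return_pmf False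
         | Some cs \<Rightarrow> map_pmf (\<lambda>C. C \<noteq> None) (stream (stepC s r l p cs) N (Suc s * N) [] 0)) ?R"
        by (intro dt_Assign_Seq) (simp only: aval.simps(1) \<sigma>6_def)
    qed
  qed
  then have "ht Tester ?\<sigma> (Suc (Suc ((300 + r * 4 + e * 8 + (r * s + e) * 8 + l * 4) + Suc ((3 + n * (l * 7 + 20)) +
        (Suc (?tA + (Suc (?tC + 1) + 2)) + 2 + 2))))) (0 + (0 + (?qA + (?qC + 0)))) (algo s r l N) ?R"
    unfolding Tester_def by (intro ht_Cond) (simp only: test if_False)
  then show ?thesis by (rule ht_mono) (simp_all add: time_def calls_def)
qed

end

section \<open>Resource bounds\<close>

text \<open>One pair of constants serves the whole parameter set; nonnegativity is included so that
  products can be bounded factor by factor.\<close>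

definition poly_on :: "'a set \<Rightarrow> ('a \<Rightarrow> real) \<Rightarrow> ('a \<Rightarrow> real) \<Rightarrow> bool" where
  "poly_on A Z g \<longleftrightarrow> (\<exists>C d. \<forall>x\<in>A. 0 \<le> g x \<and> g x \<le> C * Z x ^ d)"

context
  fixes A :: "'a set" and Z :: "'a \<Rightarrow> real"
  assumes Z: "\<forall>x\<in>A. 1 \<le> Z x"
begin

lemma poly_on_const: "0 \<le> c \<Longrightarrow> poly_on A Z (\<lambda>_. c)"
  unfolding poly_on_def by (rule exI[of _ c], rule exI[of _ 0]) simp

lemma poly_on_le: "poly_on A Z h \<Longrightarrow> (\<And>x. x \<in> A \<Longrightarrow> 0 \<le> g x \<and> g x \<le> h x) \<Longrightarrow> poly_on A Z g"
  unfolding poly_on_def by (meson order_trans)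

lemma poly_on_self: "poly_on A Z Z"
  unfolding poly_on_def using Z by (intro exI[of _ 1]) (force intro: order_trans[OF zero_le_one])

lemma poly_on_mult:
  assumes "poly_on A Z g" "poly_on A Z h"
  shows "poly_on A Z (\<lambda>x. g x * h x)"
proof -
  obtain C d C' d' where g: "\<forall>x\<in>A. 0 \<le> g x \<and> g x \<le> C * Z x ^ d" and h: "\<forall>x\<in>A. 0 \<le> h x \<and> h x \<le> C' * Z x ^ d'"
    using assms unfolding poly_on_def by blast
  have "0 \<le> g x * h x \<and> g x * h x \<le> (C * C') * Z x ^ (d + d')" if "x \<in> A" for x
  proof -
    have "g x * h x \<le> (C * Z x ^ d) * (C' * Z x ^ d')"
      using g h that by (intro mult_mono) (auto intro: order_trans)
    then show ?thesis using g h that by (simp add: power_add algebra_simps)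
  qed
  then show ?thesis unfolding poly_on_def by blast
qed

lemma poly_on_add:
  assumes "poly_on A Z g" "poly_on A Z h"
  shows "poly_on A Z (\<lambda>x. g x + h x)"
proof -
  obtain C d C' d' where g: "\<forall>x\<in>A. 0 \<le> g x \<and> g x \<le> C * Z x ^ d" and h: "\<forall>x\<in>A. 0 \<le> h x \<and> h x \<le> C' * Z x ^ d'"
    using assms unfolding poly_on_def by blast
  have "0 \<le> g x + h x \<and> g x + h x \<le> (\<bar>C\<bar> + \<bar>C'\<bar>) * Z x ^ (d + d')" if "x \<in> A" for x
  proof -
    \<comment> \<open>Both powers are raised to a common exponent, as \<open>Z\<close> is at least
      1; absolute values make this independent of the signs of the constants.\<close>
    have p: "Z x ^ d \<le> Z x ^ (d + d')" "Z x ^ d' \<le> Z x ^ (d + d')"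
      by (intro power_increasing Z[rule_format] that; simp)+
    have Z0: "0 \<le> Z x ^ d" "0 \<le> Z x ^ d'" using Z[rule_format, OF that] by simp_all
    have "C * Z x ^ d \<le> \<bar>C\<bar> * Z x ^ d" "C' * Z x ^ d' \<le> \<bar>C'\<bar> * Z x ^ d'"
      using Z0 by (intro mult_right_mono; simp)+
    moreover have "\<bar>C\<bar> * Z x ^ d \<le> \<bar>C\<bar> * Z x ^ (d + d')" "\<bar>C'\<bar> * Z x ^ d' \<le> \<bar>C'\<bar> * Z x ^ (d + d')"
      using p by (intro mult_left_mono; simp)+
    ultimately show ?thesis using g h that unfolding distrib_right by (smt (verit))
  qed
  then show ?thesis unfolding poly_on_def by blast
qed

end

section \<open>Estimates for the parameters and the number of oracle calls\<close>

lemma inv_eps_bounds: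
  assumes "0 < a" "a \<le> b" "represents a b \<epsilon>"
  shows "1 \<le> inv_eps a b" "1 / real (inv_eps a b) \<le> \<epsilon>" "real (inv_eps a b) \<le> 4 / \<epsilon>"
proof -
  define e where "e = inv_eps a b"
  have b: "0 < b" using assms by simp
  have r: "real a / real b \<le> \<epsilon>" "\<epsilon> \<le> 2 * (real a / real b)" using assms(3) by (simp_all add: represents_def)
  have "0 < real a / real b" using assms(1) b by simp
  then have \<epsilon>: "0 < \<epsilon>" using r by linarith
  have be: "b \<le> e * a" unfolding e_def inv_eps_def by (rule LeastI[of "\<lambda>e. b \<le> e * a" b]) (use assms(1) in simp)
  then have e1: "1 \<le> e" using b by (cases e) auto
  have "real b \<le> real e * real a" using be by (metis of_nat_le_iff of_nat_mult)
  then have "1 / real e \<le> real a / real b" using e1 b by (simp add: field_simps)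
  then show "1 / real (inv_eps a b) \<le> \<epsilon>" using r by (simp add: e_def)
  \<comment> \<open>Minimality of \<open>e\<close> gives e - 1 \<le> b/a \<le> 2/\<epsilon>; the
    factor 2 is the slack allowed in representing \<epsilon>.\<close>
  have "\<not> b \<le> (e - 1) * a" using not_less_Least[of "e - 1" "\<lambda>e. b \<le> e * a"] e1 by (simp add: e_def inv_eps_def)
  then have "real ((e - 1) * a) \<le> real b" by (simp only: of_nat_le_iff not_le less_imp_le)
  then have "(real e - 1) * real a \<le> real b" using e1 by (simp add: of_nat_diff)
  then have "real e - 1 \<le> real b / real a" using assms(1) by (simp add: field_simps)
  also have "\<dots> \<le> 2 / \<epsilon>" using r(2) assms(1) b \<epsilon> by (simp add: field_simps)
  finally have "real e \<le> 1 + 2 / \<epsilon>" by simp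
  \<comment> \<open>As \<open>a\<close> is at most \<open>b\<close>, \<epsilon> is at most 2, so the
    1 lost in rounding is absorbed by another 2/\<epsilon>.\<close>
  moreover have "\<epsilon> \<le> 2"
  proof -
    have "real a / real b \<le> 1" using assms(2) b by simp
    then show ?thesis using r(2) by linarith
  qed
  then have "1 \<le> 2 / \<epsilon>" using \<epsilon> by simp
  ultimately show "real (inv_eps a b) \<le> 4 / \<epsilon>" by (simp add: e_def)
  show "1 \<le> inv_eps a b" using e1 by (simp add: e_def)
qed

text \<open>By minimality the previous power stays below 4 (k + e)^2, and one doubling reaches at
  most twice that.\<close>

lemma level_upper:
  assumes "1 \<le> k" "1 \<le> e"
  shows "0 < level k e" "2 ^ level k e \<le> 8 * (k + e)\<^sup>2"
proof -
  define G where "G = (k + e + (k + e)) * (k + e + (k + e))"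
  have G: "G = 4 * (k + e)\<^sup>2" by (simp add: G_def power2_eq_square algebra_simps)
  have "1 \<le> (k + e)\<^sup>2" using assms by simp
  then have "4 \<le> G" using G by simp
  have up: "G \<le> 2 ^ level k e" unfolding G_def by (rule level_least)
  show pos: "0 < level k e" using up \<open>4 \<le> G\<close> by (cases "level k e") auto
  have "\<not> G \<le> 2 ^ (level k e - 1)"
    unfolding G_def using not_less_Least[of "level k e - 1" "\<lambda>l. (k + e + (k + e)) * (k + e + (k + e)) \<le> 2 ^ l"] pos unfolding level_def by simp
  moreover have "(2::nat) ^ level k e = 2 * 2 ^ (level k e - 1)" using pos by (metis power_eq_if not_gr_zero)
  ultimately show "2 ^ level k e \<le> 8 * (k + e)\<^sup>2" using G by simp
qed

lemma algo_params:
  assumes s: "1 \<le> s" and r: "1 \<le> r" and e: "1 \<le> e" and l: "l = level (r * s) e"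
  shows "3 * (real (r * s))\<^sup>2 \<le> 2 ^ l" "real (r * s) / 2 ^ l \<le> 1 / (4 * real e)"
    "real (r * s + s + 2) * (1 - 1 / (40 * real e)) ^ (40 * (e * l)) \<le> 1 / 3"
proof -
  define k where "k = r * s"
  have k: "1 \<le> k" "s \<le> k" using s r by (simp_all add: k_def)
  have "(k + e + (k + e)) * (k + e + (k + e)) \<le> 2 ^ l" unfolding l k_def by (rule level_least)
  then have "real ((k + e + (k + e)) * (k + e + (k + e))) \<le> real (2 ^ l)" by (simp only: of_nat_le_iff)
  then have L: "4 * (real k + real e)\<^sup>2 \<le> 2 ^ l" by (simp add: power2_eq_square algebra_simps)
  have ke: "1 \<le> real k" "1 \<le> real e" using k e by simp_all
  have "3 * (real k)\<^sup>2 \<le> 4 * (real k + real e)\<^sup>2" using ke by (simp add: power2_eq_square algebra_simps add_increasing2)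
  then show "3 * (real (r * s))\<^sup>2 \<le> 2 ^ l" using L by (simp add: k_def)
  have "4 * real e * real k \<le> 4 * (real k + real e)\<^sup>2" using ke by (simp add: power2_eq_square algebra_simps)
  then have "4 * real e * real k \<le> 2 ^ l" using L by linarith
  then show "real (r * s) / 2 ^ l \<le> 1 / (4 * real e)" using ke by (simp add: k_def[symmetric] field_simps)
  \<comment> \<open>A round of 40 e samples is survived with probability at most exp (-1), which is
    below 1/2; \<open>N\<close> samples are \<open>l\<close> such rounds, which gives
    \<open>1 / 2 ^ l\<close>.\<close>
  have "(1 - 1 / real (40 * e)) ^ (40 * e) \<le> exp (-1)"
    using exp_ge_one_minus_x_over_n_power_n[of 1 "40 * e"] e by simp
  also have "\<dots> \<le> 1 / 2" using exp_ge_add_one_self[of 1] by (simp add: exp_minus field_simps)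
  finally have half: "(1 - 1 / (40 * real e)) ^ (40 * e) \<le> 1 / 2" by simp
  have nn: "0 \<le> 1 - 1 / (40 * real e)" using ke by simp
  have "(1 - 1 / (40 * real e)) ^ (40 * (e * l)) = ((1 - 1 / (40 * real e)) ^ (40 * e)) ^ l"
    by (simp add: power_mult mult.assoc[symmetric])
  also have "\<dots> \<le> (1 / 2) ^ l" by (rule power_mono[OF half]) (use nn in simp)
  finally have p: "(1 - 1 / (40 * real e)) ^ (40 * (e * l)) \<le> 1 / 2 ^ l" by (simp add: power_divide)
  have "3 * real (k + s + 2) \<le> 3 * (2 * real k + 2)" using k by simp
  also have "\<dots> \<le> 12 * real k" using ke by simp
  also have "\<dots> \<le> 4 * (real k + 1)\<^sup>2"
  proof -
    have "0 \<le> 4 * (real k - 1)\<^sup>2" by simp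
    then show ?thesis by (simp add: power2_eq_square algebra_simps)
  qed
  also have "\<dots> \<le> 4 * (real k + real e)\<^sup>2" using ke by (intro mult_left_mono power_mono) auto
  finally have "3 * real (k + s + 2) \<le> 2 ^ l" using L by linarith
  then have "real (k + s + 2) * (1 / 2 ^ l) \<le> 1 / 3" by (simp add: field_simps)
  moreover have "real (k + s + 2) * (1 - 1 / (40 * real e)) ^ (40 * (e * l)) \<le> real (k + s + 2) * (1 / 2 ^ l)"
    by (rule mult_left_mono[OF p]) simp
  ultimately show "real (r * s + s + 2) * (1 - 1 / (40 * real e)) ^ (40 * (e * l)) \<le> 1 / 3"
    unfolding k_def by linarith
qed

lemma calls_bound:
  assumes \<epsilon>: "0 < \<epsilon>" and s: "1 \<le> s" and r: "1 \<le> r" and ab: "0 < a" "a \<le> b" and rep: "represents a b \<epsilon>"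
    and e: "e = inv_eps a b" and l: "l = level (r * s) e" and N: "N = 40 * (e * l)"
  shows "real (machine.calls s r l N) \<le> soft_bound 542080 2 (real r * (real s)\<^sup>2 / \<epsilon>)"
proof -
  define k where "k = r * s"
  define T where "T = real r * (real s)\<^sup>2 / \<epsilon>"
  have eb: "1 \<le> e" "1 / real e \<le> \<epsilon>" "real e \<le> 4 / \<epsilon>" using inv_eps_bounds[OF ab rep] by (simp_all add: e)
  have k: "1 \<le> k" using s r by (simp add: k_def)
  have l1: "1 \<le> l" using level_upper(1)[OF k eb(1)] by (simp add: l k_def)
  have \<epsilon>4: "\<epsilon> \<le> 4"
  proof -
    have "1 \<le> 4 / \<epsilon>" using eb(1,3) by linarith
    then show ?thesis using \<epsilon> by simp
  qed
  have eq: "machine.calls s r l N = Suc k * N * (l + 3) + Suc s * N * (2 + k * (l * 7 + 1))"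
    by (simp add: machine.calls_def k_def)
  \<comment> \<open>The factor \<open>s\<close> inserted below brings the cheaper first phase to the
    common form s k e l^2. With N = 40 e l the constants are 2 * 40 * 4 = 320 here and 2 * 40 * 10 =
    800 for the second phase.\<close>
  have "Suc k * N * (l + 3) \<le> (2 * k) * N * (4 * l)" using k l1 by (intro mult_le_mono) auto
  also have "\<dots> = 320 * (k * e * l\<^sup>2)" by (simp add: N power2_eq_square)
  also have "\<dots> \<le> 320 * (s * (k * e * l\<^sup>2))" using s by simp
  finally have 1: "Suc k * N * (l + 3) \<le> 320 * (s * (k * e * l\<^sup>2))" .
  have "2 + k * (l * 7 + 1) \<le> 10 * (k * l)"
  proof -
    have "1 \<le> k * l" "k \<le> k * l" using k l1 by simp_all
    moreover have "k * (l * 7 + 1) = 7 * (k * l) + k" by (simp add: algebra_simps)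
    ultimately show ?thesis by linarith
  qed
  then have "Suc s * N * (2 + k * (l * 7 + 1)) \<le> (2 * s) * N * (10 * (k * l))" using s by (intro mult_le_mono) auto
  also have "\<dots> = 800 * (s * (k * e * l\<^sup>2))" by (simp add: N power2_eq_square)
  finally have "machine.calls s r l N \<le> 1120 * (s * (k * e * l\<^sup>2))" using 1 eq by simp
  then have "real (machine.calls s r l N) \<le> real (1120 * (s * (k * e * l\<^sup>2)))" by (simp only: of_nat_le_iff)
  also have "\<dots> = 1120 * (real r * (real s)\<^sup>2 * real e) * (real l)\<^sup>2" by (simp add: k_def power2_eq_square)
  finally have A: "real (machine.calls s r l N) \<le> 1120 * (real r * (real s)\<^sup>2 * real e) * (real l)\<^sup>2" .
  have B: "real r * (real s)\<^sup>2 * real e \<le> 4 * T"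
  proof -
    have "real r * (real s)\<^sup>2 * real e \<le> real r * (real s)\<^sup>2 * (4 / \<epsilon>)" using eb by (intro mult_left_mono) auto
    then show ?thesis by (simp add: T_def mult.commute mult.left_commute)
  qed
  have T0: "0 \<le> T" using \<epsilon> by (simp add: T_def)
  have rs1: "1 \<le> real r * (real s)\<^sup>2" "real k \<le> real r * (real s)\<^sup>2"
  proof -
    have a: "1 \<le> real r" "1 \<le> real s" using r s by simp_all
    then have "1 * 1 \<le> real r * (real s)\<^sup>2" by (intro mult_mono) auto
    then show "1 \<le> real r * (real s)\<^sup>2" by simp
    have "real s \<le> (real s)\<^sup>2" using a by (simp add: power2_eq_square)
    then show "real k \<le> real r * (real s)\<^sup>2" using a by (simp add: k_def mult_left_mono)
  qed
  have kT: "real k \<le> 4 * T"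
  proof -
    have "real k * \<epsilon> \<le> real k * 4" using \<epsilon>4 by (intro mult_left_mono) auto
    also have "\<dots> \<le> 4 * (real r * (real s)\<^sup>2)" using rs1 by simp
    finally show ?thesis using \<epsilon> by (simp add: T_def field_simps)
  qed
  have eT: "real e \<le> 4 * T"
  proof -
    have "real e \<le> 4 / \<epsilon> * 1" using eb by simp
    also have "\<dots> \<le> 4 / \<epsilon> * (real r * (real s)\<^sup>2)" using rs1 \<epsilon> by (intro mult_left_mono) auto
    finally show ?thesis by (simp add: T_def)
  qed
  have "real (2 ^ l) \<le> real (8 * (k + e)\<^sup>2)"
    using level_upper(2)[OF k eb(1)] by (simp only: of_nat_le_iff l k_def)
  then have "2 ^ l \<le> 8 * (real k + real e)\<^sup>2" by simp
  \<comment> \<open>Both \<open>k\<close> and \<open>e\<close> are at most 4 T, so their sum is at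
    most 8 (T + 2).\<close>
  also have "\<dots> \<le> 8 * (8 * (T + 2))\<^sup>2" using kT eT T0 by (intro mult_left_mono power_mono) auto
  also have "\<dots> = 2 ^ 9 * (T + 2)\<^sup>2" by (simp only: power_mult_distrib) simp
  finally have L: "2 ^ l \<le> 2 ^ 9 * (T + 2)\<^sup>2" .
  have lg: "1 \<le> log 2 (T + 2)" using T0 by simp
  have "real l = log 2 (2 ^ l)" by simp
  also have "\<dots> \<le> log 2 (2 ^ 9 * (T + 2)\<^sup>2)" using L T0 by (subst log_le_cancel_iff) auto
  also have "\<dots> = log 2 (2 ^ 9) + log 2 ((T + 2)\<^sup>2)" using T0 by (simp add: log_mult del: power_numeral)
  also have "\<dots> = 9 + 2 * log 2 (T + 2)" using T0 by (simp add: log_nat_power del: power_numeral)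
  \<comment> \<open>The 9 is absorbed because the shifted logarithm is at least 1.\<close>
  finally have "real l \<le> 11 * log 2 (T + 2)" using lg by linarith
  then have "(real l)\<^sup>2 \<le> (11 * log 2 (T + 2))\<^sup>2" by (intro power_mono) auto
  then have C: "(real l)\<^sup>2 \<le> 121 * (log 2 (T + 2))\<^sup>2" by (simp add: power_mult_distrib)
  have "1120 * (real r * (real s)\<^sup>2 * real e) * (real l)\<^sup>2 \<le> (1120 * (4 * T)) * (121 * (log 2 (T + 2))\<^sup>2)"
    by (rule mult_mono[OF mult_left_mono[OF B] C]) (use T0 in simp_all)
  \<comment> \<open>The constant is 1120 * 4 * 121, where 4 stems from the bound on \<open>e\<close>
    and 121 is the square of 11.\<close>
  also have "\<dots> = soft_bound 542080 2 T" by (simp add: soft_bound_def)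
  finally show ?thesis using A by (simp add: T_def)
qed

section \<open>Correctness and running time of the tester\<close>

lemma tester_correct:
  assumes s: "1 \<le> s" and r: "1 \<le> r" and ab: "0 < a" "a \<le> b" and rep: "represents a b \<epsilon>"
    and e: "e = inv_eps a b" and l: "l = level (r * s) e" and N: "N = 40 * (e * l)"
  shows "is_tester Tester (input n s r a b) n (term_unate_dnf n s r) \<epsilon> (machine.time n s r l N e) (machine.calls s r l N)"
  unfolding is_tester_def Let_def
proof (intro allI impI)
  fix f D assume D: "set_pmf D \<subseteq> cube n"
  interpret machine n f D s r l N .
  have eb: "1 \<le> e" "1 / real e \<le> \<epsilon>" using inv_eps_bounds[OF ab rep] by (simp_all add: e)
  have l0: "0 < l" unfolding l by (rule level_upper) (use s r eb in simp_all)
  note pars = algo_params[OF s r eb(1) l, folded N]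
  note run = ht_run[OF ht_Tester[OF D ab e l N]]
  let ?R = "run n f D (time e) ([Tester], input n s r a b, 0)"
  show "(\<forall>cfg\<in>set_pmf ?R. halted cfg \<and> oracle_calls cfg \<le> calls) \<and>
     (f \<in> term_unate_dnf n s r \<longrightarrow> 2 / 3 \<le> pr ?R accepting) \<and>
     (far_from D \<epsilon> f (term_unate_dnf n s r) \<longrightarrow> 2 / 3 \<le> pr ?R rejecting)"
  proof (intro conjI impI)
    show "\<forall>cfg\<in>set_pmf ?R. halted cfg \<and> oracle_calls cfg \<le> calls" by (rule run(1))
    show "2 / 3 \<le> pr ?R accepting" if "f \<in> term_unate_dnf n s r"
      unfolding run(2) by (rule algo_complete[OF that l0 pars(1)])
    assume far: "far_from D \<epsilon> f (term_unate_dnf n s r)"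
    have "pr (algo s r l N) (\<lambda>b. b) \<le> 1 / 3" by (rule algo_sound[OF D far eb l0 pars(2,3)])
    then show "2 / 3 \<le> pr ?R rejecting" unfolding run(3) pr_not by linarith
  qed
qed

text \<open>The represented fraction exceeds 1, hence so does \<epsilon>. The constant false
  function belongs to the class and no probability exceeds 1, so no function is far.\<close>

lemma tester_trivial:
  assumes ab: "b < a" and rep: "represents a b \<epsilon>"
  shows "is_tester Tester (input n s r a b) n (term_unate_dnf n s r) \<epsilon> 2 0"
  unfolding is_tester_def Let_def
proof (intro allI impI)
  fix f D assume D: "set_pmf D \<subseteq> cube n"
  interpret oracles n f D .
  have "dt (Set ''accept'' (Const 1)) (input n s r a b) 1 0 (\<lambda>\<sigma>'. \<sigma>' ''accept'' 0 = 1)"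
    by (rule dt_Assign) (simp add: put_apply)
  then have "ht (Set ''accept'' (Const 1)) (input n s r a b) 1 0 (return_pmf True) (\<lambda>\<sigma>' b. (\<sigma>' ''accept'' 0 = 1) = b)"
    by (rule ht_dt) simp
  moreover have "bval (Less (Elem ''eps'' (Const 1)) (Elem ''eps'' (Const 0))) (input n s r a b)"
    using ab by (simp add: input_def put_def)
  ultimately have "ht Tester (input n s r a b) (Suc 1) 0 (return_pmf True) (\<lambda>\<sigma>' b. (\<sigma>' ''accept'' 0 = 1) = b)"
    unfolding Tester_def by (intro ht_Cond) (simp only: if_True)
  note run = ht_run[OF this, unfolded Suc_1]
  let ?R = "run n f D 2 ([Tester], input n s r a b, 0)"
  show "(\<forall>cfg\<in>set_pmf ?R. halted cfg \<and> oracle_calls cfg \<le> 0) \<and>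
     (f \<in> term_unate_dnf n s r \<longrightarrow> 2 / 3 \<le> pr ?R accepting) \<and>
     (far_from D \<epsilon> f (term_unate_dnf n s r) \<longrightarrow> 2 / 3 \<le> pr ?R rejecting)"
  proof (intro conjI impI)
    show "\<forall>cfg\<in>set_pmf ?R. halted cfg \<and> oracle_calls cfg \<le> 0" by (rule run(1))
    show "2 / 3 \<le> pr ?R accepting" unfolding run(2) by simp
    assume far: "far_from D \<epsilon> f (term_unate_dnf n s r)"
    have "replicate n False \<in> cube n" by (simp add: cube_def)
    then have mem: "(\<lambda>_. False) \<in> term_unate_dnf n s r"
      unfolding term_unate_dnf_def term_monotone_dnf_def by (auto intro!: exI[of _ "{}"])
    have "\<epsilon> \<le> pr D (\<lambda>x. f x \<noteq> False)" by (rule bspec[OF far[unfolded far_from_def] mem])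
    also have "\<dots> \<le> 1" by (rule measure_pmf.prob_le_1)
    finally have "\<epsilon> \<le> 1" .
    moreover have "1 < real a / real b" "real a / real b \<le> \<epsilon>" using rep ab by (simp_all add: represents_def)
    ultimately show "2 / 3 \<le> pr ?R rejecting" by linarith
  qed
qed

text \<open>Tuples turn the uniform quantification over all parameters into a bound on a single set,
  the form that \<open>poly_on\<close> requires.\<close>

definition valid :: "(real \<times> nat \<times> nat \<times> nat \<times> nat \<times> nat) set" where
  "valid = {(\<epsilon>, n, s, r, a, b). 0 < \<epsilon> \<and> 1 \<le> s \<and> 1 \<le> r \<and> 0 < a \<and> a \<le> b \<and> represents a b \<epsilon>}"

lemma time_poly:
  "\<exists>C d. \<forall>\<epsilon> n s r a b. 0 < \<epsilon> \<and> 1 \<le> s \<and> 1 \<le> r \<and> 0 < a \<and> a \<le> b \<and> represents a b \<epsilon> \<longrightarrow>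
     (let e = inv_eps a b; l = level (r * s) e in
      real (machine.time n s r l (40 * (e * l)) e) \<le> C * (real n + real s + real r + 1 / \<epsilon>) ^ d)"
proof -
  define n s r :: "(real \<times> nat \<times> nat \<times> nat \<times> nat \<times> nat) \<Rightarrow> nat"
    where "n = (\<lambda>(\<epsilon>, n, s, r, a, b). n)" and "s = (\<lambda>(\<epsilon>, n, s, r, a, b). s)" and "r = (\<lambda>(\<epsilon>, n, s, r, a, b). r)"
  define e :: "(real \<times> nat \<times> nat \<times> nat \<times> nat \<times> nat) \<Rightarrow> nat" where "e = (\<lambda>(\<epsilon>, n, s, r, a, b). inv_eps a b)"
  define l where "l = (\<lambda>x. level (r x * s x) (e x))"
  define Z where "Z = (\<lambda>(\<epsilon> :: real, n :: nat, s :: nat, r :: nat, a :: nat, b :: nat). real n + real s + real r + 1 / \<epsilon>)"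
  have "1 \<le> Z x" if xv: "x \<in> valid" for x
  proof -
    obtain \<epsilon> n s r a b where x: "x = (\<epsilon>, n, s, r, a, b)" "0 < \<epsilon>" "1 \<le> s" using xv by (auto simp: valid_def)
    then have "1 \<le> real s" "0 \<le> 1 / \<epsilon>" by simp_all
    then show ?thesis unfolding x(1) Z_def case_prod_conv by linarith
  qed
  then have Z: "\<forall>x\<in>valid. 1 \<le> Z x" by blast
  note add = poly_on_add[of valid Z, OF Z] and mult = poly_on_mult[of valid Z, OF Z]
    and const = poly_on_const[of valid Z, OF Z] and self = poly_on_self[of valid Z, OF Z] and le = poly_on_le[of valid Z, OF Z]
  have n: "poly_on valid Z (\<lambda>x. real (n x))" by (rule le[OF self]) (auto simp: valid_def Z_def n_def)
  have s: "poly_on valid Z (\<lambda>x. real (s x))" by (rule le[OF self]) (auto simp: valid_def Z_def s_def)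
  have r: "poly_on valid Z (\<lambda>x. real (r x))" by (rule le[OF self]) (auto simp: valid_def Z_def r_def)
  have e: "poly_on valid Z (\<lambda>x. real (e x))"
  proof (rule le[OF mult[OF const[of 4] self]])
    fix x assume "x \<in> valid"
    then obtain \<epsilon> n s r a b where x: "x = (\<epsilon>, n, s, r, a, b)" and v: "0 < \<epsilon>" "0 < a" "a \<le> b" "represents a b \<epsilon>"
      by (auto simp: valid_def)
    have "real (e x) \<le> 4 * (1 / \<epsilon>)" using inv_eps_bounds(3)[OF v(2-4)] by (simp add: x e_def)
    also have "\<dots> \<le> 4 * Z x" by (simp add: x Z_def)
    finally show "0 \<le> real (e x) \<and> real (e x) \<le> 4 * Z x" by simp
  qed simp_all
  have "poly_on valid Z (\<lambda>x. 8 * ((real (r x) * real (s x) + real (e x)) * (real (r x) * real (s x) + real (e x))))"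
    by (intro add mult const r s e) simp_all
  then have l: "poly_on valid Z (\<lambda>x. real (l x))"
  proof (rule le)
    fix x assume "x \<in> valid"
    then have v: "1 \<le> r x * s x" "1 \<le> e x" using inv_eps_bounds(1) by (auto simp: valid_def r_def s_def e_def)
    \<comment> \<open>A crude bound suffices for the time: the level is at most its own power of
      two, and that power is polynomial by minimality.\<close>
    have "l x \<le> 2 ^ l x" by (rule less_imp_le[OF less_exp])
    also have "\<dots> \<le> 8 * (r x * s x + e x)\<^sup>2" unfolding l_def by (rule level_upper(2)[OF v])
    finally have "real (l x) \<le> real (8 * (r x * s x + e x)\<^sup>2)" by (simp only: of_nat_le_iff)
    then show "0 \<le> real (l x) \<and> real (l x) \<le> 8 * ((real (r x) * real (s x) + real (e x)) * (real (r x) * real (s x) + real (e x)))"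
      by (simp add: power2_eq_square)
  qed
  have "poly_on valid Z (\<lambda>x. real (machine.time (n x) (s x) (r x) (l x) (40 * (e x * l x)) (e x)))"
    unfolding machine.time_def machine.timeA_def machine.timeC_def of_nat_add of_nat_mult of_nat_Suc of_nat_numeral of_nat_1
    by (intro add mult const n s r e l) simp_all
  then obtain C d where C: "\<forall>x\<in>valid. real (machine.time (n x) (s x) (r x) (l x) (40 * (e x * l x)) (e x)) \<le> C * Z x ^ d"
    unfolding poly_on_def by blast
  show ?thesis
  proof (intro exI allI impI)
    fix \<epsilon> :: real and n' s' r' a b :: nat
    assume "0 < \<epsilon> \<and> 1 \<le> s' \<and> 1 \<le> r' \<and> 0 < a \<and> a \<le> b \<and> represents a b \<epsilon>"
    then have "(\<epsilon>, n', s', r', a, b) \<in> valid" by (simp add: valid_def)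
    from C[rule_format, OF this]
    show "let e = inv_eps a b; l = level (r' * s') e in
      real (machine.time n' s' r' l (40 * (e * l)) e) \<le> C * (real n' + real s' + real r' + 1 / \<epsilon>) ^ d"
      by (simp add: n_def s_def r_def e_def l_def Z_def Let_def)
  qed
qed

theorem theorem10:
  "\<exists>(P :: com) (c :: real) (k :: nat) (c' :: real) (k' :: nat).
     \<forall>(\<epsilon> :: real) (n :: nat) (s :: nat) (r :: nat) (a :: nat) (b :: nat).
       \<epsilon> > 0 \<and> s \<ge> 1 \<and> r \<ge> 1 \<and> represents a b \<epsilon> \<longrightarrow>
       (\<exists>t q. real t \<le> c' * (real n + real s + real r + 1 / \<epsilon>) ^ k' \<and>
              real q \<le> soft_bound c k (real r * (real s)\<^sup>2 / \<epsilon>) \<and>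
              is_tester P (input n s r a b) n (term_unate_dnf n s r) \<epsilon> t q)"
proof -
  obtain C d where C: "\<forall>\<epsilon> n s r a b. 0 < \<epsilon> \<and> 1 \<le> s \<and> 1 \<le> r \<and> 0 < a \<and> a \<le> b \<and> represents a b \<epsilon> \<longrightarrow>
     (let e = inv_eps a b; l = level (r * s) e in
      real (machine.time n s r l (40 * (e * l)) e) \<le> C * (real n + real s + real r + 1 / \<epsilon>) ^ d)"
    using time_poly by blast
  \<comment> \<open>The absolute value makes the constant nonnegative, and the added 2 covers the
    two steps of the trivial case.\<close>
  have "\<exists>t q. real t \<le> (\<bar>C\<bar> + 2) * (real n + real s + real r + 1 / \<epsilon>) ^ d \<and>
              real q \<le> soft_bound 542080 2 (real r * (real s)\<^sup>2 / \<epsilon>) \<and>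
              is_tester Tester (input n s r a b) n (term_unate_dnf n s r) \<epsilon> t q"
    if v: "\<epsilon> > 0" "s \<ge> 1" "r \<ge> 1" "represents a b \<epsilon>" for \<epsilon> n s r a b
  proof -
    have a: "0 < a" using v(4) by (simp add: represents_def)
    have "1 \<le> real n + real s + real r + 1 / \<epsilon>" using v by (simp add: add_increasing2)
    then have Z: "1 \<le> (real n + real s + real r + 1 / \<epsilon>) ^ d" by (rule one_le_power)
    show ?thesis
    proof (cases "a \<le> b")
      case True
      define e where "e = inv_eps a b"
      define l where "l = level (r * s) e"
      have "real (machine.time n s r l (40 * (e * l)) e) \<le> C * (real n + real s + real r + 1 / \<epsilon>) ^ d"
        using C v a True unfolding e_def l_def Let_def by blast
      also have "\<dots> \<le> (\<bar>C\<bar> + 2) * (real n + real s + real r + 1 / \<epsilon>) ^ d"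
        using Z by (intro mult_right_mono) auto
      finally show ?thesis
        using calls_bound[OF v(1-3) a True v(4) e_def l_def refl] tester_correct[OF v(2,3) a True v(4) e_def l_def refl, of n]
        by blast
    next
      case False
      have "real 2 \<le> (\<bar>C\<bar> + 2) * 1" by simp
      also have "\<dots> \<le> (\<bar>C\<bar> + 2) * (real n + real s + real r + 1 / \<epsilon>) ^ d"
        using Z by (intro mult_left_mono) auto
      finally have "real 2 \<le> (\<bar>C\<bar> + 2) * (real n + real s + real r + 1 / \<epsilon>) ^ d" .
      moreover have "real 0 \<le> soft_bound 542080 2 (real r * (real s)\<^sup>2 / \<epsilon>)"
        using v(1) by (simp add: soft_bound_def)
      ultimately show ?thesis using tester_trivial[OF _ v(4), of n s r] False by (meson not_le)
    qed
  qed
  then show ?thesis by blast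
qed

end
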